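(* Let $F^{n}=(M^{n},L)$ be a Landsberg space, let $b_i(x,y)$ be an $h$-vector in $F^n$, and let ${}^{*}F^{n}=(M^{n},{}^{*}L)$ be the Finsler space obtained by the Kropina change with $h$-vector ${}^{*}L(x,y)=L^2(x,y)/(b_i(x,y)y^i)$. Let $F^{n-1}$ and ${}^{*}F^{n-1}$ be the Finslerian hypersurfaces of $F^n$ and ${}^{*}F^n$, respectively, with the same underlying hypersurface $M^{n-1}$ of $M^n$. Suppose that the $h$-vector $b_i$ is a gradient and is tangential to the hypersurface $F^{n-1}$. Then: 1. ${}^{*}F^{n-1}$ is a hyperplane of the second kind if $F^{n-1}$ is a hyperplane of the second kind and $M_{\alpha\beta}=0$, where $M_{\alpha\beta}$ is the second fundamental $v$-tensor of $F^{n-1}$. 2. ${}^{*}F^{n-1}$ is a hyperplane of the third kind if $F^{n-1}$ is a hyperplane of the third kind.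
   Context: Notation: $\partial_i=\partial/\partial x^i$, $\dot\partial_i=\partial/\partial y^i$; the summation convention is used. Latin indices run over $1,\dots,n$, Greek indices over $1,\dots,n-1$. Finsler space: $F^n=(M^n,L)$ is an $n$-dimensional smooth manifold with Finsler metric function $L(x,y)$. Set $l_i=\dot\partial_iL$, $g_{ij}=\tfrac12\dot\partial_i\dot\partial_jL^2$, $h_{ij}=L\,\dot\partial_i\dot\partial_jL$, $C_{ijk}=\tfrac12\dot\partial_kg_{ij}$, $C^{h}_{ij}=g^{hk}C_{ijk}$. Cartan connection $C\Gamma=(F^i_{jk},G^i_j,C^i_{jk})$ of $F^n$: $G^i=\tfrac14g^{ir}(y^j\dot\partial_r\partial_jL^2-\partial_rL^2)$, $G^i_j=\dot\partial_jG^i$, and with $\delta_k=\partial_k-G^h_k\dot\partial_h$, $F^i_{jk}=\tfrac12g^{ir}(\delta_kg_{rj}+\delta_jg_{rk}-\delta_rg_{jk})$. For a covariant vector field $X_i(x,y)$ the $h$- and $v$-covariant derivatives are $X_{i|j}=\partial_jX_i-(\dot\partial_hX_i)G^h_j-F^r_{ij}X_r$ and $X_i|_j=\dot\partial_jX_i-C^r_{ij}X_r$. The $h$-covariant derivative extends to tensors as usual: $C^r_{ij|k}=\delta_kC^r_{ij}+C^h_{ij}F^r_{hk}-C^r_{hj}F^h_{ik}-C^r_{ih}F^h_{jk}$. Landsberg space: $F^n$ is a Landsberg space if its $(v)hv$-torsion tensor vanishes, i.e. $P^r_{ij}=C^r_{ij|k}\,y^k=0$. $h$-vector: $b_i(x,y)$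 is an $h$-vector in $F^n$ if (i) $b_i|_k=0$ and (ii) $L\,C^h_{ij}b_h=\rho\,h_{ij}$ for a scalar function $\rho\neq0$. (By a known result of Izumi, $\rho$ is independent of $y$.) It is a gradient if $b_{i|j}=b_{j|i}$. Kropina change: put $\beta=b_iy^i$ (nonzero where ${}^{*}L$ is considered). ${}^{*}F^n=(M^n,{}^{*}L)$ is assumed to be a Finsler space; quantities marked with an asterisk are those formed from ${}^{*}L$ in the same way. Hypersurface: $M^{n-1}$ is given by $x^i=x^i(u^\alpha)$, with $B^i_\alpha=\partial x^i/\partial u^\alpha$ of rank $n-1$; the supporting element is tangent to $M^{n-1}$: $y^i=B^i_\alpha(u)v^\alpha$. $F^{n-1}=(M^{n-1},\underline L)$ with $\underline L(u,v)=L(x(u),y(u,v))$, and ${}^{*}F^{n-1}=(M^{n-1},{}^{*}\underline L)$ with ${}^{*}\underline L(u,v)={}^{*}L(x(u),y(u,v))$. Ambient quantities are evaluated at $(x(u),y(u,v))$. The unit normal $N^i(u,v)$ of $F^{n-1}$ is defined by $g_{ij}B^i_\alpha N^j=0$, $g_{ij}N^iN^j=1$, and $N_i=g_{ij}N^j$; similarly ${}^{*}N^i$ for ${}^{*}F^{n-1}$ using ${}^{*}g_{ij}$, and ${}^{*}N_i={}^{*}g_{ij}{}^{*}N^j$. The vector $b_i$ is tangential to $F^{n-1}$ if $b_iN^i=0$ along $F^{n-1}$. Fundamental tensors of $F^{n-1}$: with $B^i_{\alpha\beta}=\partial^2x^i/\partial u^\alpha\partial u^\beta$ and $B^i_{0\alpha}=B^i_{\beta\alpha}v^\beta$,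 put $M_\alpha=C_{ijk}B^i_\alpha N^jN^k$, $H_\alpha=N_i(B^i_{0\alpha}+G^i_jB^j_\alpha)$ (normal curvature vector), $H_{\alpha\beta}=N_i(B^i_{\alpha\beta}+F^i_{jk}B^j_\alpha B^k_\beta)+M_\alpha H_\beta$ (second fundamental $h$-tensor), $M_{\alpha\beta}=C_{ijk}B^i_\alpha B^j_\beta N^k$ (second fundamental $v$-tensor). For ${}^{*}F^{n-1}$ the tensors ${}^{*}M_\alpha,{}^{*}H_\alpha,{}^{*}H_{\alpha\beta},{}^{*}M_{\alpha\beta}$ are given by the same formulas with ${}^{*}N,{}^{*}G,{}^{*}F,{}^{*}C$ and the same $B^i_\alpha$. Hyperplanes (Matsumoto's characterizations, to be taken as definitions): $F^{n-1}$ is a hyperplane of the second kind if and only if $H_{\alpha\beta}=0$, and a hyperplane of the third kind if and only if $H_{\alpha\beta}=0=M_{\alpha\beta}$; likewise for ${}^{*}F^{n-1}$ with the starred tensors. *)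

theory Defs
  imports "HOL-Analysis.Analysis"
begin

section \<open>Smooth functions and smooth manifolds\<close>

primrec Ck_on ::
  "nat \<Rightarrow> 'a::real_normed_vector set \<Rightarrow> ('a \<Rightarrow> 'b::real_normed_vector) \<Rightarrow> bool"
where
  "Ck_on 0 S f \<longleftrightarrow> continuous_on S f"
| "Ck_on (Suc k) S f \<longleftrightarrow>
     (\<forall>x\<in>S. f differentiable (at x)) \<and>
     (\<forall>h. Ck_on k S (\<lambda>x. frechet_derivative f (at x) h))"

text \<open>Derivatives are taken in the full space, so this is only used for open sets.\<close>

definition smooth_on ::
  "'a::real_normed_vector set \<Rightarrow> ('a \<Rightarrow> 'b::real_normed_vector) \<Rightarrow> bool"
where "smooth_on S f \<longleftrightarrow> (\<forall>k. Ck_on k S f)"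

type_synonym ('p, 'n) chart = "'p set \<times> ('p \<Rightarrow> real^'n)"

abbreviation chart_dom :: "('p, 'n::finite) chart \<Rightarrow> 'p set" where "chart_dom \<equiv> fst"
abbreviation chart_map :: "('p, 'n::finite) chart \<Rightarrow> 'p \<Rightarrow> real^'n" where "chart_map \<equiv> snd"

definition chart_inv :: "('p, 'n::finite) chart \<Rightarrow> real^'n \<Rightarrow> 'p"
where "chart_inv c = inv_into (chart_dom c) (chart_map c)"

definition overlap :: "('p, 'n::finite) chart \<Rightarrow> ('p, 'n) chart \<Rightarrow> (real^'n) set"
where "overlap c c' = chart_map c ` (chart_dom c \<inter> chart_dom c')"

definition transition :: "('p, 'n::finite) chart \<Rightarrow> ('p, 'n) chart \<Rightarrow> real^'n \<Rightarrow> real^'n"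
where "transition c c' = chart_map c' \<circ> chart_inv c"

definition smooth_manifold :: "'p topology \<Rightarrow> ('p, 'n::finite) chart set \<Rightarrow> bool"
where "smooth_manifold X A \<longleftrightarrow>
    Hausdorff_space X \<and> second_countable X \<and>
    (\<Union>c\<in>A. chart_dom c) = topspace X \<and>
    (\<forall>c\<in>A. openin X (chart_dom c) \<and> open (chart_map c ` chart_dom c) \<and>
       homeomorphic_map (subtopology X (chart_dom c))
         (top_of_set (chart_map c ` chart_dom c)) (chart_map c)) \<and>
    (\<forall>c\<in>A. \<forall>c'\<in>A. smooth_on (overlap c c') (transition c c'))"


section \<open>Finsler geometry in one coordinate chart\<close>

text \<open>A pair \<open>(x, y)\<close> holds the coordinates \<open>x\<^sup>i\<close> of a point and the components \<open>y\<^sup>i\<close> of a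
  tangent vector at it.  \<open>pdx i\<close> and \<open>pdy i\<close> are the partial derivatives with respect to
  \<open>x\<^sup>i\<close> and \<open>y\<^sup>i\<close>.\<close>

type_synonym 'n tvec = "(real^'n) \<times> (real^'n)"

definition pdx :: "'n::finite \<Rightarrow> ('n tvec \<Rightarrow> real) \<Rightarrow> 'n tvec \<Rightarrow> real"
where "pdx i f z = frechet_derivative f (at z) (axis i 1, 0)"

definition pdy :: "'n::finite \<Rightarrow> ('n tvec \<Rightarrow> real) \<Rightarrow> 'n tvec \<Rightarrow> real"
where "pdy i f z = frechet_derivative f (at z) (0, axis i 1)"

definition metric :: "('n::finite tvec \<Rightarrow> real) \<Rightarrow> 'n \<Rightarrow> 'n \<Rightarrow> 'n tvec \<Rightarrow> real"
where "metric L i j z = 1/2 * pdy i (pdy j (\<lambda>w. (L w)\<^sup>2)) z"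

definition metric_mat :: "('n::finite tvec \<Rightarrow> real) \<Rightarrow> 'n tvec \<Rightarrow> real^'n^'n"
where "metric_mat L z = (\<chi> i j. metric L i j z)"

definition metric_inv :: "('n::finite tvec \<Rightarrow> real) \<Rightarrow> 'n \<Rightarrow> 'n \<Rightarrow> 'n tvec \<Rightarrow> real"
where "metric_inv L i j z = matrix_inv (metric_mat L z) $ i $ j"

definition angular :: "('n::finite tvec \<Rightarrow> real) \<Rightarrow> 'n \<Rightarrow> 'n \<Rightarrow> 'n tvec \<Rightarrow> real"
where "angular L i j z = L z * pdy i (pdy j L) z"

definition cartan_low :: "('n::finite tvec \<Rightarrow> real) \<Rightarrow> 'n \<Rightarrow> 'n \<Rightarrow> 'n \<Rightarrow> 'n tvec \<Rightarrow> real"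
where "cartan_low L i j k z = 1/2 * pdy k (metric L i j) z"

text \<open>\<open>cartan L h i j\<close> is \<open>C\<^sup>h\<^bsub>ij\<^esub>\<close>: in all mixed tensors below the contravariant index
  comes first.\<close>

definition cartan :: "('n::finite tvec \<Rightarrow> real) \<Rightarrow> 'n \<Rightarrow> 'n \<Rightarrow> 'n \<Rightarrow> 'n tvec \<Rightarrow> real"
where "cartan L h i j z = (\<Sum>k\<in>UNIV. metric_inv L h k z * cartan_low L i j k z)"

definition spray :: "('n::finite tvec \<Rightarrow> real) \<Rightarrow> 'n \<Rightarrow> 'n tvec \<Rightarrow> real"
where "spray L i z = 1/4 * (\<Sum>r\<in>UNIV. metric_inv L i r z *
    ((\<Sum>j\<in>UNIV. snd z $ j * pdy r (pdx j (\<lambda>w. (L w)\<^sup>2)) z) - pdx r (\<lambda>w. (L w)\<^sup>2) z))"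

definition nonlin :: "('n::finite tvec \<Rightarrow> real) \<Rightarrow> 'n \<Rightarrow> 'n \<Rightarrow> 'n tvec \<Rightarrow> real"
where "nonlin L i j z = pdy j (spray L i) z"

definition delta :: "('n::finite tvec \<Rightarrow> real) \<Rightarrow> 'n \<Rightarrow> ('n tvec \<Rightarrow> real) \<Rightarrow> 'n tvec \<Rightarrow> real"
where "delta L k f z = pdx k f z - (\<Sum>h\<in>UNIV. nonlin L h k z * pdy h f z)"

definition cartan_conn :: "('n::finite tvec \<Rightarrow> real) \<Rightarrow> 'n \<Rightarrow> 'n \<Rightarrow> 'n \<Rightarrow> 'n tvec \<Rightarrow> real"
where "cartan_conn L i j k z = 1/2 * (\<Sum>r\<in>UNIV. metric_inv L i r z *
    (delta L k (metric L r j) z + delta L j (metric L r k) z - delta L r (metric L j k) z))"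

text \<open>\<open>hcov L X i j\<close> and \<open>vcov L X i j\<close> are \<open>X\<^bsub>i|j\<^esub>\<close> and \<open>X\<^sub>i|\<^sub>j\<close> for a covariant vector field.\<close>

definition hcov :: "('n::finite tvec \<Rightarrow> real) \<Rightarrow> ('n tvec \<Rightarrow> real^'n) \<Rightarrow> 'n \<Rightarrow> 'n \<Rightarrow> 'n tvec \<Rightarrow> real"
where "hcov L X i j z = pdx j (\<lambda>w. X w $ i) z
    - (\<Sum>h\<in>UNIV. pdy h (\<lambda>w. X w $ i) z * nonlin L h j z)
    - (\<Sum>r\<in>UNIV. cartan_conn L r i j z * X z $ r)"

definition vcov :: "('n::finite tvec \<Rightarrow> real) \<Rightarrow> ('n tvec \<Rightarrow> real^'n) \<Rightarrow> 'n \<Rightarrow> 'n \<Rightarrow> 'n tvec \<Rightarrow> real"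
where "vcov L X i j z = pdy j (\<lambda>w. X w $ i) z - (\<Sum>r\<in>UNIV. cartan L r i j z * X z $ r)"

definition cartan_hcov ::
  "('n::finite tvec \<Rightarrow> real) \<Rightarrow> 'n \<Rightarrow> 'n \<Rightarrow> 'n \<Rightarrow> 'n \<Rightarrow> 'n tvec \<Rightarrow> real"
where "cartan_hcov L r i j k z = delta L k (cartan L r i j) z
    + (\<Sum>h\<in>UNIV. cartan L h i j z * cartan_conn L r h k z)
    - (\<Sum>h\<in>UNIV. cartan L r h j z * cartan_conn L h i k z)
    - (\<Sum>h\<in>UNIV. cartan L r i h z * cartan_conn L h j k z)"

definition vhv_torsion :: "('n::finite tvec \<Rightarrow> real) \<Rightarrow> 'n \<Rightarrow> 'n \<Rightarrow> 'n \<Rightarrow> 'n tvec \<Rightarrow> real"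
where "vhv_torsion L r i j z = (\<Sum>k\<in>UNIV. cartan_hcov L r i j k z * snd z $ k)"


section \<open>Finsler spaces, h-vectors and the Kropina change\<close>

text \<open>Objects on the slit tangent bundle are families of local representatives indexed by the
  charts, subject to the classical transformation laws.\<close>

definition tangent_transition ::
  "('p, 'n::finite) chart \<Rightarrow> ('p, 'n) chart \<Rightarrow> 'n tvec \<Rightarrow> 'n tvec"
where "tangent_transition c c' z =
    (transition c c' (fst z), frechet_derivative (transition c c') (at (fst z)) (snd z))"

text \<open>A Kropina metric exists only where \<open>\<beta> \<noteq> 0\<close>.  Hence a Finsler metric function is
  allowed to live on an open conic subset of the slit tangent bundle, given in the chart \<open>c\<close> by
  \<open>D c\<close>, that meets every tangent space.  The metric tensor is required to be regular.  No sign
  of \<open>L\<close> and no definiteness is imposed, because \<open>\<beta>\<close>, and with it the changed metric function,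
  may be negative; positive definite metrics on the whole slit tangent bundle are a special case.\<close>

definition finsler_space ::
  "'p topology \<Rightarrow> ('p, 'n::finite) chart set \<Rightarrow> (('p, 'n) chart \<Rightarrow> 'n tvec set) \<Rightarrow>
   (('p, 'n) chart \<Rightarrow> 'n tvec \<Rightarrow> real) \<Rightarrow> bool"
where "finsler_space X A D L \<longleftrightarrow>
    smooth_manifold X A \<and>
    (\<forall>c\<in>A. open (D c) \<and> fst ` D c = chart_map c ` chart_dom c \<and>
       (\<forall>(x, y)\<in>D c. y \<noteq> 0 \<and>
          (\<forall>t>0. (x, t *\<^sub>R y) \<in> D c \<and> L c (x, t *\<^sub>R y) = t * L c (x, y))) \<and>
       smooth_on (D c) (L c) \<and>
       (\<forall>z\<in>D c. invertible (metric_mat (L c) z))) \<and>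
    (\<forall>c\<in>A. \<forall>c'\<in>A. \<forall>z. fst z \<in> overlap c c' \<longrightarrow>
       (z \<in> D c \<longleftrightarrow> tangent_transition c c' z \<in> D c') \<and>
       (z \<in> D c \<longrightarrow> L c' (tangent_transition c c' z) = L c z))"

definition landsberg_space ::
  "'p topology \<Rightarrow> ('p, 'n::finite) chart set \<Rightarrow> (('p, 'n) chart \<Rightarrow> 'n tvec set) \<Rightarrow>
   (('p, 'n) chart \<Rightarrow> 'n tvec \<Rightarrow> real) \<Rightarrow> bool"
where "landsberg_space X A D L \<longleftrightarrow>
    finsler_space X A D L \<and>
    (\<forall>c\<in>A. \<forall>z\<in>D c. \<forall>r i j. vhv_torsion (L c) r i j z = 0)"

definition covector_field ::
  "('p, 'n::finite) chart set \<Rightarrow> (('p, 'n) chart \<Rightarrow> 'n tvec set) \<Rightarrow>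
   (('p, 'n) chart \<Rightarrow> 'n tvec \<Rightarrow> real^'n) \<Rightarrow> bool"
where "covector_field A D b \<longleftrightarrow>
    (\<forall>c\<in>A. smooth_on (D c) (b c)) \<and>
    (\<forall>c\<in>A. \<forall>c'\<in>A. \<forall>z\<in>D c. fst z \<in> overlap c c' \<longrightarrow>
       (\<forall>i. b c z $ i = (\<Sum>j\<in>UNIV. b c' (tangent_transition c c' z) $ j *
          frechet_derivative (transition c c') (at (fst z)) (axis i 1) $ j)))"

text \<open>The function \<open>\<rho>\<close> may depend on \<open>(x, y)\<close>.  Since the angular metric tensor is nonzero for
  \<open>n \<ge> 2\<close>, condition (ii) determines \<open>\<rho>\<close>, so its invariance under coordinate changes need not
  be required.\<close>

definition h_vector ::
  "('p, 'n::finite) chart set \<Rightarrow> (('p, 'n) chart \<Rightarrow> 'n tvec set) \<Rightarrow>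
   (('p, 'n) chart \<Rightarrow> 'n tvec \<Rightarrow> real) \<Rightarrow> (('p, 'n) chart \<Rightarrow> 'n tvec \<Rightarrow> real^'n) \<Rightarrow> bool"
where "h_vector A D L b \<longleftrightarrow>
    covector_field A D b \<and>
    (\<forall>c\<in>A. \<forall>z\<in>D c. \<forall>i k. vcov (L c) (b c) i k z = 0) \<and>
    (\<exists>\<rho> :: ('p, 'n) chart \<Rightarrow> 'n tvec \<Rightarrow> real. \<forall>c\<in>A. \<forall>z\<in>D c. \<rho> c z \<noteq> 0 \<and>
       (\<forall>i j. L c z * (\<Sum>h\<in>UNIV. cartan (L c) h i j z * b c z $ h) = \<rho> c z * angular (L c) i j z))"

definition gradient_field ::
  "('p, 'n::finite) chart set \<Rightarrow> (('p, 'n) chart \<Rightarrow> 'n tvec set) \<Rightarrow>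
   (('p, 'n) chart \<Rightarrow> 'n tvec \<Rightarrow> real) \<Rightarrow> (('p, 'n) chart \<Rightarrow> 'n tvec \<Rightarrow> real^'n) \<Rightarrow> bool"
where "gradient_field A D L b \<longleftrightarrow>
    (\<forall>c\<in>A. \<forall>z\<in>D c. \<forall>i j. hcov (L c) (b c) i j z = hcov (L c) (b c) j i z)"

definition beta :: "('n::finite tvec \<Rightarrow> real^'n) \<Rightarrow> 'n tvec \<Rightarrow> real"
where "beta b z = (\<Sum>i\<in>UNIV. b z $ i * snd z $ i)"

definition kropina_dom ::
  "(('p, 'n::finite) chart \<Rightarrow> 'n tvec set) \<Rightarrow> (('p, 'n) chart \<Rightarrow> 'n tvec \<Rightarrow> real^'n) \<Rightarrow>
   ('p, 'n) chart \<Rightarrow> 'n tvec set"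
where "kropina_dom D b c = {z \<in> D c. beta (b c) z \<noteq> 0}"

definition kropina ::
  "(('p, 'n::finite) chart \<Rightarrow> 'n tvec \<Rightarrow> real) \<Rightarrow> (('p, 'n) chart \<Rightarrow> 'n tvec \<Rightarrow> real^'n) \<Rightarrow>
   ('p, 'n) chart \<Rightarrow> 'n tvec \<Rightarrow> real"
where "kropina L b c z = (L c z)\<^sup>2 / beta (b c) z"


section \<open>Hypersurfaces\<close>

text \<open>\<open>loc_map f c d\<close>, defined on \<open>loc_dom f c d\<close>, is the map \<open>x\<^sup>i = x\<^sup>i(u\<^sup>\<alpha>)\<close> that
  represents \<open>f\<close> in the chart \<open>d\<close> of the hypersurface and the chart \<open>c\<close> of the ambient manifold.\<close>

definition loc_dom ::
  "('q \<Rightarrow> 'p) \<Rightarrow> ('p, 'n::finite) chart \<Rightarrow> ('q, 'm::finite) chart \<Rightarrow> (real^'m) set"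
where "loc_dom f c d = chart_map d ` {q \<in> chart_dom d. f q \<in> chart_dom c}"

definition loc_map ::
  "('q \<Rightarrow> 'p) \<Rightarrow> ('p, 'n::finite) chart \<Rightarrow> ('q, 'm::finite) chart \<Rightarrow> real^'m \<Rightarrow> real^'n"
where "loc_map f c d = chart_map c \<circ> f \<circ> chart_inv d"

text \<open>\<open>proj x i \<alpha>\<close> is \<open>B\<^sup>i\<^bsub>\<alpha>\<^esub>\<close> and \<open>proj2 x i \<alpha> \<beta>\<close> is \<open>B\<^sup>i\<^bsub>\<alpha>\<beta>\<^esub>\<close>.\<close>

definition proj :: "(real^'m::finite \<Rightarrow> real^'n::finite) \<Rightarrow> 'n \<Rightarrow> 'm \<Rightarrow> real^'m \<Rightarrow> real"
where "proj x i \<alpha> u = frechet_derivative (\<lambda>u'. x u' $ i) (at u) (axis \<alpha> 1)"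

definition proj2 :: "(real^'m::finite \<Rightarrow> real^'n::finite) \<Rightarrow> 'n \<Rightarrow> 'm \<Rightarrow> 'm \<Rightarrow> real^'m \<Rightarrow> real"
where "proj2 x i \<alpha> \<beta> u = frechet_derivative (proj x i \<beta>) (at u) (axis \<alpha> 1)"

definition hypersurface ::
  "'p topology \<Rightarrow> ('p, 'n::finite) chart set \<Rightarrow> 'q topology \<Rightarrow> ('q, 'm::finite) chart set \<Rightarrow>
   ('q \<Rightarrow> 'p) \<Rightarrow> bool"
where "hypersurface X A Y E f \<longleftrightarrow>
    smooth_manifold X A \<and> smooth_manifold Y E \<and> CARD('n) = CARD('m) + 1 \<and>
    continuous_map Y X f \<and>
    (\<forall>c\<in>A. \<forall>d\<in>E. smooth_on (loc_dom f c d) (loc_map f c d) \<and>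
       (\<forall>u\<in>loc_dom f c d.
          rank ((\<chi> i \<alpha>. proj (loc_map f c d) i \<alpha> u) :: real^'m^'n) = CARD('m)))"

text \<open>The point \<open>(x(u), y(u, v))\<close> at which ambient quantities are evaluated, where
  \<open>y\<^sup>i = B\<^sup>i\<^bsub>\<alpha>\<^esub> v\<^sup>\<alpha>\<close>.\<close>

definition lift :: "(real^'m::finite \<Rightarrow> real^'n::finite) \<Rightarrow> 'm tvec \<Rightarrow> 'n tvec"
where "lift x w = (x (fst w), \<chi> i. \<Sum>\<alpha>\<in>UNIV. proj x i \<alpha> (fst w) * snd w $ \<alpha>)"

text \<open>The pairs \<open>(u, v)\<close> at which the induced metric function \<open>L(x(u), y(u, v))\<close> is defined.\<close>

definition sub_dom ::
  "(('p, 'n::finite) chart \<Rightarrow> 'n tvec set) \<Rightarrow> ('q \<Rightarrow> 'p) \<Rightarrow>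
   ('p, 'n) chart \<Rightarrow> ('q, 'm::finite) chart \<Rightarrow> 'm tvec set"
where "sub_dom D f c d = {w. fst w \<in> loc_dom f c d \<and> lift (loc_map f c d) w \<in> D c}"

text \<open>The components of a unit normal are given for each pair of charts.  The sign of the normal
  is left free; changing it only changes the signs of the tensors \<open>H\<^bsub>\<alpha>\<beta>\<^esub>\<close> and \<open>M\<^bsub>\<alpha>\<beta>\<^esub>\<close>.\<close>

definition unit_normal ::
  "('p, 'n::finite) chart set \<Rightarrow> (('p, 'n) chart \<Rightarrow> 'n tvec set) \<Rightarrow>
   (('p, 'n) chart \<Rightarrow> 'n tvec \<Rightarrow> real) \<Rightarrow> ('q, 'm::finite) chart set \<Rightarrow> ('q \<Rightarrow> 'p) \<Rightarrow>
   (('p, 'n) chart \<Rightarrow> ('q, 'm) chart \<Rightarrow> 'm tvec \<Rightarrow> real^'n) \<Rightarrow> bool"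
where "unit_normal A D L E f N \<longleftrightarrow>
    (\<forall>c\<in>A. \<forall>d\<in>E. \<forall>w\<in>sub_dom D f c d.
       (\<forall>\<alpha>. (\<Sum>i\<in>UNIV. \<Sum>j\<in>UNIV. metric (L c) i j (lift (loc_map f c d) w) *
          proj (loc_map f c d) i \<alpha> (fst w) * N c d w $ j) = 0) \<and>
       (\<Sum>i\<in>UNIV. \<Sum>j\<in>UNIV. metric (L c) i j (lift (loc_map f c d) w) *
          N c d w $ i * N c d w $ j) = 1)"

definition tangential ::
  "('p, 'n::finite) chart set \<Rightarrow> (('p, 'n) chart \<Rightarrow> 'n tvec set) \<Rightarrow>
   (('p, 'n) chart \<Rightarrow> 'n tvec \<Rightarrow> real^'n) \<Rightarrow> ('q, 'm::finite) chart set \<Rightarrow> ('q \<Rightarrow> 'p) \<Rightarrow>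
   (('p, 'n) chart \<Rightarrow> ('q, 'm) chart \<Rightarrow> 'm tvec \<Rightarrow> real^'n) \<Rightarrow> bool"
where "tangential A D b E f N \<longleftrightarrow>
    (\<forall>c\<in>A. \<forall>d\<in>E. \<forall>w\<in>sub_dom D f c d.
       (\<Sum>i\<in>UNIV. b c (lift (loc_map f c d) w) $ i * N c d w $ i) = 0)"

text \<open>In the following definitions \<open>L\<close>, \<open>x\<close> and \<open>N\<close> are the representatives in fixed charts.\<close>

definition normal_low ::
  "('n::finite tvec \<Rightarrow> real) \<Rightarrow> (real^'m::finite \<Rightarrow> real^'n) \<Rightarrow> ('m tvec \<Rightarrow> real^'n) \<Rightarrow>
   'n \<Rightarrow> 'm tvec \<Rightarrow> real"
where "normal_low L x N i w = (\<Sum>j\<in>UNIV. metric L i j (lift x w) * N w $ j)"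

definition M_vec ::
  "('n::finite tvec \<Rightarrow> real) \<Rightarrow> (real^'m::finite \<Rightarrow> real^'n) \<Rightarrow> ('m tvec \<Rightarrow> real^'n) \<Rightarrow>
   'm \<Rightarrow> 'm tvec \<Rightarrow> real"
where "M_vec L x N \<alpha> w = (\<Sum>i\<in>UNIV. \<Sum>j\<in>UNIV. \<Sum>k\<in>UNIV.
    cartan_low L i j k (lift x w) * proj x i \<alpha> (fst w) * N w $ j * N w $ k)"

definition normal_curvature ::
  "('n::finite tvec \<Rightarrow> real) \<Rightarrow> (real^'m::finite \<Rightarrow> real^'n) \<Rightarrow> ('m tvec \<Rightarrow> real^'n) \<Rightarrow>
   'm \<Rightarrow> 'm tvec \<Rightarrow> real"
where "normal_curvature L x N \<alpha> w = (\<Sum>i\<in>UNIV. normal_low L x N i w *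
    ((\<Sum>\<beta>\<in>UNIV. proj2 x i \<beta> \<alpha> (fst w) * snd w $ \<beta>) +
     (\<Sum>j\<in>UNIV. nonlin L i j (lift x w) * proj x j \<alpha> (fst w))))"

definition second_h_tensor ::
  "('n::finite tvec \<Rightarrow> real) \<Rightarrow> (real^'m::finite \<Rightarrow> real^'n) \<Rightarrow> ('m tvec \<Rightarrow> real^'n) \<Rightarrow>
   'm \<Rightarrow> 'm \<Rightarrow> 'm tvec \<Rightarrow> real"
where "second_h_tensor L x N \<alpha> \<beta> w = (\<Sum>i\<in>UNIV. normal_low L x N i w *
    (proj2 x i \<alpha> \<beta> (fst w) +
     (\<Sum>j\<in>UNIV. \<Sum>k\<in>UNIV. cartan_conn L i j k (lift x w) *
        proj x j \<alpha> (fst w) * proj x k \<beta> (fst w)))) +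
    M_vec L x N \<alpha> w * normal_curvature L x N \<beta> w"

definition second_v_tensor ::
  "('n::finite tvec \<Rightarrow> real) \<Rightarrow> (real^'m::finite \<Rightarrow> real^'n) \<Rightarrow> ('m tvec \<Rightarrow> real^'n) \<Rightarrow>
   'm \<Rightarrow> 'm \<Rightarrow> 'm tvec \<Rightarrow> real"
where "second_v_tensor L x N \<alpha> \<beta> w = (\<Sum>i\<in>UNIV. \<Sum>j\<in>UNIV. \<Sum>k\<in>UNIV.
    cartan_low L i j k (lift x w) * proj x i \<alpha> (fst w) * proj x j \<beta> (fst w) * N w $ k)"

definition h_tensor_vanishes ::
  "('p, 'n::finite) chart set \<Rightarrow> (('p, 'n) chart \<Rightarrow> 'n tvec set) \<Rightarrow>
   (('p, 'n) chart \<Rightarrow> 'n tvec \<Rightarrow> real) \<Rightarrow> ('q, 'm::finite) chart set \<Rightarrow> ('q \<Rightarrow> 'p) \<Rightarrow>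
   (('p, 'n) chart \<Rightarrow> ('q, 'm) chart \<Rightarrow> 'm tvec \<Rightarrow> real^'n) \<Rightarrow> bool"
where "h_tensor_vanishes A D L E f N \<longleftrightarrow>
    (\<forall>c\<in>A. \<forall>d\<in>E. \<forall>w\<in>sub_dom D f c d. \<forall>\<alpha> \<beta>.
       second_h_tensor (L c) (loc_map f c d) (N c d) \<alpha> \<beta> w = 0)"

definition v_tensor_vanishes ::
  "('p, 'n::finite) chart set \<Rightarrow> (('p, 'n) chart \<Rightarrow> 'n tvec set) \<Rightarrow>
   (('p, 'n) chart \<Rightarrow> 'n tvec \<Rightarrow> real) \<Rightarrow> ('q, 'm::finite) chart set \<Rightarrow> ('q \<Rightarrow> 'p) \<Rightarrow>
   (('p, 'n) chart \<Rightarrow> ('q, 'm) chart \<Rightarrow> 'm tvec \<Rightarrow> real^'n) \<Rightarrow> bool"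
where "v_tensor_vanishes A D L E f N \<longleftrightarrow>
    (\<forall>c\<in>A. \<forall>d\<in>E. \<forall>w\<in>sub_dom D f c d. \<forall>\<alpha> \<beta>.
       second_v_tensor (L c) (loc_map f c d) (N c d) \<alpha> \<beta> w = 0)"

text \<open>Matsumoto's characterizations of the hyperplanes of the second and third kind, taken as
  definitions.\<close>

definition hyperplane_second_kind ::
  "('p, 'n::finite) chart set \<Rightarrow> (('p, 'n) chart \<Rightarrow> 'n tvec set) \<Rightarrow>
   (('p, 'n) chart \<Rightarrow> 'n tvec \<Rightarrow> real) \<Rightarrow> ('q, 'm::finite) chart set \<Rightarrow> ('q \<Rightarrow> 'p) \<Rightarrow>
   (('p, 'n) chart \<Rightarrow> ('q, 'm) chart \<Rightarrow> 'm tvec \<Rightarrow> real^'n) \<Rightarrow> bool"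
where "hyperplane_second_kind A D L E f N \<longleftrightarrow> h_tensor_vanishes A D L E f N"

definition hyperplane_third_kind ::
  "('p, 'n::finite) chart set \<Rightarrow> (('p, 'n) chart \<Rightarrow> 'n tvec set) \<Rightarrow>
   (('p, 'n) chart \<Rightarrow> 'n tvec \<Rightarrow> real) \<Rightarrow> ('q, 'm::finite) chart set \<Rightarrow> ('q \<Rightarrow> 'p) \<Rightarrow>
   (('p, 'n) chart \<Rightarrow> ('q, 'm) chart \<Rightarrow> 'm tvec \<Rightarrow> real^'n) \<Rightarrow> bool"
where "hyperplane_third_kind A D L E f N \<longleftrightarrow>
    h_tensor_vanishes A D L E f N \<and> v_tensor_vanishes A D L E f N"

end

theory Submission
  imports Defs
begin

text \<open>Put \<open>E = L\<^sup>2/2\<close>, let \<open>S\<close> be the derivation along the geodesic spray and \<open>G\<^sup>h\<^bsub>ij\<^esub>\<close> the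
  Berwald connection.  Every function with \<open>S\<close>-parallel vertical Hessian \<open>f\<^bsub>ij\<^esub>\<close> has a totally
  symmetric Berwald derivative of \<open>f\<^bsub>ij\<^esub>\<close>; in a Landsberg space this derivative vanishes for
  \<open>f = E\<close>, so the Cartan connection agrees with the Berwald connection.  For an h-vector
  \<open>b\<^sub>i = \<partial>\<beta>/\<partial>y\<^sup>i\<close>, and \<open>\<beta>\<^bsub>ij\<^esub> = C\<^sup>h\<^bsub>ij\<^esub> b\<^sub>h\<close> is a multiple of the angular metric.  The gradient
  condition makes \<open>\<beta>\<^bsub>ij\<^esub>\<close> parallel along \<open>S\<close>; since \<open>C\<^sup>h\<^bsub>ij\<^esub>\<close> is parallel as well, the horizontal
  differential of \<open>\<beta>\<close> annihilates every \<open>C\<^sup>h\<^bsub>ij\<^esub>\<close> and is therefore proportional to \<open>y\<^sub>j\<close>.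

  The starred spray differs from the spray of \<open>L\<close> by a vector \<open>\<Delta>\<close> whose starred covariant
  components are combinations of \<open>y\<^sub>r\<close> and \<open>b\<^sub>r\<close>.  Both vanish on the unit normal \<open>N\<close>, on which the
  starred metric is a multiple of the original one, so \<open>\<Delta>\<close> is tangential and \<open>*N\<close> is a multiple
  of \<open>N\<close>.  If \<open>M\<^bsub>\<alpha>\<beta>\<^esub> = 0\<close>, then \<open>*M\<^bsub>\<alpha>\<beta>\<^esub> = 0\<close>, and \<open>\<partial>\<Delta>/\<partial>y\<close> preserves the splitting into
  tangential and normal vectors; all correction terms in \<open>*H\<^bsub>\<alpha>\<beta>\<^esub>\<close> then drop out and it becomes a
  multiple of \<open>H\<^bsub>\<alpha>\<beta>\<^esub>\<close>.\<close>

section \<open>Smooth functions\<close>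

abbreviation dd :: "('a::real_normed_vector \<Rightarrow> 'b::real_normed_vector) \<Rightarrow> 'a \<Rightarrow> 'a \<Rightarrow> 'b"
  where "dd f z \<equiv> frechet_derivative f (at z)"

lemma dd_eqI: "(f has_derivative f') (at z) \<Longrightarrow> dd f z h = f' h"
  using frechet_derivative_at by metis

lemma dd_works: "f differentiable (at z) \<Longrightarrow> (f has_derivative dd f z) (at z)"
  using frechet_derivative_works by blast

lemma dd_linear: "f differentiable (at z) \<Longrightarrow> linear (dd f z)"
  by (rule linear_frechet_derivative)

text \<open>A Frechet derivative depends only on the germ of the function, so identities known on an
  open set may be differentiated.\<close>

lemma dd_cong:
  assumes "open S" "z \<in> S" "\<And>w. w \<in> S \<Longrightarrow> f w = g w"
  shows "dd f z h = dd g z h"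
proof -
  have "(f has_derivative F) (at z) \<longleftrightarrow> (g has_derivative F) (at z)" for F
    using assms has_derivative_transform_within_open by metis
  then show ?thesis unfolding frechet_derivative_def by simp
qed

section \<open>Closure properties of the classes C^k and of smooth functions\<close>

lemma Ck_on_cong:
  assumes "open S" "\<And>w. w \<in> S \<Longrightarrow> f w = g w"
  shows "Ck_on k S f \<longleftrightarrow> Ck_on k S g"
  using assms(2)
proof (induction k arbitrary: f g)
  case 0
  then show ?case by (simp cong: continuous_on_cong)
next
  case (Suc k)
  have "dd f w h = dd g w h" if "w \<in> S" for w h
    using dd_cong[OF assms(1) that] Suc.prems by blast
  then have "Ck_on k S (\<lambda>x. dd f x h) = Ck_on k S (\<lambda>x. dd g x h)" for h
    by (rule Suc.IH)
  moreover have "f differentiable (at x) \<longleftrightarrow> g differentiable (at x)" if "x \<in> S" for x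
    unfolding differentiable_def
    using has_derivative_transform_within_open[OF _ assms(1) that] Suc.prems by metis
  ultimately show ?case by simp
qed

lemma Ck_on_Suc_imp: "Ck_on (Suc k) S f \<Longrightarrow> Ck_on k S f"
proof (induction k arbitrary: f)
  case 0
  then show ?case
    by (auto intro!: continuous_at_imp_continuous_on differentiable_imp_continuous_within)
next
  case (Suc k)
  then show ?case by (metis Ck_on.simps(2))
qed

lemma Ck_on_subset: "Ck_on k S f \<Longrightarrow> T \<subseteq> S \<Longrightarrow> Ck_on k T f"
  by (induction k arbitrary: f) (auto intro: continuous_on_subset)

lemma Ck_on_const: "Ck_on k S (\<lambda>_. c)"
  by (induction k arbitrary: c) auto

lemma Ck_on_add:
  assumes "open S" "Ck_on k S f" "Ck_on k S g"
  shows "Ck_on k S (\<lambda>x. f x + g x)"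
  using assms(2,3)
proof (induction k arbitrary: f g)
  case 0
  then show ?case by (auto intro: continuous_on_add)
next
  case (Suc k)
  have "dd (\<lambda>x. f x + g x) x h = dd f x h + dd g x h" if "x \<in> S" for x h
    using Suc.prems that by (auto intro!: dd_eqI has_derivative_add dd_works)
  then have "Ck_on k S (\<lambda>x. dd (\<lambda>x. f x + g x) x h) = Ck_on k S (\<lambda>x. dd f x h + dd g x h)" for h
    by (intro Ck_on_cong assms)
  with Suc show ?case by auto
qed

text \<open>By the product rule the derivative is again a sum of such products, now of class k;
  \<open>Ck_on_Suc_imp\<close> supplies the undifferentiated factors.\<close>

lemma (in bounded_bilinear) Ck_on:
  assumes "open S" "Ck_on k S f" "Ck_on k S g"
  shows "Ck_on k S (\<lambda>x. prod (f x) (g x))"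
  using assms(2,3)
proof (induction k arbitrary: f g)
  case 0
  then show ?case by (auto intro: continuous_on)
next
  case (Suc k)
  have "((\<lambda>x. prod (f x) (g x)) has_derivative (\<lambda>h. prod (f x) (dd g x h) + prod (dd f x h) (g x)))
      (at x)" if "x \<in> S" for x
    using Suc.prems that by (auto intro!: FDERIV dd_works)
  note d = this
  have "dd (\<lambda>x. prod (f x) (g x)) x h = prod (f x) (dd g x h) + prod (dd f x h) (g x)"
    if "x \<in> S" for x h
    using d[OF that] by (rule dd_eqI)
  then have "Ck_on k S (\<lambda>x. dd (\<lambda>x. prod (f x) (g x)) x h) =
      Ck_on k S (\<lambda>x. prod (f x) (dd g x h) + prod (dd f x h) (g x))" for h
    by (intro Ck_on_cong assms)
  moreover have "Ck_on k S (\<lambda>x. prod (f x) (dd g x h) + prod (dd f x h) (g x))" for h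
    using Suc.prems Suc.prems[THEN Ck_on_Suc_imp] by (intro Ck_on_add Suc.IH assms(1)) simp_all
  ultimately show ?case using d unfolding Ck_on.simps differentiable_def by blast
qed

lemma (in bounded_linear) Ck_on_compose:
  assumes "open S" "Ck_on k S g"
  shows "Ck_on k S (\<lambda>x. f (g x))"
  using assms(2)
proof (induction k arbitrary: g)
  case 0
  then show ?case by (auto intro: continuous_on)
next
  case (Suc k)
  have d: "((\<lambda>x. f (g x)) has_derivative (\<lambda>h. f (dd g x h))) (at x)" if "x \<in> S" for x
    using Suc.prems that by (auto intro!: has_derivative dd_works)
  have "dd (\<lambda>x. f (g x)) x h = f (dd g x h)" if "x \<in> S" for x h
    using d[OF that] by (rule dd_eqI)
  then have "Ck_on k S (\<lambda>x. dd (\<lambda>x. f (g x)) x h) = Ck_on k S (\<lambda>x. f (dd g x h))" for h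
    by (intro Ck_on_cong assms)
  moreover have "Ck_on k S (\<lambda>x. f (dd g x h))" for h
    using Suc.prems by (intro Suc.IH) auto
  ultimately show ?case using d unfolding Ck_on.simps differentiable_def by blast
qed

text \<open>The derivative of 1/f is a product of \<open>dd f\<close> with two copies of 1/f, so
  class k for 1/f gives class k + 1.\<close>

lemma Ck_on_inverse:
  fixes f :: "'a::real_normed_vector \<Rightarrow> real"
  assumes "open S" "\<And>x. x \<in> S \<Longrightarrow> f x \<noteq> 0" "Ck_on k S f"
  shows "Ck_on k S (\<lambda>x. inverse (f x))"
  using assms(3)
proof (induction k)
  case 0
  then show ?case using assms(2) by (auto intro: continuous_on_inverse)
next
  case (Suc k)
  have d: "((\<lambda>x. inverse (f x)) has_derivative (\<lambda>h. - (inverse (f x) * dd f x h * inverse (f x))))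
      (at x)" if "x \<in> S" for x
    using Suc.prems that assms(2)[OF that] by (intro Deriv.has_derivative_inverse dd_works) auto
  have "dd (\<lambda>x. inverse (f x)) x h = (- 1) * (inverse (f x) * dd f x h * inverse (f x))"
    if "x \<in> S" for x h
    using dd_eqI[OF d[OF that]] by simp
  then have "Ck_on k S (\<lambda>x. dd (\<lambda>x. inverse (f x)) x h) =
      Ck_on k S (\<lambda>x. (- 1) * (inverse (f x) * dd f x h * inverse (f x)))" for h
    by (intro Ck_on_cong assms)
  moreover have "Ck_on k S (\<lambda>x. (- 1) * (inverse (f x) * dd f x h * inverse (f x)))" for h
    using Suc.prems Suc.prems[THEN Ck_on_Suc_imp] Suc.IH
    by (intro bounded_bilinear.Ck_on[OF bounded_bilinear_mult] assms(1) Ck_on_const) simp_all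
  ultimately show ?case using d unfolding Ck_on.simps differentiable_def by blast
qed

lemma smooth_on_cong:
  assumes "open S" "\<And>w. w \<in> S \<Longrightarrow> f w = g w" "smooth_on S g"
  shows "smooth_on S f"
  using assms(3) Ck_on_cong[OF assms(1,2)] by (auto simp: smooth_on_def)

lemma smooth_on_subset: "smooth_on S f \<Longrightarrow> T \<subseteq> S \<Longrightarrow> smooth_on T f"
  unfolding smooth_on_def by (blast intro: Ck_on_subset)

lemma smooth_on_Ck_on: "smooth_on S f \<Longrightarrow> Ck_on k S f"
  by (simp add: smooth_on_def)

lemma smooth_on_differentiable: "smooth_on S f \<Longrightarrow> z \<in> S \<Longrightarrow> f differentiable (at z)"
  using smooth_on_Ck_on[of S f "Suc 0"] by simp

lemma smooth_on_has_derivative: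
  "smooth_on S f \<Longrightarrow> z \<in> S \<Longrightarrow> (f has_derivative dd f z) (at z)"
  by (intro dd_works smooth_on_differentiable)

lemma smooth_on_dd:
  assumes "smooth_on S f" shows "smooth_on S (\<lambda>w. dd f w h)"
  unfolding smooth_on_def
proof
  show "Ck_on k S (\<lambda>w. dd f w h)" for k
    using smooth_on_Ck_on[OF assms, of "Suc k"] by simp
qed

lemma smooth_on_continuous_on: "smooth_on S f \<Longrightarrow> continuous_on S f"
  using smooth_on_Ck_on[of S f 0] by simp

lemma smooth_on_const: "smooth_on S (\<lambda>_. c)"
  by (simp add: smooth_on_def Ck_on_const)

lemma smooth_on_add:
  "open S \<Longrightarrow> smooth_on S f \<Longrightarrow> smooth_on S g \<Longrightarrow> smooth_on S (\<lambda>x. f x + g x)"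
  by (simp add: smooth_on_def Ck_on_add)

lemma smooth_on_mult:
  fixes f g :: "'a::real_normed_vector \<Rightarrow> real"
  shows "open S \<Longrightarrow> smooth_on S f \<Longrightarrow> smooth_on S g \<Longrightarrow> smooth_on S (\<lambda>x. f x * g x)"
  by (simp add: smooth_on_def bounded_bilinear.Ck_on[OF bounded_bilinear_mult])

lemma smooth_on_scaleR:
  "open S \<Longrightarrow> smooth_on S f \<Longrightarrow> smooth_on S g \<Longrightarrow> smooth_on S (\<lambda>x. f x *\<^sub>R g x)"
  by (simp add: smooth_on_def bounded_bilinear.Ck_on[OF bounded_bilinear_scaleR])

lemma smooth_on_bounded_linear:
  "bounded_linear T \<Longrightarrow> open S \<Longrightarrow> smooth_on S f \<Longrightarrow> smooth_on S (\<lambda>x. T (f x))"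
  by (simp add: smooth_on_def bounded_linear.Ck_on_compose)

lemma smooth_on_ident: "smooth_on S (\<lambda>x. x)"
proof -
  have "Ck_on k S (\<lambda>x. x)" for k by (cases k) (auto simp: Ck_on_const)
  then show ?thesis by (simp add: smooth_on_def)
qed

lemma smooth_on_diff:
  fixes f g :: "'a::real_normed_vector \<Rightarrow> 'b::real_normed_vector"
  assumes "open S" "smooth_on S f" "smooth_on S g" shows "smooth_on S (\<lambda>x. f x - g x)"
  using smooth_on_add[OF assms(1,2) smooth_on_bounded_linear[OF bounded_linear_minus[OF bounded_linear_ident] assms(1,3)]]
  by simp

lemma smooth_on_sum:
  assumes "open S" "\<And>i. i \<in> I \<Longrightarrow> smooth_on S (f i)"
  shows "smooth_on S (\<lambda>x. \<Sum>i\<in>I. f i x)"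
  using assms(2)
  by (induction I rule: infinite_finite_induct) (auto intro: smooth_on_add smooth_on_const assms(1))

lemma smooth_on_prod:
  fixes f :: "'i \<Rightarrow> 'a::real_normed_vector \<Rightarrow> real"
  assumes "open S" "\<And>i. i \<in> I \<Longrightarrow> smooth_on S (f i)"
  shows "smooth_on S (\<lambda>x. \<Prod>i\<in>I. f i x)"
  using assms(2)
  by (induction I rule: infinite_finite_induct) (auto intro: smooth_on_mult smooth_on_const assms(1))

lemma smooth_on_vec_lambda:
  fixes f :: "'a::real_normed_vector \<Rightarrow> 'n::finite \<Rightarrow> real"
  assumes "open U" "\<And>i. smooth_on U (\<lambda>z. f z i)"
  shows "smooth_on U (\<lambda>z. \<chi> i. f z i)"
proof -
  have "smooth_on U (\<lambda>z. \<Sum>i\<in>UNIV. f z i *\<^sub>R axis i (1::real))"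
    by (intro smooth_on_sum[OF assms(1)] smooth_on_scaleR[OF assms(1)] smooth_on_const assms(2))
  moreover have "(\<Sum>i\<in>UNIV. f z i *\<^sub>R axis i (1::real)) = (\<chi> i. f z i)" for z
    using basis_expansion[of "\<chi> i. f z i"] by (simp add: scalar_mult_eq_scaleR)
  ultimately show ?thesis by simp
qed

lemma smooth_on_divide:
  fixes f g :: "'a::real_normed_vector \<Rightarrow> real"
  assumes "open S" "smooth_on S f" "smooth_on S g" "\<And>x. x \<in> S \<Longrightarrow> g x \<noteq> 0"
  shows "smooth_on S (\<lambda>x. f x / g x)"
proof -
  have "smooth_on S (\<lambda>x. inverse (g x))"
    unfolding smooth_on_def
    by (intro allI Ck_on_inverse assms(1,4) smooth_on_Ck_on[OF assms(3)])
  then show ?thesis unfolding divide_inverse by (intro smooth_on_mult assms)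
qed

lemma smooth_on_power2:
  fixes f :: "'a::real_normed_vector \<Rightarrow> real"
  shows "open S \<Longrightarrow> smooth_on S f \<Longrightarrow> smooth_on S (\<lambda>x. (f x)\<^sup>2)"
  unfolding power2_eq_square by (rule smooth_on_mult)

section \<open>Smooth dependence of the inverse matrix\<close>

lemma smooth_on_det:
  fixes M :: "'a::real_normed_vector \<Rightarrow> real^'n::finite^'n"
  assumes "open S" "\<And>i j. smooth_on S (\<lambda>x. M x $ i $ j)"
  shows "smooth_on S (\<lambda>x. det (M x))"
  unfolding det_def
  by (intro smooth_on_sum smooth_on_mult smooth_on_prod smooth_on_const assms)

lemma matrix_inv_inverse:
  fixes M :: "real^'n::finite^'n"
  assumes "invertible M"
  shows "M ** matrix_inv M = mat 1" "matrix_inv M ** M = mat 1"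
  using assms someI_ex[of "\<lambda>N. M ** N = mat 1 \<and> N ** M = mat 1"]
  by (auto simp: invertible_def matrix_inv_def)

text \<open>Cramer's rule with right-hand side \<open>axis j 1\<close>, whose solution is column j
  of the inverse. It makes the entries quotients of determinants, hence smooth.\<close>

lemma matrix_inv_cramer:
  fixes M :: "real^'n::finite^'n"
  assumes "invertible M"
  shows "matrix_inv M $ i $ j = det (\<chi> k l. if l = i then axis j 1 $ k else M $ k $ l) / det M"
proof -
  have "M *v (matrix_inv M *v axis j 1) = axis j 1"
    by (simp add: matrix_vector_mul_assoc matrix_inv_inverse[OF assms])
  moreover have "det M \<noteq> 0" using assms invertible_det_nz by blast
  ultimately have "matrix_inv M *v axis j 1 =
      (\<chi> k. det(\<chi> i l. if l=k then axis j 1 $ i else M $ i $ l) / det M)"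
    using cramer by blast
  moreover have "(matrix_inv M *v axis j 1) $ i = matrix_inv M $ i $ j"
    by (simp add: matrix_vector_mult_def axis_def if_distrib cong: if_cong)
  ultimately show ?thesis by simp
qed

lemma smooth_on_matrix_inv:
  fixes M :: "'a::real_normed_vector \<Rightarrow> real^'n::finite^'n"
  assumes "open S" "\<And>i j. smooth_on S (\<lambda>x. M x $ i $ j)" "\<And>x. x \<in> S \<Longrightarrow> invertible (M x)"
  shows "smooth_on S (\<lambda>x. matrix_inv (M x) $ i $ j)"
proof (rule smooth_on_cong[OF assms(1)])
  have "smooth_on S (\<lambda>x. (\<chi> k l. if l = i then axis j 1 $ k else M x $ k $ l) $ i' $ j')" for i' j'
    using assms(2) by (cases "j' = i") (auto intro: smooth_on_const)
  then show "smooth_on S (\<lambda>x. det (\<chi> k l. if l = i then axis j 1 $ k else M x $ k $ l) / det (M x))"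
    using assms(1,2) assms(3)[unfolded invertible_det_nz]
    by (intro smooth_on_divide smooth_on_det) simp_all
qed (rule matrix_inv_cramer[OF assms(3)])

section \<open>Symmetry of second derivatives\<close>

lemma DERIV_along_line:
  fixes f :: "'a::real_normed_vector \<Rightarrow> real"
  assumes "f differentiable (at (p + s *\<^sub>R u))"
  shows "((\<lambda>s. f (p + s *\<^sub>R u)) has_real_derivative dd f (p + s *\<^sub>R u) u) (at s)"
proof -
  have "((\<lambda>s. p + s *\<^sub>R u) has_derivative (\<lambda>h. h *\<^sub>R u)) (at s)"
    by (auto intro!: derivative_eq_intros)
  from diff_chain_at[OF this dd_works[OF assms]]
  show ?thesis
    by (simp add: has_field_derivative_def o_def linear_cmul[OF dd_linear[OF assms]] mult_commute_abs)
qed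

text \<open>The mean value theorem is applied in direction u to the increment in direction v, and
  then in direction v to the derivative along u.\<close>

lemma second_difference_mvt:
  fixes f :: "'a::real_normed_vector \<Rightarrow> real"
  assumes f: "smooth_on (ball z r) f" and t: "t > 0" "t * (norm u + norm v) < r"
  obtains a b where "0 < a" "a < t" "0 < b" "b < t"
    "f (z + t *\<^sub>R u + t *\<^sub>R v) - f (z + t *\<^sub>R u) - f (z + t *\<^sub>R v) + f z
      = t * t * dd (\<lambda>w. dd f w u) (z + a *\<^sub>R u + b *\<^sub>R v) v"
proof -
  have mem: "z + a *\<^sub>R u + b *\<^sub>R v \<in> ball z r" if "0 \<le> a" "a \<le> t" "0 \<le> b" "b \<le> t" for a b
  proof -
    have "norm (a *\<^sub>R u + b *\<^sub>R v) \<le> a * norm u + b * norm v"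
      using norm_triangle_ineq[of "a *\<^sub>R u" "b *\<^sub>R v"] that by simp
    also have "\<dots> \<le> t * norm u + t * norm v"
      using that by (intro add_mono mult_right_mono) auto
    finally have "dist (z + a *\<^sub>R u + b *\<^sub>R v) z < r"
      using t(2) by (simp add: distrib_left dist_norm)
    then show ?thesis by (metis mem_ball dist_commute)
  qed
  define \<phi> where "\<phi> = (\<lambda>s. f (z + s *\<^sub>R u + t *\<^sub>R v) - f (z + s *\<^sub>R u))"
  have d1: "((\<lambda>s. f (z + s *\<^sub>R u + c *\<^sub>R v)) has_real_derivative dd f (z + s *\<^sub>R u + c *\<^sub>R v) u) (at s)"
    if "0 \<le> s" "s \<le> t" "0 \<le> c" "c \<le> t" for s c
    using DERIV_along_line[of f "z + c *\<^sub>R v" s u] smooth_on_differentiable[OF f mem[OF that]]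
    by (simp add: add_ac)
  have "\<exists>a. 0 < a \<and> a < t \<and> \<phi> t - \<phi> 0 =
      (t - 0) * (dd f (z + a *\<^sub>R u + t *\<^sub>R v) u - dd f (z + a *\<^sub>R u) u)"
    unfolding \<phi>_def
    using t d1[of _ t] d1[of _ 0] by (intro MVT2 DERIV_diff) simp_all
  then obtain a where a: "0 < a" "a < t" and ea:
    "\<phi> t - \<phi> 0 = t * (dd f (z + a *\<^sub>R u + t *\<^sub>R v) u - dd f (z + a *\<^sub>R u) u)" by auto
  have d2: "((\<lambda>s. dd f (z + a *\<^sub>R u + s *\<^sub>R v) u) has_real_derivative
      dd (\<lambda>w. dd f w u) (z + a *\<^sub>R u + s *\<^sub>R v) v) (at s)"
    if "0 \<le> s" "s \<le> t" for s
    using a that by (intro DERIV_along_line smooth_on_differentiable[OF smooth_on_dd[OF f]] mem) auto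
  have "\<exists>b. 0 < b \<and> b < t \<and> dd f (z + a *\<^sub>R u + t *\<^sub>R v) u - dd f (z + a *\<^sub>R u + 0 *\<^sub>R v) u =
      (t - 0) * dd (\<lambda>w. dd f w u) (z + a *\<^sub>R u + b *\<^sub>R v) v"
    using t d2 by (intro MVT2) simp_all
  then obtain b where "0 < b" "b < t" and
    "dd f (z + a *\<^sub>R u + t *\<^sub>R v) u - dd f (z + a *\<^sub>R u) u =
      t * dd (\<lambda>w. dd f w u) (z + a *\<^sub>R u + b *\<^sub>R v) v" by auto
  with a ea that[of a b] show ?thesis by (simp add: \<phi>_def mult.assoc)
qed

text \<open>The second difference is symmetric in u and v; divided by the square of the step it
  converges to either mixed derivative.\<close>

lemma dd_commute_real:
  fixes f :: "'a::real_normed_vector \<Rightarrow> real"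
  assumes "open S" "smooth_on S f" "z \<in> S"
  shows "dd (\<lambda>w. dd f w u) z v = dd (\<lambda>w. dd f w v) z u"
proof -
  obtain r where r: "r > 0" "ball z r \<subseteq> S" using assms openE by metis
  have f: "smooth_on (ball z r) f" using assms(2) r(2) by (rule smooth_on_subset)
  \<comment> \<open>The summand 1 keeps the denominator positive when u = v = 0.\<close>
  define c where "c = r / (norm u + norm v + 1)"
  have pos: "norm u + norm v + 1 > 0" by (simp add: add_nonneg_pos)
  then have c: "c > 0" "c * (norm u + norm v) < r" using r(1) by (simp_all add: c_def field_simps)
  define T where "T = (\<lambda>n::nat. c / Suc n)"
  have T0: "T n > 0" for n using c by (simp add: T_def)
  have Tr: "T n * (norm u + norm v) < r" "T n * (norm v + norm u) < r" for n
  proof -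
    have "T n \<le> c" using c(1) by (simp add: T_def divide_le_eq mult_le_cancel_left1)
    then have "T n * (norm u + norm v) \<le> c * (norm u + norm v)" by (intro mult_right_mono) auto
    then show "T n * (norm u + norm v) < r" using c(2) by linarith
    then show "T n * (norm v + norm u) < r" by (simp add: add.commute)
  qed
  have Tlim: "T \<longlonglongrightarrow> 0" unfolding T_def by (rule LIMSEQ_Suc[OF lim_const_over_n])
  have lim: "(\<lambda>n. (f (z + T n *\<^sub>R u + T n *\<^sub>R v) - f (z + T n *\<^sub>R u) - f (z + T n *\<^sub>R v) + f z) / (T n * T n))
      \<longlonglongrightarrow> dd (\<lambda>w. dd f w u) z v" (is "?q u v \<longlonglongrightarrow> _")
    if uv: "\<And>n. T n * (norm u + norm v) < r" for u v
  proof -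
    have "\<exists>a b. 0 < a \<and> a < T n \<and> 0 < b \<and> b < T n \<and>
      ?q u v n = dd (\<lambda>w. dd f w u) (z + a *\<^sub>R u + b *\<^sub>R v) v" for n
      using T0[of n] by (rule_tac second_difference_mvt[OF f T0[of n] uv[of n]]) auto
    then obtain a b where ab: "\<And>n. 0 < a n \<and> a n < T n \<and> 0 < b n \<and> b n < T n \<and>
      ?q u v n = dd (\<lambda>w. dd f w u) (z + a n *\<^sub>R u + b n *\<^sub>R v) v" by metis
    have "a \<longlonglongrightarrow> 0" by (rule tendsto_sandwich[OF _ _ tendsto_const Tlim])
        (use ab in \<open>auto intro!: always_eventually less_imp_le\<close>)
    moreover have "b \<longlonglongrightarrow> 0" by (rule tendsto_sandwich[OF _ _ tendsto_const Tlim])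
        (use ab in \<open>auto intro!: always_eventually less_imp_le\<close>)
    ultimately have "(\<lambda>n. z + a n *\<^sub>R u + b n *\<^sub>R v) \<longlonglongrightarrow> z + 0 *\<^sub>R u + 0 *\<^sub>R v"
      by (intro tendsto_intros)
    then have "(\<lambda>n. z + a n *\<^sub>R u + b n *\<^sub>R v) \<longlonglongrightarrow> z" by simp
    moreover have "isCont (\<lambda>w. dd (\<lambda>w. dd f w u) w v) z"
      using smooth_on_continuous_on[OF smooth_on_dd[OF smooth_on_dd[OF assms(2)]]] assms
      by (simp add: continuous_on_eq_continuous_at)
    ultimately have "(\<lambda>n. dd (\<lambda>w. dd f w u) (z + a n *\<^sub>R u + b n *\<^sub>R v) v) \<longlonglongrightarrow> dd (\<lambda>w. dd f w u) z v"
      using isCont_tendsto_compose by blast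
    then show ?thesis using ab by simp
  qed
  have swap: "z + T n *\<^sub>R v + T n *\<^sub>R u = z + T n *\<^sub>R u + T n *\<^sub>R v" for n
    by (simp add: add_ac)
  have "?q v u = ?q u v" unfolding swap by (simp add: algebra_simps)
  with lim[OF Tr(2)] have "?q u v \<longlonglongrightarrow> dd (\<lambda>w. dd f w v) z u" by (simp only:)
  with lim[OF Tr(1)] show ?thesis by (rule LIMSEQ_unique)
qed

lemma dd_linear_comp:
  assumes "bounded_linear T" "f differentiable (at z)"
  shows "dd (\<lambda>w. T (f w)) z h = T (dd f z h)"
  by (rule dd_eqI[OF bounded_linear.has_derivative[OF assms(1) dd_works[OF assms(2)]]])

lemma dd_commute:
  fixes f :: "'a::real_normed_vector \<Rightarrow> 'b::euclidean_space"
  assumes S: "open S" and f: "smooth_on S f" and z: "z \<in> S"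
  shows "dd (\<lambda>w. dd f w u) z v = dd (\<lambda>w. dd f w v) z u"
proof (rule euclidean_eqI)
  fix i :: 'b assume "i \<in> Basis"
  have b: "bounded_linear (\<lambda>x::'b. x \<bullet> i)" by (rule bounded_linear_inner_left)
  have *: "dd (\<lambda>w. dd f w u) z v \<bullet> i = dd (\<lambda>w. dd (\<lambda>x. f x \<bullet> i) w u) z v" for u v
  proof -
    have "dd (\<lambda>w. dd f w u) z v \<bullet> i = dd (\<lambda>w. dd f w u \<bullet> i) z v"
      by (rule dd_linear_comp[OF b smooth_on_differentiable[OF smooth_on_dd[OF f] z], symmetric])
    also have "\<dots> = dd (\<lambda>w. dd (\<lambda>x. f x \<bullet> i) w u) z v"
      by (rule dd_cong[OF S z], rule dd_linear_comp[OF b smooth_on_differentiable[OF f], symmetric])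
    finally show ?thesis .
  qed
  show "dd (\<lambda>w. dd f w u) z v \<bullet> i = dd (\<lambda>w. dd f w v) z u \<bullet> i"
    unfolding * by (rule dd_commute_real[OF S smooth_on_bounded_linear[OF b S f] z])
qed

lemma dd_expand:
  fixes f :: "'a::euclidean_space \<Rightarrow> 'b::real_normed_vector"
  assumes "f differentiable (at z)"
  shows "dd f z v = (\<Sum>b\<in>Basis. (v \<bullet> b) *\<^sub>R dd f z b)"
proof -
  interpret linear "dd f z" by (rule dd_linear[OF assms])
  have "dd f z v = dd f z (\<Sum>b\<in>Basis. (v \<bullet> b) *\<^sub>R b)" by (simp add: euclidean_representation)
  then show ?thesis by (simp add: sum scale)
qed

text \<open>The symmetry of second derivatives is built in here, so that commutators of derivations along
  vector fields can be computed without coordinates.\<close>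

lemma has_derivative_dd_field:
  fixes f :: "'a::euclidean_space \<Rightarrow> 'b::euclidean_space"
  assumes S: "open S" and f: "smooth_on S f" and z: "z \<in> S"
    and \<xi>: "(\<xi> has_derivative \<xi>') (at z)"
  shows "((\<lambda>w. dd f w (\<xi> w)) has_derivative
    (\<lambda>h. dd (\<lambda>w. dd f w h) z (\<xi> z) + dd f z (\<xi>' h))) (at z)"
proof (rule has_derivative_transform_within_open[OF _ S z])
  show "(\<Sum>b\<in>Basis. (\<xi> w \<bullet> b) *\<^sub>R dd f w b) = dd f w (\<xi> w)" if "w \<in> S" for w
    by (rule dd_expand[OF smooth_on_differentiable[OF f that], symmetric])
  have "dd (\<lambda>w. dd f w h) z (\<xi> z) + dd f z (\<xi>' h) =
      (\<Sum>b\<in>Basis. (\<xi> z \<bullet> b) *\<^sub>R dd (\<lambda>w. dd f w b) z h + (\<xi>' h \<bullet> b) *\<^sub>R dd f z b)" for h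
  proof -
    have "dd (\<lambda>w. dd f w h) z (\<xi> z) = (\<Sum>b\<in>Basis. (\<xi> z \<bullet> b) *\<^sub>R dd (\<lambda>w. dd f w h) z b)"
      by (rule dd_expand[OF smooth_on_differentiable[OF smooth_on_dd[OF f] z]])
    also have "\<dots> = (\<Sum>b\<in>Basis. (\<xi> z \<bullet> b) *\<^sub>R dd (\<lambda>w. dd f w b) z h)"
      by (intro sum.cong refl arg_cong[where f="scaleR _"] dd_commute[OF S f z])
    finally show ?thesis
      using dd_expand[OF smooth_on_differentiable[OF f z], of "\<xi>' h"] by (simp add: sum.distrib)
  qed
  moreover have "((\<lambda>w. \<Sum>b\<in>Basis. (\<xi> w \<bullet> b) *\<^sub>R dd f w b) has_derivative
    (\<lambda>h. \<Sum>b\<in>Basis. (\<xi> z \<bullet> b) *\<^sub>R dd (\<lambda>w. dd f w b) z h + (\<xi>' h \<bullet> b) *\<^sub>R dd f z b)) (at z)"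
    by (intro has_derivative_sum has_derivative_scaleR has_derivative_inner_left \<xi>
        smooth_on_has_derivative[OF smooth_on_dd[OF f] z])
  ultimately show "((\<lambda>w. \<Sum>b\<in>Basis. (\<xi> w \<bullet> b) *\<^sub>R dd f w b) has_derivative
      (\<lambda>h. dd (\<lambda>w. dd f w h) z (\<xi> z) + dd f z (\<xi>' h))) (at z)" by simp
qed

text \<open>The direction varies with the point, so it is expanded in a fixed basis, which leaves
  only derivatives in constant directions.\<close>

lemma smooth_on_dd_field:
  fixes f :: "'a::euclidean_space \<Rightarrow> 'b::real_normed_vector"
  assumes "open S" "smooth_on S f" "smooth_on S \<xi>"
  shows "smooth_on S (\<lambda>w. dd f w (\<xi> w))"
proof (rule smooth_on_cong[OF assms(1)])
  show "dd f w (\<xi> w) = (\<Sum>b\<in>Basis. (\<xi> w \<bullet> b) *\<^sub>R dd f w b)" if "w \<in> S" for w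
    by (rule dd_expand[OF smooth_on_differentiable[OF assms(2) that]])
  show "smooth_on S (\<lambda>w. \<Sum>b\<in>Basis. (\<xi> w \<bullet> b) *\<^sub>R dd f w b)"
    by (rule smooth_on_sum[OF assms(1)], rule smooth_on_scaleR[OF assms(1)
        smooth_on_bounded_linear[OF bounded_linear_inner_left assms(1,3)] smooth_on_dd[OF assms(2)]])
qed

section \<open>Vertical derivatives\<close>

definition vd :: "real^'n::finite \<Rightarrow> ('n tvec \<Rightarrow> 'b::real_normed_vector) \<Rightarrow> 'n tvec \<Rightarrow> 'b"
  where "vd u f z = dd f z (0, u)"

lemma pdy_eq_vd: "pdy i f = vd (axis i 1) f"
  by (simp add: fun_eq_iff pdy_def vd_def)

lemma smooth_on_vd: "smooth_on U f \<Longrightarrow> smooth_on U (vd u f)"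
  unfolding vd_def by (rule smooth_on_dd)

lemma vd_cong: "open U \<Longrightarrow> z \<in> U \<Longrightarrow> (\<And>w. w \<in> U \<Longrightarrow> f w = g w) \<Longrightarrow> vd u f z = vd u g z"
  unfolding vd_def by (rule dd_cong)

lemma vd_commute:
  fixes f :: "'n::finite tvec \<Rightarrow> 'b::euclidean_space"
  assumes "open U" "smooth_on U f" "z \<in> U"
  shows "vd u (vd v f) z = vd v (vd u f) z"
  unfolding vd_def by (rule dd_commute[OF assms])

lemma linear_Pair1: "linear (\<lambda>u. (u, 0))" and linear_Pair2: "linear (\<lambda>u. (0, u))"
  by (auto intro!: linearI)

lemma linear_expand:
  fixes P :: "real^'n::finite \<Rightarrow> 'b::real_vector"
  assumes "linear P"
  shows "P u = (\<Sum>i\<in>UNIV. u $ i *\<^sub>R P (axis i 1))"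
proof -
  have "P u = P (\<Sum>i\<in>UNIV. u $ i *\<^sub>R axis i 1)"
    using basis_expansion[of u] by (simp add: scalar_mult_eq_scaleR)
  then show ?thesis by (simp add: linear_sum[OF assms] linear_cmul[OF assms])
qed

text \<open>The definitions yield tensor identities in coordinates; this extends them, one argument
  at a time, to arbitrary vectors.\<close>

lemma axis_test:
  fixes P Q :: "real^'n::finite \<Rightarrow> real"
  assumes "linear P" "linear Q" "\<And>i. P (axis i 1) = Q (axis i 1)"
  shows "P u = Q u"
proof -
  have "P (\<Sum>i\<in>UNIV. u $ i *\<^sub>R axis i 1) = Q (\<Sum>i\<in>UNIV. u $ i *\<^sub>R axis i 1)"
    using assms(3) by (simp add: linear_sum[OF assms(1)] linear_sum[OF assms(2)]
        linear_cmul[OF assms(1)] linear_cmul[OF assms(2)])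
  then show ?thesis using basis_expansion[of u] by (simp add: scalar_mult_eq_scaleR)
qed

lemma linear_dd: "smooth_on U f \<Longrightarrow> z \<in> U \<Longrightarrow> linear (dd f z)"
  by (rule dd_linear[OF smooth_on_differentiable])

lemma linear_vd: "smooth_on U f \<Longrightarrow> z \<in> U \<Longrightarrow> linear (\<lambda>u. vd u f z)"
  unfolding vd_def
  by (rule linear_compose[OF linear_Pair2 dd_linear[OF smooth_on_differentiable], unfolded o_def])

lemma linear_hd: "smooth_on U f \<Longrightarrow> z \<in> U \<Longrightarrow> linear (\<lambda>r. dd f z (r, 0))"
  by (rule linear_compose[OF linear_Pair1 linear_dd, unfolded o_def])

text \<open>Commuting the derivatives makes u the outer direction, where linearity is that of a
  single derivative.\<close>

lemma linear_vd2:
  fixes f :: "'n::finite tvec \<Rightarrow> 'b::euclidean_space"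
  assumes "open U" "smooth_on U f" "z \<in> U"
  shows "linear (\<lambda>u. vd v (vd u f) z)"
  unfolding vd_commute[OF assms, of v] by (rule linear_vd[OF smooth_on_vd[OF assms(2)] assms(3)])

lemma linear_vd3:
  fixes f :: "'n::finite tvec \<Rightarrow> 'b::euclidean_space"
  assumes "open U" "smooth_on U f" "z \<in> U"
  shows "linear (\<lambda>u. vd r (vd v (vd u f)) z)"
proof -
  have "vd r (vd v (vd u f)) z = vd r (vd u (vd v f)) z" for u
    by (rule vd_cong[OF assms(1,3)], rule vd_commute[OF assms(1,2)])
  then show ?thesis
    using linear_vd2[OF assms(1) smooth_on_vd[OF assms(2)] assms(3)] by simp
qed

lemma vd_cycle:
  fixes f :: "'n::finite tvec \<Rightarrow> 'b::euclidean_space"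
  assumes "open U" "smooth_on U f" "z \<in> U"
  shows "vd r (vd v (vd u f)) z = vd v (vd u (vd r f)) z"
proof -
  have "vd r (vd v (vd u f)) z = vd v (vd r (vd u f)) z"
    by (rule vd_commute[OF assms(1) smooth_on_vd[OF assms(2)] assms(3)])
  also have "\<dots> = vd v (vd u (vd r f)) z"
    by (rule vd_cong[OF assms(1,3)], rule vd_commute[OF assms(1,2)])
  finally show ?thesis .
qed

lemma vd_expand:
  assumes "smooth_on U f" "z \<in> U"
  shows "vd u f z = (\<Sum>i\<in>UNIV. u $ i *\<^sub>R vd (axis i 1) f z)"
proof -
  interpret linear "\<lambda>u. vd u f z" by (rule linear_vd[OF assms])
  have "vd u f z = vd (\<Sum>i\<in>UNIV. u $ i *\<^sub>R axis i 1) f z"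
    using basis_expansion[of u] by (simp add: scalar_mult_eq_scaleR)
  then show ?thesis by (simp add: sum scale)
qed

lemma dd_pair:
  assumes "smooth_on U f" "z \<in> U"
  shows "dd f z (u, v) = dd f z (u, 0) + vd v f z"
  unfolding vd_def using linear_add[OF dd_linear[OF smooth_on_differentiable[OF assms]], of "(u, 0)" "(0, v)"]
  by simp

lemma vd_const: "vd u (\<lambda>_. c) z = 0" by (simp add: vd_def)

lemma vd_mult:
  fixes f g :: "'n::finite tvec \<Rightarrow> real"
  assumes "smooth_on U f" "smooth_on U g" "z \<in> U"
  shows "vd u (\<lambda>w. f w * g w) z = f z * vd u g z + vd u f z * g z"
  unfolding vd_def by (rule dd_eqI) (rule has_derivative_mult[OF smooth_on_has_derivative[OF assms(1,3)]
      smooth_on_has_derivative[OF assms(2,3)]])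

lemma vd_plus:
  fixes f g :: "'n::finite tvec \<Rightarrow> real"
  assumes "smooth_on U f" "smooth_on U g" "z \<in> U"
  shows "vd r (\<lambda>w. f w + g w) z = vd r f z + vd r g z"
  unfolding vd_def
  by (rule dd_eqI[OF has_derivative_add[OF smooth_on_has_derivative[OF assms(1,3)]
        smooth_on_has_derivative[OF assms(2,3)]]])

lemma smooth_on_snd: "open U \<Longrightarrow> smooth_on U (\<lambda>z. snd z)"
  by (rule smooth_on_bounded_linear[OF bounded_linear_snd _ smooth_on_ident])

lemma smooth_on_component:
  "open U \<Longrightarrow> smooth_on U f \<Longrightarrow> smooth_on U (\<lambda>z. f z $ i)"
  by (rule smooth_on_bounded_linear[OF bounded_linear_vec_nth])

lemma smooth_on_Pair:
  assumes "open U" "smooth_on U f" "smooth_on U g"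
  shows "smooth_on U (\<lambda>z. (f z, g z))"
proof -
  have "smooth_on U (\<lambda>z. (f z, 0) + (0, g z))"
    by (rule smooth_on_add[OF assms(1)
          smooth_on_bounded_linear[OF bounded_linear_Pair[OF bounded_linear_ident bounded_linear_zero] assms(1,2)]
          smooth_on_bounded_linear[OF bounded_linear_Pair[OF bounded_linear_zero bounded_linear_ident] assms(1,3)]])
  then show ?thesis by simp
qed

lemma dd_vert: "(\<lambda>w. dd f w (0, r)) = vd r f" by (simp add: fun_eq_iff vd_def)

lemma dd_vd_field:
  fixes f :: "'n::finite tvec \<Rightarrow> 'b::euclidean_space"
  assumes U: "open U" and f: "smooth_on U f" and z: "z \<in> U"
    and \<xi>: "(\<xi> has_derivative \<xi>') (at z)"
  shows "dd (\<lambda>w. vd (\<xi> w) f w) z h = dd (vd (\<xi> z) f) z h + vd (\<xi>' h) f z"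
proof -
  have "((\<lambda>w. (0::real^'n, \<xi> w)) has_derivative (\<lambda>h. (0, \<xi>' h))) (at z)"
    by (intro has_derivative_Pair \<xi> has_derivative_const)
  from has_derivative_dd_field[OF U f z this]
  have "dd (\<lambda>w. dd f w (0, \<xi> w)) z h = dd (\<lambda>w. dd f w h) z (0, \<xi> z) + dd f z (0, \<xi>' h)"
    by (rule dd_eqI)
  then show ?thesis unfolding vd_def dd_commute[OF U f z, of h] .
qed

lemma smooth_vd_field:
  assumes "open U" "smooth_on U f" "smooth_on U \<xi>"
  shows "smooth_on U (\<lambda>w. vd (\<xi> w) f w)"
  unfolding vd_def
  by (intro smooth_on_dd_field[OF assms(1,2)] smooth_on_Pair[OF assms(1)] smooth_on_const assms(3))

section \<open>Euler's relation for homogeneous functions\<close>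

lemma vd_Euler:
  fixes f :: "'n::finite tvec \<Rightarrow> 'b::euclidean_space"
  assumes U: "open U" and f: "smooth_on U f" and z: "z \<in> U"
  shows "dd (\<lambda>w. vd (snd w) f w) z h = dd (vd (snd z) f) z h + vd (snd h) f z"
  by (rule dd_vd_field[OF assms has_derivative_snd[OF has_derivative_ident]])

text \<open>Differentiating Euler's relation in direction u lowers the degree of homogeneity by
  one.\<close>

lemma Euler_vd:
  fixes f :: "'n::finite tvec \<Rightarrow> real"
  assumes U: "open U" and f: "smooth_on U f" and z: "z \<in> U"
    and hom: "\<And>w. w \<in> U \<Longrightarrow> vd (snd w) f w = r * f w"
  shows "vd (snd z) (vd u f) z = (r - 1) * vd u f z"
proof -
  have "vd (snd z) (vd u f) z + vd u f z = dd (\<lambda>w. vd (snd w) f w) z (0, u)"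
    using vd_Euler[OF U f z, of "(0, u)"] vd_commute[OF U f z, of u] by (simp add: vd_def)
  also have "\<dots> = dd (\<lambda>w. r * f w) z (0, u)"
    by (rule dd_cong[OF U z]) (rule hom)
  also have "\<dots> = r * vd u f z"
    unfolding vd_def by (rule dd_linear_comp[OF bounded_linear_mult_right smooth_on_differentiable[OF f z]])
  finally show ?thesis by (simp add: algebra_simps)
qed

text \<open>Derivatives along the base do not move y, so the degree of homogeneity is kept.\<close>

lemma Euler_hd:
  fixes f :: "'n::finite tvec \<Rightarrow> real"
  assumes U: "open U" and f: "smooth_on U f" and z: "z \<in> U"
    and hom: "\<And>w. w \<in> U \<Longrightarrow> vd (snd w) f w = r * f w"
  shows "vd (snd z) (\<lambda>w. dd f w (u, 0)) z = r * dd f z (u, 0)"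
proof -
  have "dd (vd (snd z) f) z (u, 0) = dd (\<lambda>w. vd (snd w) f w) z (u, 0)"
    using vd_Euler[OF U f z, of "(u, 0)"] by (simp add: vd_def linear_0[OF dd_linear[OF smooth_on_differentiable[OF f z]]] zero_prod_def[symmetric])
  also have "\<dots> = dd (\<lambda>w. r * f w) z (u, 0)"
    by (rule dd_cong[OF U z]) (rule hom)
  also have "\<dots> = r * dd f z (u, 0)"
    by (rule dd_linear_comp[OF bounded_linear_mult_right smooth_on_differentiable[OF f z]])
  finally show ?thesis unfolding vd_def dd_commute[OF U f z, of "(u, 0)"] .
qed

section \<open>The geodesic spray and the nonlinear connection\<close>

text \<open>Its vertical Hessian is the metric tensor, so g, C and the connections can be written
  with derivatives of one function.\<close>

definition energy :: "('n::finite tvec \<Rightarrow> real) \<Rightarrow> 'n tvec \<Rightarrow> real"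
  where "energy L z = (L z)\<^sup>2 / 2"

definition spray_vec :: "('n::finite tvec \<Rightarrow> real) \<Rightarrow> 'n tvec \<Rightarrow> real^'n"
  where "spray_vec L z = (\<chi> i. spray L i z)"

text \<open>Homogeneity is stated infinitesimally, by Euler's relation. The open domain is
  arbitrary, so that the locale serves both the original and the changed metric.\<close>

locale finsler_chart =
  fixes U :: "'n::finite tvec set" and L :: "'n tvec \<Rightarrow> real"
  assumes open_U: "open U" and smooth_L: "smooth_on U L"
    and Euler_L: "z \<in> U \<Longrightarrow> vd (snd z) L z = L z"
    and regular: "z \<in> U \<Longrightarrow> invertible (metric_mat L z)"
begin

abbreviation "E \<equiv> energy L"
abbreviation "G \<equiv> spray_vec L"

text \<open>\<open>S\<close> is the derivation \<open>y\<^sup>i \<partial>\<^sub>i - 2 G\<^sup>i \<partial>/\<partial>y\<^sup>i\<close> along the geodesic spray and \<open>\<delta> k\<close> is \<open>k\<^sup>i \<delta>\<^sub>i\<close>.\<close>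

definition S :: "('n tvec \<Rightarrow> 'b::real_normed_vector) \<Rightarrow> 'n tvec \<Rightarrow> 'b"
  where "S f z = dd f z (snd z, - 2 *\<^sub>R G z)"

definition \<delta> :: "real^'n \<Rightarrow> ('n tvec \<Rightarrow> 'b::real_normed_vector) \<Rightarrow> 'n tvec \<Rightarrow> 'b"
  where "\<delta> k f z = dd f z (k, - vd k G z)"

lemma smooth_E: "smooth_on U E"
  unfolding energy_def
  by (intro smooth_on_divide smooth_on_power2 smooth_L open_U smooth_on_const) simp

lemma pdy_double:
  fixes f :: "'n tvec \<Rightarrow> real"
  shows "smooth_on U f \<Longrightarrow> z \<in> U \<Longrightarrow> pdy j (\<lambda>w. 2 * f w) z = 2 * vd (axis j 1) f z"
  unfolding pdy_eq_vd vd_def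
  by (rule dd_linear_comp[OF bounded_linear_mult_right smooth_on_differentiable])

lemma L2_eq: "(\<lambda>w. (L w)\<^sup>2) = (\<lambda>w. 2 * E w)" by (simp add: energy_def)

lemma pdy_pdy_L2:
  assumes "z \<in> U" shows "pdy i (pdy j (\<lambda>w. (L w)\<^sup>2)) z = 2 * vd (axis i 1) (vd (axis j 1) E) z"
proof -
  have "pdy i (pdy j (\<lambda>w. (L w)\<^sup>2)) z = pdy i (\<lambda>w. 2 * vd (axis j 1) E w) z"
    unfolding L2_eq pdy_eq_vd[of i]
    by (rule vd_cong[OF open_U assms], rule pdy_double[OF smooth_E])
  then show ?thesis by (simp add: pdy_double[OF smooth_on_vd[OF smooth_E] assms])
qed

lemma metric_eq: "z \<in> U \<Longrightarrow> metric L i j z = vd (axis i 1) (vd (axis j 1) E) z"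
  by (simp add: metric_def pdy_pdy_L2)

lemma metric_sum1:
  assumes z: "z \<in> U"
  shows "(\<Sum>j\<in>UNIV. metric L i j z * v $ j) = vd (axis i 1) (vd v E) z"
proof -
  have "vd v (vd (axis i 1) E) z = (\<Sum>j\<in>UNIV. v $ j * vd (axis j 1) (vd (axis i 1) E) z)"
    using vd_expand[OF smooth_on_vd[OF smooth_E] z, of v "axis i 1"] by simp
  also have "\<dots> = (\<Sum>j\<in>UNIV. metric L i j z * v $ j)"
    unfolding metric_eq[OF z] vd_commute[OF open_U smooth_E z, of "axis i 1"]
    by (simp only: mult.commute)
  finally show ?thesis unfolding vd_commute[OF open_U smooth_E z, of "axis i 1"] by simp
qed

lemma metric_sum:
  assumes z: "z \<in> U"
  shows "(\<Sum>i\<in>UNIV. \<Sum>j\<in>UNIV. metric L i j z * u $ i * v $ j) = vd u (vd v E) z"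
proof -
  have "(\<Sum>j\<in>UNIV. metric L i j z * u $ i * v $ j) = u $ i * vd (axis i 1) (vd v E) z" for i
    by (simp add: metric_sum1[OF z, symmetric] sum_distrib_left mult_ac)
  then show ?thesis using vd_expand[OF smooth_on_vd[OF smooth_E] z, of u v] by simp
qed

text \<open>Regularity of the metric allows equality of vectors to be tested after lowering the
  index.\<close>

lemma nondeg:
  assumes z: "z \<in> U" and u: "\<And>r. vd r (vd u E) z = 0"
  shows "u = 0"
proof -
  have "metric_mat L z *v u = 0"
    by (simp add: matrix_vector_mult_def metric_mat_def metric_sum1[OF z] u vec_eq_iff)
  then have "matrix_inv (metric_mat L z) *v (metric_mat L z *v u) = 0" by simp
  then show ?thesis by (simp add: matrix_vector_mul_assoc matrix_inv_inverse[OF regular[OF z]])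
qed

text \<open>Multiplication by g_{ji} undoes raising by g^{ir}. The definitions of the spray, the
  Cartan tensor and the Cartan connection thereby become lowered identities.\<close>

lemma metric_raise:
  assumes z: "z \<in> U" and v: "\<And>i. v $ i = (\<Sum>r\<in>UNIV. metric_inv L i r z * c r)"
  shows "vd (axis j 1) (vd v E) z = c j"
proof -
  have "v = matrix_inv (metric_mat L z) *v (\<chi> r. c r)"
    by (simp add: vec_eq_iff v matrix_vector_mult_def metric_inv_def)
  then have "metric_mat L z *v v = (\<chi> r. c r)"
    by (simp add: matrix_vector_mul_assoc matrix_inv_inverse[OF regular[OF z]])
  then have "(metric_mat L z *v v) $ j = c j" by simp
  then show ?thesis
    by (simp add: matrix_vector_mult_def metric_mat_def metric_sum1[OF z])
qed

lemma cartan_low_eq: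
  assumes z: "z \<in> U"
  shows "cartan_low L i j k z = vd (axis k 1) (vd (axis i 1) (vd (axis j 1) E)) z / 2"
proof -
  have "vd (axis k 1) (metric L i j) z = vd (axis k 1) (vd (axis i 1) (vd (axis j 1) E)) z"
    by (rule vd_cong[OF open_U z metric_eq])
  then show ?thesis by (simp add: cartan_low_def pdy_eq_vd)
qed

lemma smooth_metric: "smooth_on U (metric L i j)"
  using open_U metric_eq smooth_on_vd[OF smooth_on_vd[OF smooth_E]] by (rule smooth_on_cong)

lemma smooth_metric_inv: "smooth_on U (metric_inv L i j)"
  unfolding metric_inv_def
  by (rule smooth_on_matrix_inv[OF open_U _ regular]) (simp_all add: metric_mat_def smooth_metric)

lemma hd_expand:
  fixes f :: "'n tvec \<Rightarrow> real"
  assumes "smooth_on U f" "z \<in> U"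
  shows "dd f z (u, 0) = (\<Sum>i\<in>UNIV. u $ i * pdx i f z)"
proof -
  interpret linear "\<lambda>u. dd f z (u, 0)" by (rule linear_hd[OF assms])
  have "dd f z (u, 0) = dd f z (\<Sum>i\<in>UNIV. u $ i *\<^sub>R axis i 1, 0)"
    using basis_expansion[of u] by (simp add: scalar_mult_eq_scaleR)
  then show ?thesis by (simp add: sum scale pdx_def)
qed

lemma spray_low:
  assumes z: "z \<in> U"
  shows "(\<Sum>j\<in>UNIV. snd z $ j * pdy r (pdx j (\<lambda>w. (L w)\<^sup>2)) z) - pdx r (\<lambda>w. (L w)\<^sup>2) z
    = 2 * (dd (vd (axis r 1) E) z (snd z, 0) - dd E z (axis r 1, 0))"
proof -
  have x: "pdx j (\<lambda>w. (L w)\<^sup>2) w = 2 * dd E w (axis j 1, 0)" if "w \<in> U" for j w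
    unfolding L2_eq pdx_def
    by (rule dd_linear_comp[OF bounded_linear_mult_right smooth_on_differentiable[OF smooth_E that]])
  have "pdy r (pdx j (\<lambda>w. (L w)\<^sup>2)) z = 2 * dd (vd (axis r 1) E) z (axis j 1, 0)" for j
  proof -
    have "pdy r (pdx j (\<lambda>w. (L w)\<^sup>2)) z = pdy r (\<lambda>w. 2 * dd E w (axis j 1, 0)) z"
      unfolding pdy_eq_vd by (rule vd_cong[OF open_U z x])
    also have "\<dots> = 2 * vd (axis r 1) (\<lambda>w. dd E w (axis j 1, 0)) z"
      by (rule pdy_double[OF smooth_on_dd[OF smooth_E] z])
    finally show ?thesis
      unfolding vd_def dd_commute[OF open_U smooth_E z, of "(axis j 1, 0)"] .
  qed
  then show ?thesis
    by (simp add: x[OF z] hd_expand[OF smooth_on_vd[OF smooth_E] z, of _ "snd z"] pdx_def[of _ "vd _ _"]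
        sum_distrib_left mult_ac right_diff_distrib)
qed

lemma smooth_G: "smooth_on U G"
proof -
  have "smooth_on U (\<lambda>z. dd (vd (axis r 1) E) z (snd z, 0) - dd E z (axis r 1, 0))" for r
    by (intro smooth_on_diff[OF open_U] smooth_on_dd smooth_E
        smooth_on_dd_field[OF open_U smooth_on_vd[OF smooth_E]] smooth_on_Pair[OF open_U]
        smooth_on_snd[OF open_U] smooth_on_const)
  then have 1: "smooth_on U (\<lambda>z. \<Sum>r\<in>UNIV. metric_inv L i r z *
      (2 * (dd (vd (axis r 1) E) z (snd z, 0) - dd E z (axis r 1, 0))))" for i
    by (intro smooth_on_sum[OF open_U] smooth_on_mult[OF open_U] smooth_metric_inv smooth_on_const)
  have "smooth_on U (\<lambda>z. 1/4 * (\<Sum>r\<in>UNIV. metric_inv L i r z *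
      (2 * (dd (vd (axis r 1) E) z (snd z, 0) - dd E z (axis r 1, 0)))))" for i
    by (rule smooth_on_mult[OF open_U smooth_on_const 1])
  then have "smooth_on U (spray L i)" for i
    by (rule smooth_on_cong[OF open_U, rotated]) (simp add: spray_def spray_low)
  then show ?thesis unfolding spray_vec_def[abs_def] by (rule smooth_on_vec_lambda[OF open_U])
qed

lemma nonlin_eq: "z \<in> U \<Longrightarrow> nonlin L i j z = vd (axis j 1) G z $ i"
proof -
  assume z: "z \<in> U"
  have "spray L i = (\<lambda>w. G w $ i)" by (simp add: spray_vec_def)
  then show ?thesis
    unfolding nonlin_def pdy_eq_vd
    using dd_linear_comp[OF bounded_linear_vec_nth smooth_on_differentiable[OF smooth_G z]]
    by (simp add: vd_def)
qed

lemma metric_raise_vec: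
  assumes z: "z \<in> U" and c: "linear c" and v: "\<And>i. v $ i = (\<Sum>r\<in>UNIV. metric_inv L i r z * c (axis r 1))"
  shows "vd u (vd v E) z = c u"
  by (rule axis_test[OF linear_vd[OF smooth_on_vd[OF smooth_E] z] c]) (rule metric_raise[OF z v])

lemma linear_hd2:
  fixes f :: "'n tvec \<Rightarrow> real"
  assumes "smooth_on U f" "z \<in> U"
  shows "linear (\<lambda>r. dd (vd r f) z h)"
proof -
  have "dd (vd r f) z h = vd r (\<lambda>w. dd f w h) z" for r
    unfolding vd_def by (rule dd_commute[OF open_U assms])
  then show ?thesis using linear_vd[OF smooth_on_dd[OF assms(1)] assms(2)] by simp
qed

text \<open>The defining formula of G^i with its index lowered.\<close>

lemma spray_eq:
  assumes z: "z \<in> U"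
  shows "2 * vd r (vd (G z) E) z = dd (vd r E) z (snd z, 0) - dd E z (r, 0)"
proof -
  define c where "c = (\<lambda>r. (1/2) *\<^sub>R (dd (vd r E) z (snd z, 0) - dd E z (r, 0)))"
  have "linear c"
    unfolding c_def
    by (intro linear_compose_scale_right linear_compose_sub linear_hd2[OF smooth_E z]
        linear_hd[OF smooth_E z])
  moreover have "G z $ i = (\<Sum>r\<in>UNIV. metric_inv L i r z * c (axis r 1))" for i
    unfolding spray_vec_def spray_def c_def
    unfolding spray_low[OF z] sum_distrib_left vec_lambda_beta by (rule sum.cong) simp_all
  ultimately have "vd r (vd (G z) E) z = c r" by (rule metric_raise_vec[OF z])
  then show ?thesis by (simp add: c_def)
qed

lemmas smooth_vdE = smooth_on_vd[OF smooth_E]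
lemmas smooth_vdG = smooth_on_vd[OF smooth_G]

lemma vd_linear_simps:
  fixes f :: "'n tvec \<Rightarrow> 'b::euclidean_space"
  assumes "smooth_on U f" "z \<in> U"
  shows "vd (u + v) f z = vd u f z + vd v f z" "vd (u - v) f z = vd u f z - vd v f z"
    "vd (- u) f z = - vd u f z" "vd (c *\<^sub>R u) f z = c *\<^sub>R vd u f z" "vd 0 f z = 0"
    "vd r (vd (u + v) f) z = vd r (vd u f) z + vd r (vd v f) z"
    "vd r (vd (u - v) f) z = vd r (vd u f) z - vd r (vd v f) z"
    "vd r (vd (- u) f) z = - vd r (vd u f) z"
    "vd r (vd (c *\<^sub>R u) f) z = c *\<^sub>R vd r (vd u f) z" "vd r (vd 0 f) z = 0"
  by (fact linear_add[OF linear_vd[OF assms]] linear_diff[OF linear_vd[OF assms]]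
      linear_neg[OF linear_vd[OF assms]] linear_cmul[OF linear_vd[OF assms]]
      linear_0[OF linear_vd[OF assms]] linear_add[OF linear_vd2[OF open_U assms]]
      linear_diff[OF linear_vd2[OF open_U assms]] linear_neg[OF linear_vd2[OF open_U assms]]
      linear_cmul[OF linear_vd2[OF open_U assms]] linear_0[OF linear_vd2[OF open_U assms]])+

lemma vd_energy: assumes z: "z \<in> U" shows "vd i E z = L z * vd i L z"
proof -
  have "(E has_derivative (\<lambda>h. L z * dd L z h)) (at z)"
    unfolding energy_def
    by (auto intro!: derivative_eq_intros smooth_on_has_derivative[OF smooth_L z] simp: fun_eq_iff)
  then show ?thesis unfolding vd_def by (rule dd_eqI)
qed

lemma Euler_E: "z \<in> U \<Longrightarrow> vd (snd z) E z = 2 * E z"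
  by (simp add: vd_energy Euler_L energy_def[of L z] power2_eq_square)

lemma Euler_vdE: assumes z: "z \<in> U" shows "vd (snd z) (vd r E) z = vd r E z"
  using Euler_vd[OF open_U smooth_E z Euler_E] by simp

lemma Euler_vdE': assumes z: "z \<in> U" shows "vd r (vd (snd z) E) z = vd r E z"
  using Euler_vdE[OF z] vd_commute[OF open_U smooth_E z] by simp

lemma Euler_vd2E: assumes z: "z \<in> U" shows "vd (snd z) (vd r (vd s E)) z = 0"
  using Euler_vd[OF open_U smooth_vdE z, of s 1] Euler_vdE by simp

text \<open>\<open>spray_eq\<close> is differentiated along y: g_{ri} has degree 0 and the right
  side degree 2, so G has degree 2.\<close>

lemma Euler_G: assumes z: "z \<in> U" shows "vd (snd z) G z = 2 *\<^sub>R G z"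
proof -
  define y where "y = snd z"
  have "vd r (vd (vd y G z - 2 *\<^sub>R G z) E) z = 0" for r
  proof -
    have f: "((\<lambda>w. (0::real^'n, G w)) has_derivative (\<lambda>h. (0, dd G z h))) (at z)"
      by (intro has_derivative_Pair smooth_on_has_derivative[OF smooth_G z] has_derivative_const)
    have g: "((\<lambda>w. (snd w, 0::real^'n)) has_derivative (\<lambda>h. (snd h, 0))) (at z)"
      by (intro has_derivative_Pair has_derivative_snd has_derivative_ident has_derivative_const)
    have "vd y (\<lambda>w. dd (vd r E) w (0, G w)) z =
        dd (\<lambda>w. dd (vd r E) w (0, y)) z (0, G z) + dd (vd r E) z (0, dd G z (0, y))"
      unfolding vd_def[of y] by (rule dd_eqI[OF has_derivative_dd_field[OF open_U smooth_vdE z f]])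
    also have "dd (\<lambda>w. dd (vd r E) w (0, y)) z (0, G z) = vd y (vd (G z) (vd r E)) z"
      unfolding dd_vert vd_def[symmetric] by (rule vd_commute[OF open_U smooth_vdE z])
    also have "\<dots> = 0" unfolding y_def by (rule Euler_vd2E[OF z])
    finally have 1: "vd y (\<lambda>w. dd (vd r E) w (0, G w)) z = vd (vd y G z) (vd r E) z"
      by (simp add: vd_def[of "dd G z (0, y)"] vd_def[of y G])
    have "vd y (\<lambda>w. dd (vd r E) w (snd w, 0)) z =
        dd (\<lambda>w. dd (vd r E) w (0, y)) z (snd z, 0) + dd (vd r E) z (y, 0)"
      unfolding vd_def[of y]
      using dd_eqI[OF has_derivative_dd_field[OF open_U smooth_vdE z g], where h = "(0, y)"] by simp
    also have "dd (\<lambda>w. dd (vd r E) w (0, y)) z (snd z, 0) = vd y (\<lambda>w. dd (vd r E) w (y, 0)) z"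
      using dd_commute[OF open_U smooth_vdE z] by (simp add: vd_def y_def)
    also have "\<dots> = dd (vd r E) z (y, 0)"
      unfolding y_def using Euler_hd[OF open_U smooth_vdE z, of r 1] Euler_vdE by simp
    finally have 2: "vd y (\<lambda>w. dd (vd r E) w (snd w, 0)) z = 2 * dd (vd r E) z (y, 0)" by simp
    have 3: "vd y (\<lambda>w. dd E w (r, 0)) z = 2 * dd E z (r, 0)"
      unfolding y_def by (rule Euler_hd[OF open_U smooth_E z Euler_E])
    have "2 * vd y (\<lambda>w. dd (vd r E) w (0, G w)) z = vd y (\<lambda>w. 2 * dd (vd r E) w (0, G w)) z"
      unfolding vd_def[of y]
      by (rule dd_linear_comp[OF bounded_linear_mult_right, symmetric],
          rule smooth_on_differentiable[OF _ z],
          intro smooth_on_dd_field[OF open_U smooth_vdE] smooth_on_Pair[OF open_U] smooth_on_const smooth_G)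
    also have "\<dots> = vd y (\<lambda>w. dd (vd r E) w (snd w, 0) - dd E w (r, 0)) z"
    proof (rule vd_cong[OF open_U z])
      fix w assume w: "w \<in> U"
      show "2 * dd (vd r E) w (0, G w) = dd (vd r E) w (snd w, 0) - dd E w (r, 0)"
        using spray_eq[OF w, of r] vd_commute[OF open_U smooth_E w, of r "G w"] by (simp add: vd_def)
    qed
    also have "\<dots> = vd y (\<lambda>w. dd (vd r E) w (snd w, 0)) z - vd y (\<lambda>w. dd E w (r, 0)) z"
      unfolding vd_def[of y]
      by (rule dd_eqI, intro has_derivative_diff smooth_on_has_derivative[OF _ z]
          smooth_on_dd[OF smooth_E] smooth_on_dd_field[OF open_U smooth_vdE]
          smooth_on_Pair[OF open_U] smooth_on_const smooth_on_snd[OF open_U])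
    finally have "2 * vd (vd y G z) (vd r E) z = 2 * (dd (vd r E) z (y, 0) - dd E z (r, 0))"
      unfolding 1 2 3 by simp
    also have "\<dots> = 2 * (2 * vd r (vd (G z) E) z)" by (simp only: spray_eq[OF z] y_def)
    finally show ?thesis
      by (simp add: vd_linear_simps[OF smooth_E z] vd_commute[OF open_U smooth_E z, of r])
  qed
  from nondeg[OF z this] show ?thesis by (simp add: y_def)
qed

section \<open>Derivations along the spray and horizontal derivations\<close>

lemma S_\<delta>: "z \<in> U \<Longrightarrow> S f z = \<delta> (snd z) f z"
  \<comment> \<open>Homogeneity of degree two gives G^i_j y^j = 2 G^i.\<close>
  by (simp add: S_def \<delta>_def Euler_G)

lemma linear_\<delta>:
  assumes "smooth_on U f" "z \<in> U"
  shows "linear (\<lambda>k. \<delta> k f z)"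
proof -
  have "linear (\<lambda>k. (k, - vd k G z))"
    by (auto intro!: linearI simp: vd_linear_simps[OF smooth_G assms(2)])
  then show ?thesis
    unfolding \<delta>_def by (rule linear_compose[OF _ linear_dd[OF assms], unfolded o_def])
qed

lemma S_cong: "z \<in> U \<Longrightarrow> (\<And>w. w \<in> U \<Longrightarrow> f w = g w) \<Longrightarrow> S f z = S g z"
  unfolding S_def by (rule dd_cong[OF open_U])

lemma smooth_S: "smooth_on U f \<Longrightarrow> smooth_on U (S f)"
  unfolding S_def
  by (intro smooth_on_dd_field[OF open_U] smooth_on_Pair[OF open_U] smooth_on_snd[OF open_U]
      smooth_on_bounded_linear[OF bounded_linear_scaleR_right open_U] smooth_G)

lemma smooth_\<delta>: "smooth_on U f \<Longrightarrow> smooth_on U (\<delta> k f)"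
  unfolding \<delta>_def
  by (intro smooth_on_dd_field[OF open_U] smooth_on_Pair[OF open_U] smooth_on_const
      smooth_on_bounded_linear[OF bounded_linear_minus[OF bounded_linear_ident] open_U] smooth_vdG)

text \<open>The commutator of a vertical derivation with S, read off from the coefficients (y, -2G)
  of S.\<close>

lemma vd_S:
  fixes f :: "'n tvec \<Rightarrow> real"
  assumes f: "smooth_on U f" and z: "z \<in> U"
  shows "vd r (S f) z = S (vd r f) z + 2 * \<delta> r f z - dd f z (r, 0)"
proof -
  have d: "((\<lambda>w. (snd w, - 2 *\<^sub>R G w)) has_derivative (\<lambda>h. (snd h, - 2 *\<^sub>R dd G z h))) (at z)"
    by (intro has_derivative_Pair has_derivative_snd has_derivative_ident
        has_derivative_scaleR_right smooth_on_has_derivative[OF smooth_G z])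
  have "vd r (S f) z = dd (\<lambda>w. dd f w (0, r)) z (snd z, - 2 *\<^sub>R G z) + dd f z (r, - 2 *\<^sub>R dd G z (0, r))"
    unfolding vd_def[of r] S_def
    using dd_eqI[OF has_derivative_dd_field[OF open_U f z d], of "(0, r)"] by simp
  also have "dd f z (r, - 2 *\<^sub>R dd G z (0, r)) = 2 * \<delta> r f z - dd f z (r, 0)"
    using dd_pair[OF f z, of r "- 2 *\<^sub>R dd G z (0, r)"] dd_pair[OF f z, of r "- dd G z (0, r)"]
    by (simp add: \<delta>_def vd_def[of r] vd_linear_simps[OF f z])
  finally show ?thesis unfolding dd_vert S_def by simp
qed

text \<open>The commutator of a vertical and a horizontal derivation; its coefficients, the second
  vertical derivatives of G, form the Berwald connection.\<close>

lemma vd_\<delta>: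
  fixes f :: "'n tvec \<Rightarrow> real"
  assumes f: "smooth_on U f" and z: "z \<in> U"
  shows "vd r (\<delta> k f) z = \<delta> k (vd r f) z - vd (vd r (vd k G) z) f z"
proof -
  have d: "((\<lambda>w. (k, - vd k G w)) has_derivative (\<lambda>h. (0, - dd (vd k G) z h))) (at z)"
    by (intro has_derivative_Pair has_derivative_minus has_derivative_const
        smooth_on_has_derivative[OF smooth_vdG z])
  have "vd r (\<delta> k f) z = dd (\<lambda>w. dd f w (0, r)) z (k, - vd k G z) + dd f z (0, - dd (vd k G) z (0, r))"
    unfolding vd_def[of r] \<delta>_def by (rule dd_eqI[OF has_derivative_dd_field[OF open_U f z d]])
  moreover have "dd f z (0, - dd (vd k G) z (0, r)) = - vd (vd r (vd k G) z) f z"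
    using vd_linear_simps(3)[OF f z, of "vd r (vd k G) z"] by (simp only: vd_def)
  ultimately show ?thesis unfolding dd_vert \<delta>_def by simp
qed

lemma dd_eq_\<delta>:
  fixes f :: "'n tvec \<Rightarrow> real"
  assumes f: "smooth_on U f" and z: "z \<in> U"
  shows "dd f z (r, 0) = \<delta> r f z + vd (vd r G z) f z"
  using dd_pair[OF f z, of r "- vd r G z"] by (simp add: \<delta>_def vd_linear_simps[OF f z])

text \<open>The Euler-Lagrange equation of the energy, which restates the lowered spray
  equation.\<close>

lemma Euler_Lagrange: assumes z: "z \<in> U" shows "S (vd r E) z = dd E z (r, 0)"
proof -
  have "S (vd r E) z = dd (vd r E) z (snd z, 0) - 2 * vd r (vd (G z) E) z"
    using dd_pair[OF smooth_vdE z, of r "snd z" "- 2 *\<^sub>R G z"] vd_commute[OF open_U smooth_E z, of r "G z"]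
    by (simp add: S_def vd_linear_simps[OF smooth_vdE z])
  then show ?thesis using spray_eq[OF z, of r] by simp
qed

text \<open>The vector y moves along S with velocity -2G, which the last term records.\<close>

lemma S_vd_snd:
  fixes f :: "'n tvec \<Rightarrow> real"
  assumes f: "smooth_on U f" and z: "z \<in> U"
  shows "S (\<lambda>w. vd (snd w) f w) z = S (vd (snd z) f) z - 2 * vd (G z) f z"
  using vd_Euler[OF open_U f z] by (simp add: S_def vd_linear_simps[OF f z])

lemma \<delta>_vd_snd:
  fixes f :: "'n tvec \<Rightarrow> real"
  assumes f: "smooth_on U f" and z: "z \<in> U"
  shows "\<delta> k (\<lambda>w. vd (snd w) f w) z = \<delta> k (vd (snd z) f) z - vd (vd k G z) f z"
  using vd_Euler[OF open_U f z] by (simp add: \<delta>_def vd_linear_simps[OF f z])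

text \<open>Applying S to Euler's relation for E and inserting the Euler-Lagrange equation gives 2 S
  E = S E.\<close>

lemma S_E: assumes z: "z \<in> U" shows "S E z = 0"
proof -
  have "S (\<lambda>w. vd (snd w) E w) z = S (\<lambda>w. 2 * E w) z" by (rule S_cong[OF z Euler_E])
  also have "\<dots> = 2 * S E z" unfolding S_def
    by (rule dd_linear_comp[OF bounded_linear_mult_right smooth_on_differentiable[OF smooth_E z]])
  finally have 1: "S (vd (snd z) E) z - 2 * vd (G z) E z = 2 * S E z"
    by (simp only: S_vd_snd[OF smooth_E z])
  have "S E z = dd E z (snd z, 0) - 2 * vd (G z) E z"
    using dd_pair[OF smooth_E z, of "snd z" "- 2 *\<^sub>R G z"] by (simp add: S_def vd_linear_simps[OF smooth_E z])
  with 1 Euler_Lagrange[OF z, of "snd z"] show ?thesis by simp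
qed

text \<open>In the vertical derivative of S E = 0 the Euler-Lagrange equation cancels all but the
  horizontal term.\<close>

lemma \<delta>_E: assumes z: "z \<in> U" shows "\<delta> r E z = 0"
proof -
  have "vd r (S E) z = vd r (\<lambda>_. 0) z" by (rule vd_cong[OF open_U z S_E])
  then show ?thesis using vd_S[OF smooth_E z, of r] Euler_Lagrange[OF z, of r] by (simp add: vd_const)
qed

text \<open>The vertical derivative of \<open>\<delta>_E\<close>. The right side is symmetric in r
  and k.\<close>

lemma \<delta>_vdE: assumes z: "z \<in> U" shows "\<delta> k (vd r E) z = vd (vd r (vd k G) z) E z"
proof -
  have "vd r (\<delta> k E) z = vd r (\<lambda>_. 0) z" by (rule vd_cong[OF open_U z \<delta>_E])
  then show ?thesis using vd_\<delta>[OF smooth_E z, of r k] by (simp add: vd_const)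
qed

text \<open>A vertical derivative of the Euler-Lagrange equation; it says that the metric is
  parallel along the spray for the coefficients G^i_j.\<close>

lemma S_vd2E:
  assumes z: "z \<in> U"
  shows "S (vd r (vd k E)) z = vd (vd r G z) (vd k E) z + vd (vd k G z) (vd r E) z"
proof -
  have "vd k (S (vd r E)) z = vd k (\<lambda>w. dd E w (r, 0)) z"
    by (rule vd_cong[OF open_U z Euler_Lagrange])
  also have "\<dots> = dd (vd k E) z (r, 0)"
    unfolding vd_def by (rule dd_commute[OF open_U smooth_E z])
  finally have 1: "S (vd k (vd r E)) z + 2 * \<delta> k (vd r E) z - dd (vd r E) z (k, 0) = dd (vd k E) z (r, 0)"
    unfolding vd_S[OF smooth_vdE z] .
  have "S (vd k (vd r E)) z = S (vd r (vd k E)) z"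
    by (rule S_cong[OF z vd_commute[OF open_U smooth_E]])
  moreover have "\<delta> k (vd r E) z = \<delta> r (vd k E) z"
    unfolding \<delta>_vdE[OF z] vd_commute[OF open_U smooth_G z, of r] ..
  ultimately show ?thesis using 1 by (simp add: dd_eq_\<delta>[OF smooth_vdE z])
qed

section \<open>The Cartan connection\<close>

text \<open>\<open>conn_low\<close> is \<open>F\<^bsub>rjk\<^esub> = g\<^bsub>ri\<^esub> F\<^sup>i\<^bsub>jk\<^esub>\<close>.\<close>

definition conn_low :: "real^'n \<Rightarrow> real^'n \<Rightarrow> real^'n \<Rightarrow> 'n tvec \<Rightarrow> real"
  where "conn_low r j k z =
    (\<delta> k (vd r (vd j E)) z + \<delta> j (vd r (vd k E)) z - \<delta> r (vd j (vd k E)) z) / 2"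

text \<open>The deflection identity F^i_{jk} y^j = G^i_k, lowered. In the Christoffel formula the
  derivatives of y_r cancel by symmetry and the metric is parallel along S.\<close>

lemma conn_low_snd:
  assumes z: "z \<in> U"
  shows "conn_low r (snd z) k z = vd r (vd (vd k G z) E) z"
proof -
  have *: "\<delta> k (vd r (vd (snd z) E)) z = \<delta> k (vd r E) z + vd (vd k G z) (vd r E) z" for r k
  proof -
    have "\<delta> k (vd r (vd (snd z) E)) z = \<delta> k (vd (snd z) (vd r E)) z"
      unfolding \<delta>_def by (rule dd_cong[OF open_U z vd_commute[OF open_U smooth_E]])
    also have "\<dots> = \<delta> k (\<lambda>w. vd (snd w) (vd r E) w) z + vd (vd k G z) (vd r E) z"
      unfolding \<delta>_vd_snd[OF smooth_vdE z] by simp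
    also have "\<delta> k (\<lambda>w. vd (snd w) (vd r E) w) z = \<delta> k (vd r E) z"
      unfolding \<delta>_def by (rule dd_cong[OF open_U z Euler_vdE])
    finally show ?thesis .
  qed
  have "\<delta> r (vd (snd z) (vd k E)) z = \<delta> r (vd k (vd (snd z) E)) z"
    unfolding \<delta>_def by (rule dd_cong[OF open_U z vd_commute[OF open_U smooth_E]])
  moreover have "\<delta> k (vd r E) z = \<delta> r (vd k E) z"
    unfolding \<delta>_vdE[OF z] vd_commute[OF open_U smooth_G z, of r] ..
  ultimately show ?thesis
    unfolding conn_low_def * S_\<delta>[OF z, symmetric] S_vd2E[OF z]
    using * vd_commute[OF open_U smooth_E z, of r "vd k G z"] by simp
qed

lemma linear_dd_vd2:
  fixes f :: "'n tvec \<Rightarrow> real"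
  assumes f: "smooth_on U f" and z: "z \<in> U"
  shows "linear (\<lambda>u. dd (vd r (vd u f)) z h)"
proof -
  have "dd (vd r (vd u f)) z h = dd (vd u (vd r f)) z h" for u
    by (rule dd_cong[OF open_U z vd_commute[OF open_U f]])
  then show ?thesis using linear_hd2[OF smooth_on_vd[OF f] z] by simp
qed

lemma \<delta>_vd2_commute:
  fixes f :: "'n tvec \<Rightarrow> real"
  assumes f: "smooth_on U f" and z: "z \<in> U"
  shows "\<delta> k (vd r (vd u f)) z = \<delta> k (vd u (vd r f)) z"
  unfolding \<delta>_def by (rule dd_cong[OF open_U z vd_commute[OF open_U f]])

lemma linear_\<delta>_vd:
  fixes f :: "'n tvec \<Rightarrow> real"
  assumes f: "smooth_on U f" and z: "z \<in> U"
  shows "linear (\<lambda>u. \<delta> k (vd u f) z)" "linear (\<lambda>u. \<delta> k (vd r (vd u f)) z)"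
    "linear (\<lambda>u. \<delta> u (vd r (vd s f)) z)"
  unfolding \<delta>_def[of k]
  by (rule linear_hd2[OF f z] linear_dd_vd2[OF f z] linear_\<delta>[OF smooth_on_vd[OF smooth_on_vd[OF f]] z])+

lemma delta_eq:
  fixes f :: "'n tvec \<Rightarrow> real"
  assumes f: "smooth_on U f" and z: "z \<in> U"
  shows "delta L k f z = \<delta> (axis k 1) f z"
  using vd_expand[OF f z, of "vd (axis k 1) G z"] dd_eq_\<delta>[OF f z, of "axis k 1"]
  by (simp add: delta_def pdx_def pdy_eq_vd nonlin_eq[OF z])

lemma delta_sum:
  fixes f :: "'n tvec \<Rightarrow> real"
  assumes f: "smooth_on U f" and z: "z \<in> U"
  shows "(\<Sum>k\<in>UNIV. delta L k f z * u $ k) = \<delta> u f z"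
  using linear_expand[OF linear_\<delta>[OF f z], of u] by (simp add: delta_eq[OF f z] mult.commute)

lemma delta_metric:
  assumes z: "z \<in> U"
  shows "delta L k (metric L i j) z = \<delta> (axis k 1) (vd (axis i 1) (vd (axis j 1) E)) z"
  unfolding delta_eq[OF smooth_metric z] \<delta>_def by (rule dd_cong[OF open_U z metric_eq])

definition conn_vec :: "'n \<Rightarrow> 'n \<Rightarrow> 'n tvec \<Rightarrow> real^'n"
  where "conn_vec j k z = (\<chi> i. cartan_conn L i j k z)"

lemma linear_conn_low:
  assumes z: "z \<in> U"
  shows "linear (\<lambda>r. conn_low r j k z)" "linear (\<lambda>j. conn_low r j k z)" "linear (\<lambda>k. conn_low r j k z)"
proof -
  have "linear (\<lambda>u. \<delta> k (vd u (vd r E)) z)" for k r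
    using linear_\<delta>_vd(1)[OF smooth_vdE z] .
  note l = this linear_\<delta>_vd(2,3)[OF smooth_E z]
  have *: "linear P \<Longrightarrow> linear Q \<Longrightarrow> linear R \<Longrightarrow> linear (\<lambda>u. (P u + Q u - R u) / 2)"
    for P Q R :: "real^'n \<Rightarrow> real"
    by (auto intro!: linearI simp: linear_add linear_cmul field_simps)
  show "linear (\<lambda>r. conn_low r j k z)" "linear (\<lambda>j. conn_low r j k z)" "linear (\<lambda>k. conn_low r j k z)"
    unfolding conn_low_def by (intro * l)+
qed

lemma conn_low_sym: "z \<in> U \<Longrightarrow> conn_low r j k z = conn_low r k j z"
  using \<delta>_vd2_commute[OF smooth_E, of z r j k] by (simp add: conn_low_def)

lemma conn_vec:
  assumes z: "z \<in> U"
  shows "vd u (vd (conn_vec j k z) E) z = conn_low u (axis j 1) (axis k 1) z"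
proof -
  define c where "c = (\<lambda>u. conn_low u (axis j 1) (axis k 1) z)"
  have "linear c" unfolding c_def by (rule linear_conn_low[OF z])
  moreover have "conn_vec j k z $ i = (\<Sum>r\<in>UNIV. metric_inv L i r z * c (axis r 1))" for i
    by (simp add: conn_vec_def cartan_conn_def c_def conn_low_def delta_metric[OF z] sum_distrib_left mult_ac)
  ultimately have "vd u (vd (conn_vec j k z) E) z = c u" by (rule metric_raise_vec[OF z])
  then show ?thesis by (simp add: c_def)
qed

lemma cartan_conn_sym:
  assumes z: "z \<in> U" shows "cartan_conn L i j k z = cartan_conn L i k j z"
proof -
  have "conn_vec j k z - conn_vec k j z = 0"
    by (rule nondeg[OF z])
      (simp add: vd_linear_simps[OF smooth_E z] conn_vec[OF z] conn_low_sym[OF z, of _ "axis j 1"])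
  then have "conn_vec j k z $ i = conn_vec k j z $ i" by simp
  then show ?thesis by (simp add: conn_vec_def)
qed

text \<open>Lowering the index i reduces this to \<open>conn_low_snd\<close>.\<close>

lemma cartan_conn_snd:
  assumes z: "z \<in> U"
  shows "(\<Sum>k\<in>UNIV. cartan_conn L i j k z * snd z $ k) = nonlin L i j z"
proof -
  define v where "v = (\<Sum>k\<in>UNIV. snd z $ k *\<^sub>R conn_vec j k z)"
  have "vd u (vd v E) z = vd u (vd (vd (axis j 1) G z) E) z" for u
  proof -
    have "vd u (vd v E) z = (\<Sum>k\<in>UNIV. snd z $ k * vd u (vd (conn_vec j k z) E) z)"
      unfolding v_def
      by (simp add: linear_sum[OF linear_vd2[OF open_U smooth_E z]] vd_linear_simps[OF smooth_E z])
    also have "\<dots> = conn_low u (axis j 1) (snd z) z"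
      using linear_expand[OF linear_conn_low(3)[OF z], of u "axis j 1" "snd z"] by (simp add: conn_vec[OF z])
    finally show ?thesis
      using conn_low_snd[OF z, of u "axis j 1"] conn_low_sym[OF z, of u "axis j 1"] by simp
  qed
  then have "v - vd (axis j 1) G z = 0"
    by (intro nondeg[OF z]) (simp add: vd_linear_simps[OF smooth_E z])
  then have "v $ i = vd (axis j 1) G z $ i" by simp
  then show ?thesis
    by (simp add: v_def conn_vec_def nonlin_eq[OF z] mult.commute)
qed

text \<open>Pairing with a lowered vector cancels the inverse metric; this is the form in which
  F^i_{jk} enters the second fundamental tensor.\<close>

lemma cartan_conn_sum:
  assumes z: "z \<in> U"
  shows "(\<Sum>i\<in>UNIV. (\<Sum>l\<in>UNIV. metric L i l z * n $ l) *
      (\<Sum>j\<in>UNIV. \<Sum>k\<in>UNIV. cartan_conn L i j k z * a $ j * b $ k)) = conn_low n a b z"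
proof -
  have "conn_low n a b z = (\<Sum>j\<in>UNIV. a $ j * (\<Sum>k\<in>UNIV. b $ k * conn_low n (axis j 1) (axis k 1) z))"
    using linear_expand[OF linear_conn_low(2)[OF z], of n a b] linear_expand[OF linear_conn_low(3)[OF z], of n _ b]
    by simp
  also have "\<dots> = (\<Sum>j\<in>UNIV. a $ j * (\<Sum>k\<in>UNIV. b $ k * (\<Sum>i\<in>UNIV. cartan_conn L i j k z * vd (axis i 1) (vd n E) z)))"
  proof -
    have "conn_low n (axis j 1) (axis k 1) z = (\<Sum>i\<in>UNIV. cartan_conn L i j k z * vd (axis i 1) (vd n E) z)" for j k
      using conn_vec[OF z, of n j k] vd_expand[OF smooth_vdE z, of "conn_vec j k z" n]
        vd_commute[OF open_U smooth_E z, of n "conn_vec j k z"]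
      by (simp add: conn_vec_def)
    then show ?thesis by simp
  qed
  also have "\<dots> = (\<Sum>j\<in>UNIV. \<Sum>k\<in>UNIV. \<Sum>i\<in>UNIV. a $ j * b $ k * cartan_conn L i j k z * vd (axis i 1) (vd n E) z)"
    by (simp add: sum_distrib_left mult_ac)
  also have "\<dots> = (\<Sum>i\<in>UNIV. \<Sum>j\<in>UNIV. \<Sum>k\<in>UNIV. a $ j * b $ k * cartan_conn L i j k z * vd (axis i 1) (vd n E) z)"
    by (subst (2) sum.swap, subst sum.swap) rule
  finally show ?thesis unfolding metric_sum1[OF z] by (simp add: sum_distrib_left mult_ac)
qed

section \<open>The Cartan tensor and contractions with moving vectors\<close>

lemma cartan_low_sum:
  assumes z: "z \<in> U"
  shows "(\<Sum>i\<in>UNIV. \<Sum>j\<in>UNIV. \<Sum>k\<in>UNIV. cartan_low L i j k z * a $ i * b $ j * c $ k)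
    = vd c (vd a (vd b E)) z / 2"
proof -
  have "vd c (vd a (vd b E)) z = (\<Sum>i\<in>UNIV. a $ i * vd c (vd (axis i 1) (vd b E)) z)"
    using linear_expand[OF linear_vd2[OF open_U smooth_vdE z], of c a b] by simp
  also have "\<dots> = (\<Sum>i\<in>UNIV. a $ i * (\<Sum>j\<in>UNIV. b $ j * vd c (vd (axis i 1) (vd (axis j 1) E)) z))"
    using linear_expand[OF linear_vd3[OF open_U smooth_E z], of c _ b] by simp
  also have "\<dots> = (\<Sum>i\<in>UNIV. a $ i * (\<Sum>j\<in>UNIV. b $ j * (\<Sum>k\<in>UNIV. c $ k * (2 * cartan_low L i j k z))))"
    using vd_expand[OF smooth_on_vd[OF smooth_vdE] z, of c] by (simp add: cartan_low_eq[OF z])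
  finally show ?thesis by (simp add: sum_distrib_left sum_divide_distrib mult_ac)
qed

definition cartan_vec :: "'n \<Rightarrow> 'n \<Rightarrow> 'n tvec \<Rightarrow> real^'n"
  where "cartan_vec a b z = (\<chi> h. cartan L h a b z)"

lemma smooth_cartan: "smooth_on U (cartan L h a b)"
proof -
  have "smooth_on U (\<lambda>z. vd (axis k 1) (vd (axis a 1) (vd (axis b 1) E)) z / 2)" for k
    by (intro smooth_on_divide[OF open_U] smooth_on_vd smooth_E smooth_on_const) simp
  with open_U cartan_low_eq have "smooth_on U (cartan_low L a b k)" for k
    by (rule smooth_on_cong)
  then show ?thesis unfolding cartan_def
    by (intro smooth_on_sum[OF open_U] smooth_on_mult[OF open_U] smooth_metric_inv)
qed

lemma smooth_cartan_vec: "smooth_on U (cartan_vec a b)"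
  unfolding cartan_vec_def by (rule smooth_on_vec_lambda[OF open_U smooth_cartan])

lemma cartan_vec:
  assumes z: "z \<in> U"
  shows "vd r (vd (cartan_vec a b z) E) z = vd r (vd (axis a 1) (vd (axis b 1) E)) z / 2"
proof -
  define c where "c = (\<lambda>r. (1/2) *\<^sub>R vd r (vd (axis a 1) (vd (axis b 1) E)) z)"
  have "linear c"
    unfolding c_def by (intro linear_compose_scale_right linear_vd[OF smooth_on_vd[OF smooth_vdE] z])
  moreover have "cartan_vec a b z $ i = (\<Sum>r\<in>UNIV. metric_inv L i r z * c (axis r 1))" for i
    by (simp add: cartan_vec_def cartan_def c_def cartan_low_eq[OF z])
  ultimately have "vd r (vd (cartan_vec a b z) E) z = c r" by (rule metric_raise_vec[OF z])
  then show ?thesis by (simp add: c_def)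
qed

lemma S_vd_field:
  fixes f :: "'n tvec \<Rightarrow> 'b::euclidean_space"
  assumes f: "smooth_on U f" and \<xi>: "smooth_on U \<xi>" and z: "z \<in> U"
  shows "S (\<lambda>w. vd (\<xi> w) f w) z = S (vd (\<xi> z) f) z + vd (S \<xi> z) f z"
  unfolding S_def by (rule dd_vd_field[OF open_U f z smooth_on_has_derivative[OF \<xi> z]])

lemma vd_vd_field:
  fixes f :: "'n tvec \<Rightarrow> 'b::euclidean_space"
  assumes f: "smooth_on U f" and \<xi>: "smooth_on U \<xi>" and z: "z \<in> U"
  shows "vd r (\<lambda>w. vd (\<xi> w) f w) z = vd r (vd (\<xi> z) f) z + vd (vd r \<xi> z) f z"
  unfolding vd_def[of r] by (rule dd_vd_field[OF open_U f z smooth_on_has_derivative[OF \<xi> z]])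

text \<open>The Berwald covariant derivative of the vertical Hessian of \<open>f\<close>, when this Hessian is
  parallel along the spray.\<close>

definition hess_berwald :: "('n tvec \<Rightarrow> real) \<Rightarrow> real^'n \<Rightarrow> real^'n \<Rightarrow> real^'n \<Rightarrow> 'n tvec \<Rightarrow> real"
  where "hess_berwald f r i j z = vd (vd r G z) (vd i (vd j f)) z + vd (vd i G z) (vd r (vd j f)) z
    + vd (vd j G z) (vd r (vd i f)) z - S (vd r (vd i (vd j f))) z"

text \<open>Third vertical derivatives are totally symmetric, and the three terms with G are
  permuted among themselves.\<close>

lemma hess_berwald_sym:
  assumes f: "smooth_on U f" and z: "z \<in> U"
  shows "hess_berwald f r i j z = hess_berwald f i r j z"
    "hess_berwald f r i j z = hess_berwald f r j i z"
proof -
  have "S (vd r (vd i (vd j f))) z = S (vd i (vd r (vd j f))) z"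
    by (rule S_cong[OF z vd_commute[OF open_U smooth_on_vd[OF f]]])
  moreover have "vd u (vd r (vd i f)) z = vd u (vd i (vd r f)) z" for u r i
    by (rule vd_cong[OF open_U z vd_commute[OF open_U f]])
  moreover have "S (vd r (vd i (vd j f))) z = S (vd r (vd j (vd i f))) z"
    by (rule S_cong[OF z vd_cong[OF open_U _ vd_commute[OF open_U f]]])
  ultimately show "hess_berwald f r i j z = hess_berwald f i r j z"
    "hess_berwald f r i j z = hess_berwald f r j i z"
    unfolding hess_berwald_def by (simp_all only: ac_simps)
qed

text \<open>A vertical derivative of \<open>par\<close>. The commutator \<open>vd_S\<close> produces
  the horizontal derivative; the terms with second derivatives of G are the Berwald connection
  terms, and the rest is \<open>hess_berwald\<close>.\<close>

lemma \<delta>_hess: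
  assumes f: "smooth_on U f" and z: "z \<in> U"
    and par: "\<And>w i j. w \<in> U \<Longrightarrow>
      S (vd i (vd j f)) w = vd (vd i G w) (vd j f) w + vd (vd j G w) (vd i f) w"
  shows "\<delta> r (vd i (vd j f)) z = vd (vd r (vd i G) z) (vd j f) z + vd (vd r (vd j G) z) (vd i f) z
    + hess_berwald f r i j z"
proof -
  note s = smooth_on_vd[OF f] smooth_on_vd[OF smooth_on_vd[OF f]]
  have "vd r (S (vd i (vd j f))) z = vd r (\<lambda>w. vd (vd i G w) (vd j f) w + vd (vd j G w) (vd i f) w) z"
    by (rule vd_cong[OF open_U z par])
  also have "\<dots> = vd r (\<lambda>w. vd (vd i G w) (vd j f) w) z + vd r (\<lambda>w. vd (vd j G w) (vd i f) w) z"
    by (rule vd_plus[OF smooth_vd_field[OF open_U s(1) smooth_vdG] smooth_vd_field[OF open_U s(1) smooth_vdG] z])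
  finally show ?thesis
    unfolding vd_S[OF s(2) z] dd_eq_\<delta>[OF s(2) z] vd_vd_field[OF s(1) smooth_vdG z] hess_berwald_def
    using vd_commute[OF open_U s(1) z] by simp
qed

end

section \<open>Landsberg spaces\<close>

locale landsberg_chart = finsler_chart +
  assumes landsberg: "z \<in> U \<Longrightarrow> vhv_torsion L r i j z = 0"
begin

text \<open>The vanishing of P^r_{ab} written out: contraction with y^k turns F^i_{jk} into G^i_j
  and the horizontal derivative into S.\<close>

lemma S_cartan_vec:
  assumes z: "z \<in> U"
  shows "S (cartan_vec a b) z = (\<Sum>h\<in>UNIV. (vd (axis a 1) G z $ h) *\<^sub>R cartan_vec h b z)
    + (\<Sum>h\<in>UNIV. (vd (axis b 1) G z $ h) *\<^sub>R cartan_vec a h z) - vd (cartan_vec a b z) G z"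
proof (rule vec_eq_iff[THEN iffD2], rule allI)
  fix r
  have S: "S (cartan_vec a b) z $ r = (\<Sum>k\<in>UNIV. delta L k (cartan L r a b) z * snd z $ k)"
  proof -
    have "S (cartan_vec a b) z $ r = S (\<lambda>w. cartan_vec a b w $ r) z"
      unfolding S_def
      by (rule dd_linear_comp[OF bounded_linear_vec_nth smooth_on_differentiable[OF smooth_cartan_vec z], symmetric])
    also have "(\<lambda>w. cartan_vec a b w $ r) = cartan L r a b" by (simp add: cartan_vec_def)
    finally show ?thesis by (simp add: S_\<delta>[OF z] delta_sum[OF smooth_cartan z])
  qed
  have c: "(\<Sum>k\<in>UNIV. (\<Sum>h\<in>UNIV. P h * cartan_conn L (p h) (q h) k z) * snd z $ k)
      = (\<Sum>h\<in>UNIV. P h * nonlin L (p h) (q h) z)" for P :: "'a \<Rightarrow> real" and p q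
    unfolding cartan_conn_snd[OF z, symmetric] sum_distrib_left sum_distrib_right
    by (subst sum.swap) (simp add: mult_ac)
  have "0 = (\<Sum>k\<in>UNIV. cartan_hcov L r a b k z * snd z $ k)"
    using landsberg[OF z] by (simp add: vhv_torsion_def)
  also have "\<dots> = S (cartan_vec a b) z $ r + (\<Sum>h\<in>UNIV. cartan L h a b z * nonlin L r h z)
      - (\<Sum>h\<in>UNIV. cartan L r h b z * nonlin L h a z) - (\<Sum>h\<in>UNIV. cartan L r a h z * nonlin L h b z)"
    unfolding S cartan_hcov_def
    by (simp add: distrib_right left_diff_distrib sum.distrib sum_subtractf c)
  finally show "S (cartan_vec a b) z $ r = ((\<Sum>h\<in>UNIV. (vd (axis a 1) G z $ h) *\<^sub>R cartan_vec h b z)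
      + (\<Sum>h\<in>UNIV. (vd (axis b 1) G z $ h) *\<^sub>R cartan_vec a h z) - vd (cartan_vec a b z) G z) $ r"
    using vd_expand[OF smooth_G z, of "cartan_vec a b z"]
    by (simp add: cartan_vec_def nonlin_eq[OF z] mult.commute)
qed

lemma S_cartan_contraction:
  fixes f :: "'a tvec \<Rightarrow> real"
  assumes f: "smooth_on U f" and z: "z \<in> U"
  shows "S (\<lambda>w. vd (cartan_vec a b w) f w) z = S (vd (cartan_vec a b z) f) z
    + (\<Sum>h\<in>UNIV. (vd (axis a 1) G z $ h) * vd (cartan_vec h b z) f z)
    + (\<Sum>h\<in>UNIV. (vd (axis b 1) G z $ h) * vd (cartan_vec a h z) f z)
    - vd (vd (cartan_vec a b z) G z) f z"
  unfolding S_vd_field[OF f smooth_cartan_vec z] S_cartan_vec[OF z]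
  by (simp add: vd_linear_simps[OF f z] linear_sum[OF linear_vd[OF f z]])

text \<open>Lowering the index of C^h_{ab} preserves parallelism along the spray, because the metric
  is parallel by \<open>S_vd2E\<close>.\<close>

lemma S_vd3E_axis:
  assumes z: "z \<in> U"
  shows "S (vd k (vd (axis a 1) (vd (axis b 1) E))) z =
    vd (vd k G z) (vd (axis a 1) (vd (axis b 1) E)) z
    + vd k (vd (vd (axis a 1) G z) (vd (axis b 1) E)) z
    + vd k (vd (axis a 1) (vd (vd (axis b 1) G z) E)) z"
proof -
  have cv: "vd (cartan_vec a b w) (vd k E) w = (1/2) * vd k (vd (axis a 1) (vd (axis b 1) E)) w"
    if "w \<in> U" for a b w
    using cartan_vec[OF that] vd_commute[OF open_U smooth_E that] by simp
  have "S (\<lambda>w. (1/2) * vd k (vd (axis a 1) (vd (axis b 1) E)) w) z =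
      (1/2) * S (vd k (vd (axis a 1) (vd (axis b 1) E))) z"
    unfolding S_def by (rule dd_linear_comp[OF bounded_linear_mult_right
        smooth_on_differentiable[OF smooth_on_vd[OF smooth_on_vd[OF smooth_vdE]] z]])
  moreover have "S (\<lambda>w. (1/2) * vd k (vd (axis a 1) (vd (axis b 1) E)) w) z =
      S (\<lambda>w. vd (cartan_vec a b w) (vd k E) w) z"
    by (rule S_cong[OF z cv[symmetric]])
  moreover have "vd (vd k G z) (vd (cartan_vec a b z) E) z =
      (1/2) * vd (vd k G z) (vd (axis a 1) (vd (axis b 1) E)) z"
    using cartan_vec[OF z] by simp
  ultimately show ?thesis
    unfolding S_cartan_contraction[OF smooth_vdE z] cv[OF z] S_vd2E[OF z]
    using linear_expand[OF linear_vd2[OF open_U smooth_vdE z], of k "vd (axis a 1) G z" "axis b 1"]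
      linear_expand[OF linear_vd3[OF open_U smooth_E z], of k "axis a 1" "vd (axis b 1) G z"]
    by (simp add: sum_divide_distrib[symmetric])
qed

text \<open>All terms are linear in i and in j, so the basis case suffices.\<close>

lemma S_vd3E:
  assumes z: "z \<in> U"
  shows "S (vd k (vd i (vd j E))) z = vd (vd k G z) (vd i (vd j E)) z
    + vd k (vd (vd i G z) (vd j E)) z + vd k (vd i (vd (vd j G z) E)) z"
proof -
  have add3: "linear P \<Longrightarrow> linear Q \<Longrightarrow> linear R \<Longrightarrow> linear (\<lambda>u. P u + Q u + R u)"
    for P Q R :: "real^'a \<Rightarrow> real"
    by (intro linear_compose_add)
  have lG: "linear P \<Longrightarrow> linear (\<lambda>u. P (vd u G z))" for P :: "real^'a \<Rightarrow> real"
    using linear_compose[OF linear_vd[OF smooth_G z]] by (simp add: o_def)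
  have l2: "linear (\<lambda>j. S (vd k (vd i (vd j E))) z)" for i
  proof -
    have "S (vd k (vd i (vd j E))) z = S (vd k (vd j (vd i E))) z" for j
      by (rule S_cong[OF z vd_cong[OF open_U _ vd_commute[OF open_U smooth_E]]])
    then show ?thesis using linear_dd_vd2[OF smooth_vdE z] by (simp add: S_def)
  qed
  have axis_j: "S (vd k (vd (axis a 1) (vd j E))) z = vd (vd k G z) (vd (axis a 1) (vd j E)) z
    + vd k (vd (vd (axis a 1) G z) (vd j E)) z + vd k (vd (axis a 1) (vd (vd j G z) E)) z" for a
    by (rule axis_test[where P = "\<lambda>j. S (vd k (vd (axis a 1) (vd j E))) z" and
          Q = "\<lambda>j. vd (vd k G z) (vd (axis a 1) (vd j E)) z + vd k (vd (vd (axis a 1) G z) (vd j E)) z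
            + vd k (vd (axis a 1) (vd (vd j G z) E)) z"])
      (intro l2 add3 linear_vd3[OF open_U smooth_E z] S_vd3E_axis[OF z]
        lG[of "\<lambda>u. vd k (vd (axis a 1) (vd u E)) z"])+
  show ?thesis
    by (rule axis_test[where P = "\<lambda>i. S (vd k (vd i (vd j E))) z" and
          Q = "\<lambda>i. vd (vd k G z) (vd i (vd j E)) z + vd k (vd (vd i G z) (vd j E)) z
            + vd k (vd i (vd (vd j G z) E)) z"], unfold S_def[of "vd _ _"])
      (intro add3 linear_dd_vd2[OF smooth_vdE z] linear_vd2[OF open_U smooth_vdE z]
        lG[of "\<lambda>u. vd k (vd u (vd j E)) z"] axis_j[unfolded S_def])+
qed

text \<open>\<open>S_vd3E\<close> is the vanishing of \<open>hess_berwald\<close> for the energy.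
  Hence the metric is parallel for the Berwald connection, a familiar property of Landsberg
  spaces.\<close>

lemma \<delta>_vd2E:
  assumes z: "z \<in> U"
  shows "\<delta> r (vd i (vd j E)) z = vd (vd r (vd i G) z) (vd j E) z + vd (vd r (vd j G) z) (vd i E) z"
proof -
  have "hess_berwald E r i j z = 0"
    unfolding hess_berwald_def S_vd3E[OF z]
    using vd_cycle[OF open_U smooth_E z]  vd_commute[OF open_U smooth_vdE z] by simp
  then show ?thesis using \<delta>_hess[OF smooth_E z S_vd2E, of r i j] by simp
qed

text \<open>Berwald parallelism collapses the Christoffel formula to one term, so the Cartan and
  Berwald connections agree.\<close>

lemma conn_low_eq:
  assumes z: "z \<in> U"
  shows "conn_low r j k z = vd r (vd (vd j (vd k G) z) E) z"
  unfolding conn_low_def \<delta>_vd2E[OF z]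
  using vd_commute[OF open_U smooth_G z] vd_commute[OF open_U smooth_E z] by simp

end

section \<open>Gradient h-vectors\<close>

text \<open>The h-vector enters through \<beta>, with b_i as its vertical derivative.
  \<open>hess_\<beta>_cartan\<close> is condition (i). \<open>hess_\<beta>_angular\<close> adds
  condition (ii): 2 E g_{ij} - y_i y_j is L^2 h_{ij}, and \<kappa> is \<rho> / L^3. In
  \<open>gradient\<close> the symmetric connection terms have been cancelled.\<close>

locale h_chart = landsberg_chart U L for U :: "'n::finite tvec set" and L +
  fixes \<beta> :: "'n tvec \<Rightarrow> real"
  assumes smooth_\<beta>: "smooth_on U \<beta>"
    and Euler_\<beta>: "z \<in> U \<Longrightarrow> vd (snd z) \<beta> z = \<beta> z"
    and hess_\<beta>_cartan: "z \<in> U \<Longrightarrow> vd (axis a 1) (vd (axis c 1) \<beta>) z = vd (cartan_vec a c z) \<beta> z"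
    and hess_\<beta>_angular: "z \<in> U \<Longrightarrow> \<exists>\<kappa>. \<kappa> \<noteq> 0 \<and> (\<forall>i j. vd i (vd j \<beta>) z =
        \<kappa> * (2 * energy L z * vd i (vd j (energy L)) z - vd i (energy L) z * vd j (energy L) z))"
    and gradient: "z \<in> U \<Longrightarrow> \<delta> i (vd j \<beta>) z = \<delta> j (vd i \<beta>) z"
begin

lemmas smooth_vd\<beta> = smooth_on_vd[OF smooth_\<beta>]

text \<open>The gradient condition contracted with y; the term with G accounts for the motion of y
  in y^i b_i = \<beta>.\<close>

lemma S_vd\<beta>: assumes z: "z \<in> U" shows "S (vd r \<beta>) z = \<delta> r \<beta> z + vd (vd r G z) \<beta> z"
proof -
  have "\<delta> r (\<lambda>w. vd (snd w) \<beta> w) z = \<delta> r \<beta> z"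
    unfolding \<delta>_def by (rule dd_cong[OF open_U z Euler_\<beta>])
  then show ?thesis
    using \<delta>_vd_snd[OF smooth_\<beta> z, of r] gradient[OF z, of r "snd z"] by (simp add: S_\<delta>[OF z])
qed

lemma vd_S\<beta>: assumes z: "z \<in> U" shows "vd r (S \<beta>) z = 2 * \<delta> r \<beta> z"
  unfolding vd_S[OF smooth_\<beta> z] S_vd\<beta>[OF z] dd_eq_\<delta>[OF smooth_\<beta> z] by simp

text \<open>A vertical derivative of \<open>S_vd\<beta>\<close>: the Berwald terms of the
  commutators cancel, and \<open>gradient\<close> removes the horizontal derivatives of b.\<close>

lemma S_vd2\<beta>:
  assumes z: "z \<in> U"
  shows "S (vd i (vd j \<beta>)) z = vd (vd i G z) (vd j \<beta>) z + vd (vd j G z) (vd i \<beta>) z"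
proof -
  have "vd i (S (vd j \<beta>)) z = vd i (\<lambda>w. \<delta> j \<beta> w + vd (vd j G w) \<beta> w) z"
    by (rule vd_cong[OF open_U z S_vd\<beta>])
  also have "\<dots> = vd i (\<delta> j \<beta>) z + vd i (\<lambda>w. vd (vd j G w) \<beta> w) z"
    by (rule vd_plus[OF smooth_\<delta>[OF smooth_\<beta>] smooth_vd_field[OF open_U smooth_\<beta> smooth_vdG] z])
  finally show ?thesis
    unfolding vd_S[OF smooth_vd\<beta> z] dd_eq_\<delta>[OF smooth_vd\<beta> z] vd_\<delta>[OF smooth_\<beta> z]
      vd_vd_field[OF smooth_\<beta> smooth_vdG z]
    using gradient[OF z, of i j] vd_commute[OF open_U smooth_\<beta> z, of i "vd j G z"] by simp
qed

text \<open>S is applied to \<beta>_{ij} = C^h_{ij} b_h. Both tensors are parallel along S, so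
  C^h_{ij} contracts to zero with the defect of parallelism of b_h, which is the horizontal
  derivative of \<beta> by \<open>S_vd\<beta>\<close>.\<close>

lemma \<delta>_cartan_vec_\<beta>:
  assumes z: "z \<in> U" shows "\<delta> (cartan_vec i j z) \<beta> z = 0"
proof -
  have "S (vd (axis i 1) (vd (axis j 1) \<beta>)) z = S (\<lambda>w. vd (cartan_vec i j w) \<beta> w) z"
    by (rule S_cong[OF z hess_\<beta>_cartan])
  moreover have "(\<Sum>h\<in>UNIV. (vd (axis i 1) G z $ h) * vd (cartan_vec h j z) \<beta> z) =
      vd (vd (axis i 1) G z) (vd (axis j 1) \<beta>) z"
    using vd_expand[OF smooth_vd\<beta> z, of "vd (axis i 1) G z" "axis j 1"]
    by (simp add: hess_\<beta>_cartan[OF z])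
  moreover have "(\<Sum>h\<in>UNIV. (vd (axis j 1) G z $ h) * vd (cartan_vec i h z) \<beta> z) =
      vd (vd (axis j 1) G z) (vd (axis i 1) \<beta>) z"
    using vd_expand[OF smooth_vd\<beta> z, of "vd (axis j 1) G z" "axis i 1"]
      vd_commute[OF open_U smooth_\<beta> z, of _ "axis i 1"]
    by (simp add: hess_\<beta>_cartan[OF z])
  ultimately show ?thesis
    unfolding S_vd2\<beta>[OF z] S_cartan_contraction[OF smooth_\<beta> z] S_vd\<beta>[OF z] by simp
qed

text \<open>The witness is b^i, the h-vector with its index raised.\<close>

lemma exists_gradient:
  assumes z: "z \<in> U" shows "\<exists>v. \<forall>r. vd r (vd v E) z = vd r \<beta> z"
  using metric_raise_vec[OF z linear_vd[OF smooth_\<beta> z],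
      of "\<chi> i. \<Sum>r\<in>UNIV. metric_inv L i r z * vd (axis r 1) \<beta> z"] by auto

text \<open>Since \<open>C\<^sup>h\<^bsub>ij\<^esub> b\<^sup>i\<close> is a nonzero multiple of the angular metric \<open>h\<^sup>h\<^sub>j\<close> and the horizontal
  differential of \<open>\<beta>\<close> annihilates it, that differential is proportional to \<open>y\<^sub>j\<close>.\<close>

lemma \<delta>_\<beta>:
  assumes z: "z \<in> U" shows "2 * E z * \<delta> j \<beta> z = vd j E z * S \<beta> z"
proof -
  obtain v where v: "\<And>r. vd r (vd v E) z = vd r \<beta> z" using exists_gradient[OF z] by blast
  obtain \<kappa> where \<kappa>: "\<kappa> \<noteq> 0" "\<And>i j. vd i (vd j \<beta>) z =
      \<kappa> * (2 * E z * vd i (vd j E) z - vd i E z * vd j E z)"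
    using hess_\<beta>_angular[OF z] by blast
  \<comment> \<open>K^h = C^h_{ab} b^a j^b, which the horizontal differential of \<beta>
    annihilates.\<close>
  define K where "K = (\<Sum>a\<in>UNIV. \<Sum>b\<in>UNIV. (v $ a * j $ b) *\<^sub>R cartan_vec a b z)"
  have K: "\<delta> K \<beta> z = 0"
    unfolding K_def
    by (simp add: linear_sum[OF linear_\<delta>[OF smooth_\<beta> z]] linear_cmul[OF linear_\<delta>[OF smooth_\<beta> z]]
        \<delta>_cartan_vec_\<beta>[OF z])
  have e: "(\<Sum>a\<in>UNIV. \<Sum>b\<in>UNIV. v $ a * j $ b * vd r (vd (axis a 1) (vd (axis b 1) E)) z) = vd r (vd v (vd j E)) z" for r
  proof -
    have "vd r (vd v (vd j E)) z = (\<Sum>a\<in>UNIV. v $ a * vd r (vd (axis a 1) (vd j E)) z)"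
      using linear_expand[OF linear_vd2[OF open_U smooth_vdE z], of r v j] by simp
    also have "\<dots> = (\<Sum>a\<in>UNIV. v $ a * (\<Sum>b\<in>UNIV. j $ b * vd r (vd (axis a 1) (vd (axis b 1) E)) z))"
      using linear_expand[OF linear_vd3[OF open_U smooth_E z], of r _ j] by simp
    finally show ?thesis by (simp add: sum_distrib_left mult_ac)
  qed
  \<comment> \<open>Lowered, K is C_{rab} b^a j^b = \<beta>_{rj}, and the angular form of
    \<beta>_{rj} identifies K as a combination of j and y.\<close>
  have "vd r (vd K E) z = vd r (vd (\<kappa> *\<^sub>R ((2 * E z) *\<^sub>R j - vd j E z *\<^sub>R snd z)) E) z" for r
  proof -
    have 1: "vd v (vd (axis a 1) (vd (axis b 1) E)) z / 2 = vd (axis a 1) (vd (axis b 1) \<beta>) z" for a b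
    proof -
      have "vd v (vd (axis a 1) (vd (axis b 1) E)) z / 2 = vd v (vd (cartan_vec a b z) E) z"
        by (simp add: cartan_vec[OF z])
      also have "\<dots> = vd (axis a 1) (vd (axis b 1) \<beta>) z"
        by (simp add: vd_commute[OF open_U smooth_E z, of v] v hess_\<beta>_cartan[OF z])
      finally show ?thesis .
    qed
    \<comment> \<open>The factor 2 appears because C is half a third derivative of the
      energy.\<close>
    have vv: "vd v (vd s (vd r E)) z = 2 * vd s (vd r \<beta>) z" for s r
    proof -
      have l: "linear (\<lambda>s. vd v (vd s (vd r E)) z)" "linear (\<lambda>s. 2 * vd s (vd r \<beta>) z)"
        "linear (\<lambda>r. vd v (vd s (vd r E)) z)" "linear (\<lambda>r. 2 * vd s (vd r \<beta>) z)" for s r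
        using linear_compose_scale_right[OF linear_vd[OF smooth_vd\<beta> z], of 2]
          linear_compose_scale_right[OF linear_vd2[OF open_U smooth_\<beta> z], of 2]
          linear_vd2[OF open_U smooth_vdE z] linear_vd3[OF open_U smooth_E z] by auto
      have "vd v (vd (axis a 1) (vd r E)) z = 2 * vd (axis a 1) (vd r \<beta>) z" for a
        by (rule axis_test[OF l(3) l(4)]) (use 1 in \<open>simp add: field_simps\<close>)
      then show ?thesis by (rule axis_test[OF l(1) l(2)])
    qed
    have "vd r (vd K E) z = vd r (vd v (vd j E)) z / 2"
      unfolding K_def e[symmetric]
      by (simp add: linear_sum[OF linear_vd2[OF open_U smooth_E z]] vd_linear_simps[OF smooth_E z]
          cartan_vec[OF z] sum_divide_distrib)
    also have "\<dots> = vd v (vd r (vd j E)) z / 2"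
      using vd_commute[OF open_U smooth_vdE z] by simp
    also have "\<dots> = vd r (vd j \<beta>) z" by (simp add: vv)
    finally show ?thesis
      by (simp add: \<kappa> vd_linear_simps[OF smooth_E z] Euler_vdE'[OF z] algebra_simps)
  qed
  then have "K - \<kappa> *\<^sub>R ((2 * E z) *\<^sub>R j - vd j E z *\<^sub>R snd z) = 0"
    by (intro nondeg[OF z]) (simp add: vd_linear_simps(7)[OF smooth_E z])
  then have "\<kappa> * (2 * E z * \<delta> j \<beta> z - vd j E z * S \<beta> z) = 0"
    using K linear_\<delta>[OF smooth_\<beta> z]
    by (simp add: linear_cmul[OF linear_\<delta>[OF smooth_\<beta> z]] linear_diff[OF linear_\<delta>[OF smooth_\<beta> z]] S_\<delta>[OF z])
  then show ?thesis using \<kappa>(1) by simp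
qed

end

section \<open>The Kropina change\<close>

text \<open>The changed metric is an instance of \<open>finsler_chart\<close> where \<beta> is
  nonzero, so the general theory of its spray and connection is available under the prefix
  \<open>star\<close>.\<close>

locale kropina_chart = h_chart U L \<beta> +
  star: finsler_chart "{z \<in> U. \<beta> z \<noteq> 0}" "\<lambda>z. (L z)\<^sup>2 / \<beta> z"
  for U :: "'n::finite tvec set" and L \<beta> +
  assumes L_nonzero: "z \<in> U \<Longrightarrow> L z \<noteq> 0"
begin

abbreviation "U' \<equiv> {z \<in> U. \<beta> z \<noteq> 0}"
abbreviation "E' \<equiv> energy (\<lambda>z. (L z)\<^sup>2 / \<beta> z)"
abbreviation "G' \<equiv> spray_vec (\<lambda>z. (L z)\<^sup>2 / \<beta> z)"
abbreviation "\<iota> \<equiv> \<lambda>z. inverse (\<beta> z)"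

lemma E_nonzero: "z \<in> U \<Longrightarrow> E z \<noteq> 0"
  by (simp add: energy_def L_nonzero)

lemma E'_eq: "E' = (\<lambda>z. 2 * (E z)\<^sup>2 * (\<iota> z)\<^sup>2)"
proof
  fix z
  have "(a / b)\<^sup>2 / 2 = 2 * (a / 2)\<^sup>2 * (inverse b)\<^sup>2" for a b :: real
    by (cases "b = 0") (simp_all add: field_simps power2_eq_square)
  then show "E' z = 2 * (E z)\<^sup>2 * (\<iota> z)\<^sup>2" unfolding energy_def .
qed

text \<open>Rules for differentiating polynomials in E, 1/\<beta> and vertical derivatives of E and
  \<beta>; with 1/\<beta> as one function the starred energy is such a polynomial.\<close>

lemma has_derivative_E_beta:
  assumes z: "z \<in> U'"
  shows "(E has_derivative dd E z) (at z)" "(vd i E has_derivative dd (vd i E) z) (at z)"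
    "(vd i (vd j E) has_derivative dd (vd i (vd j E)) z) (at z)"
    "(\<beta> has_derivative dd \<beta> z) (at z)" "(vd i \<beta> has_derivative dd (vd i \<beta>) z) (at z)"
    "(vd i (vd j \<beta>) has_derivative dd (vd i (vd j \<beta>)) z) (at z)"
    "(\<iota> has_derivative (\<lambda>h. - (\<iota> z)\<^sup>2 * dd \<beta> z h)) (at z)"
proof -
  have zU: "z \<in> U" using z by simp
  show "(\<iota> has_derivative (\<lambda>h. - (\<iota> z)\<^sup>2 * dd \<beta> z h)) (at z)"
    using z by (auto intro!: derivative_eq_intros smooth_on_has_derivative[OF smooth_\<beta>]
        simp: power2_eq_square fun_eq_iff)
qed (use z in \<open>auto intro!: smooth_on_has_derivative smooth_on_vd smooth_E smooth_\<beta>\<close>)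

lemma dd_E':
  assumes z: "z \<in> U'"
  shows "dd E' z h = 4 * E z * (\<iota> z)\<^sup>2 * dd E z h - 4 * (E z)\<^sup>2 * (\<iota> z)^3 * dd \<beta> z h"
proof -
  have "(E' has_derivative (\<lambda>h. 4 * E z * (\<iota> z)\<^sup>2 * dd E z h - 4 * (E z)\<^sup>2 * (\<iota> z)^3 * dd \<beta> z h)) (at z)"
    unfolding E'_eq
    by (rule has_derivative_eq_rhs, (rule derivative_intros has_derivative_E_beta[OF z])+)
      (simp add: fun_eq_iff algebra_simps power2_eq_square power3_eq_cube)
  then show ?thesis by (rule dd_eqI)
qed

lemma vd_E':
  assumes z: "z \<in> U'"
  shows "vd r E' z = 4 * E z * (\<iota> z)\<^sup>2 * vd r E z - 4 * (E z)\<^sup>2 * (\<iota> z)^3 * vd r \<beta> z"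
  unfolding vd_def by (rule dd_E'[OF z])

lemma dd_vdE':
  assumes z: "z \<in> U'"
  shows "dd (vd r E') z h = 4 * E z * (\<iota> z)\<^sup>2 * dd (vd r E) z h + 4 * (\<iota> z)\<^sup>2 * dd E z h * vd r E z
    - 8 * E z * (\<iota> z)^3 * (dd \<beta> z h * vd r E z + dd E z h * vd r \<beta> z)
    + 12 * (E z)\<^sup>2 * (\<iota> z)^4 * dd \<beta> z h * vd r \<beta> z - 4 * (E z)\<^sup>2 * (\<iota> z)^3 * dd (vd r \<beta>) z h"
    (is "_ = ?rhs h")
proof -
  have "((\<lambda>z. 4 * E z * (\<iota> z)\<^sup>2 * vd r E z - 4 * (E z)\<^sup>2 * (\<iota> z)^3 * vd r \<beta> z) has_derivative ?rhs) (at z)"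
    by (rule has_derivative_eq_rhs, (rule derivative_intros has_derivative_E_beta[OF z])+)
      (simp add: fun_eq_iff algebra_simps power2_eq_square power3_eq_cube power4_eq_xxxx)
  then have "dd (\<lambda>z. 4 * E z * (\<iota> z)\<^sup>2 * vd r E z - 4 * (E z)\<^sup>2 * (\<iota> z)^3 * vd r \<beta> z) z h = ?rhs h"
    by (rule dd_eqI)
  then show ?thesis using dd_cong[OF star.open_U z vd_E'] by simp
qed

lemma vd2_E':
  assumes z: "z \<in> U'"
  shows "vd i (vd j E') z = 4 * E z * (\<iota> z)\<^sup>2 * vd i (vd j E) z - 4 * (E z)\<^sup>2 * (\<iota> z)^3 * vd i (vd j \<beta>) z
    + 4 * (\<iota> z)\<^sup>2 * vd i E z * vd j E z
    - 8 * E z * (\<iota> z)^3 * (vd i E z * vd j \<beta> z + vd i \<beta> z * vd j E z)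
    + 12 * (E z)\<^sup>2 * (\<iota> z)^4 * vd i \<beta> z * vd j \<beta> z"
  unfolding vd_def[of i] dd_vdE'[OF z] by (simp add: algebra_simps)

text \<open>The condition on h removes all terms with \<open>dd E z h\<close>. It is met by the
  horizontal directions and by the vertical direction along the normal.\<close>

lemma dd_vd2E':
  assumes z: "z \<in> U'" and h: "dd E z h = 0"
  shows "dd (vd i (vd j E')) z h =
    4 * E z * (\<iota> z)\<^sup>2 * dd (vd i (vd j E)) z h - 8 * E z * (\<iota> z)^3 * dd \<beta> z h * vd i (vd j E) z
    - 4 * (E z)\<^sup>2 * (\<iota> z)^3 * dd (vd i (vd j \<beta>)) z h + 12 * (E z)\<^sup>2 * (\<iota> z)^4 * dd \<beta> z h * vd i (vd j \<beta>) z
    - 8 * (\<iota> z)^3 * dd \<beta> z h * vd i E z * vd j E z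
    + 4 * (\<iota> z)\<^sup>2 * (dd (vd i E) z h * vd j E z + vd i E z * dd (vd j E) z h)
    + 24 * E z * (\<iota> z)^4 * dd \<beta> z h * (vd i E z * vd j \<beta> z + vd i \<beta> z * vd j E z)
    - 8 * E z * (\<iota> z)^3 * (dd (vd i E) z h * vd j \<beta> z + vd i E z * dd (vd j \<beta>) z h
        + dd (vd i \<beta>) z h * vd j E z + vd i \<beta> z * dd (vd j E) z h)
    - 48 * (E z)\<^sup>2 * (\<iota> z)^5 * dd \<beta> z h * vd i \<beta> z * vd j \<beta> z
    + 12 * (E z)\<^sup>2 * (\<iota> z)^4 * (dd (vd i \<beta>) z h * vd j \<beta> z + vd i \<beta> z * dd (vd j \<beta>) z h)"
    (is "_ = ?rhs")
proof -
  define T where "T = (\<lambda>z. 4 * E z * (\<iota> z)\<^sup>2 * vd i (vd j E) z - 4 * (E z)\<^sup>2 * (\<iota> z)^3 * vd i (vd j \<beta>) z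
    + 4 * (\<iota> z)\<^sup>2 * vd i E z * vd j E z
    - 8 * E z * (\<iota> z)^3 * (vd i E z * vd j \<beta> z + vd i \<beta> z * vd j E z)
    + 12 * (E z)\<^sup>2 * (\<iota> z)^4 * vd i \<beta> z * vd j \<beta> z)"
  \<comment> \<open>The full derivative is not written out: the rules construct T', and only its
    value at h is compared.\<close>
  have "\<exists>T'. (T has_derivative T') (at z) \<and> (dd E z h = 0 \<longrightarrow> T' h = ?rhs)"
    unfolding T_def
    by (rule exI, rule conjI, (rule derivative_intros has_derivative_E_beta[OF z])+)
      (simp add: algebra_simps power2_eq_square eval_nat_numeral)
  then obtain T' where T': "(T has_derivative T') (at z)" and e: "dd E z h = 0 \<Longrightarrow> T' h = ?rhs"
    by blast
  have "dd (vd i (vd j E')) z h = dd T z h"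
    unfolding T_def by (rule dd_cong[OF star.open_U z vd2_E'])
  then show ?thesis using dd_eqI[OF T'] e[OF h] by simp
qed

section \<open>The difference of the two sprays\<close>

definition \<Delta> :: "'n tvec \<Rightarrow> real^'n" where "\<Delta> z = G' z - G z"

lemma smooth_\<Delta>: "smooth_on U' \<Delta>"
  unfolding \<Delta>_def
  by (rule smooth_on_diff[OF star.open_U star.smooth_G smooth_on_subset[OF smooth_G]]) auto

lemma G'_eq: "G' = (\<lambda>z. G z + \<Delta> z)" by (simp add: \<Delta>_def)

lemma vd_G': assumes z: "z \<in> U'" shows "vd k G' z = vd k G z + vd k \<Delta> z"
  using dd_eqI[OF has_derivative_add[OF smooth_on_has_derivative[OF smooth_G]
        smooth_on_has_derivative[OF smooth_\<Delta> z]]] z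
  unfolding G'_eq vd_def by auto

text \<open>Twice the left side is S(vd r E') - d_r E', the defect of E' in the Euler-Lagrange
  equation along the original spray.\<close>

lemma \<Delta>_low:
  assumes z: "z \<in> U'"
  shows "vd (\<Delta> z) (vd r E') z =
    2 * E z * (\<iota> z)^3 * S \<beta> z * (3 * E z * \<iota> z * vd r \<beta> z - 2 * vd r E z)"
proof -
  have zU: "z \<in> U" using z by simp
  have "2 * vd r (vd (\<Delta> z) E') z = 2 * vd r (vd (G' z) E') z - 2 * vd r (vd (G z) E') z"
    by (simp add: \<Delta>_def star.vd_linear_simps[OF star.smooth_E z])
  also have "\<dots> = dd (vd r E') z (snd z, 0) - dd E' z (r, 0) - 2 * vd (G z) (vd r E') z"
    unfolding star.spray_eq[OF z] vd_commute[OF star.open_U star.smooth_E z, of r "G z"] ..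
  also have "\<dots> = S (vd r E') z - dd E' z (r, 0)"
    using dd_pair[OF star.smooth_vdE z, of r "snd z" "- 2 *\<^sub>R G z"]
    by (simp add: S_def star.vd_linear_simps[OF star.smooth_vdE z])
  also have "\<dots> = 2 * (2 * E z * (\<iota> z)^3 * S \<beta> z * (3 * E z * \<iota> z * vd r \<beta> z - 2 * vd r E z))"
  proof -
    \<comment> \<open>\<beta> satisfies the same Euler-Lagrange equation as E; with S E = 0 only
      terms with S \<beta> survive.\<close>
    have "S (vd r \<beta>) z = dd \<beta> z (r, 0)" using S_vd\<beta>[OF zU] dd_eq_\<delta>[OF smooth_\<beta> zU] by simp
    then have "dd E z (snd z, - 2 *\<^sub>R G z) = 0" "dd \<beta> z (snd z, - 2 *\<^sub>R G z) = S \<beta> z"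
      "dd (vd r E) z (snd z, - 2 *\<^sub>R G z) = dd E z (r, 0)"
      "dd (vd r \<beta>) z (snd z, - 2 *\<^sub>R G z) = dd \<beta> z (r, 0)"
      using S_E[OF zU] Euler_Lagrange[OF zU, of r] by (simp_all only: S_def)
    then show ?thesis
      unfolding S_def[of "vd r E'"] dd_vdE'[OF z] dd_E'[OF z]
      by (simp add: algebra_simps power2_eq_square eval_nat_numeral)
  qed
  finally show ?thesis unfolding vd_commute[OF star.open_U star.smooth_E z, of r] by simp
qed

text \<open>\<kappa> is known only pointwise, so it is eliminated by \<beta>_{an} H_{nn} =
  \<beta>_{nn} H_{an}, valid near z. At z both \<beta>_{an} and H_{an} vanish, and differentiation
  gives the result as if \<kappa> were constant.\<close>

lemma dd_hess_\<beta>: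
  assumes z: "z \<in> U" and nn: "vd n (vd n E) z = 1" and yn: "vd n E z = 0"
    and a: "vd a (vd n E) z = 0"
    and \<kappa>: "\<And>i j. vd i (vd j \<beta>) z = \<kappa> * (2 * E z * vd i (vd j E) z - vd i E z * vd j E z)"
  shows "dd (vd a (vd n \<beta>)) z h =
    \<kappa> * (2 * E z * dd (vd a (vd n E)) z h - vd a E z * dd (vd n E) z h)"
proof -
  define H where "H = (\<lambda>i j w. 2 * E w * vd i (vd j E) w - vd i E w * vd j E w)"
  note d = smooth_on_has_derivative[OF smooth_E z] smooth_on_has_derivative[OF smooth_vdE z]
    smooth_on_has_derivative[OF smooth_on_vd[OF smooth_vdE] z]
    smooth_on_has_derivative[OF smooth_on_vd[OF smooth_vd\<beta>] z]
  have dH: "(H i j has_derivative (\<lambda>h. 2 * E z * dd (vd i (vd j E)) z h + 2 * dd E z h * vd i (vd j E) z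
      - vd i E z * dd (vd j E) z h - dd (vd i E) z h * vd j E z)) (at z)" for i j
    unfolding H_def
    by (rule has_derivative_eq_rhs, (rule derivative_intros d)+) (simp add: fun_eq_iff)
  have eq: "vd a (vd n \<beta>) w * H n n w = vd n (vd n \<beta>) w * H a n w" if "w \<in> U" for w
    using hess_\<beta>_angular[OF that] unfolding H_def by auto
  have H0: "H a n z = 0" "vd a (vd n \<beta>) z = 0" "H n n z = 2 * E z" "vd n (vd n \<beta>) z = \<kappa> * (2 * E z)"
    by (simp_all add: H_def nn yn a \<kappa>)
  have "dd (\<lambda>w. vd a (vd n \<beta>) w * H n n w) z h = vd a (vd n \<beta>) z * dd (H n n) z h + dd (vd a (vd n \<beta>)) z h * H n n z"
    by (rule dd_eqI[OF has_derivative_mult[OF d(4)], OF dd_works]) (use dH differentiable_def in blast)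
  moreover have "dd (\<lambda>w. vd n (vd n \<beta>) w * H a n w) z h = vd n (vd n \<beta>) z * dd (H a n) z h + dd (vd n (vd n \<beta>)) z h * H a n z"
    by (rule dd_eqI[OF has_derivative_mult[OF d(4)], OF dd_works]) (use dH differentiable_def in blast)
  moreover have "dd (\<lambda>w. vd a (vd n \<beta>) w * H n n w) z h = dd (\<lambda>w. vd n (vd n \<beta>) w * H a n w) z h"
    by (rule dd_cong[OF open_U z eq])
  ultimately have "2 * E z * dd (vd a (vd n \<beta>)) z h = 2 * E z * (\<kappa> * dd (H a n) z h)"
    unfolding H0 by auto
  then have "dd (vd a (vd n \<beta>)) z h = \<kappa> * dd (H a n) z h" using E_nonzero[OF z] by simp
  also have "dd (H a n) z h = 2 * E z * dd (vd a (vd n E)) z h - vd a E z * dd (vd n E) z h"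
    using dd_eqI[OF dH[of a n], of h] by (simp add: a yn)
  finally show ?thesis .
qed

end

section \<open>The unit normal of a hypersurface\<close>

text \<open>The data at one supporting element: n is the unit normal, orthogonal to y by
  \<open>yn\<close> and to b by \<open>bn\<close>, and \<open>Cn\<close> is M_{\<alpha>\<beta>} = 0
  extended to all tangential vectors.\<close>

locale hypersurface_point = kropina_chart U L \<beta> for U :: "'n::finite tvec set" and L \<beta> +
  fixes z :: "'n tvec" and n :: "real^'n"
  assumes z: "z \<in> {z \<in> U. \<beta> z \<noteq> 0}"
    and nn: "vd n (vd n (energy L)) z = 1"
    and yn: "vd n (energy L) z = 0"
    and bn: "vd n \<beta> z = 0"
    and Cn: "vd a (vd n (energy L)) z = 0 \<Longrightarrow> vd c (vd n (energy L)) z = 0 \<Longrightarrow>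
      vd n (vd a (vd c (energy L))) z = 0"
begin

lemma zU: "z \<in> U" using z by simp

definition \<kappa> :: real where
  "\<kappa> = (SOME k. \<forall>i j. vd i (vd j \<beta>) z = k * (2 * E z * vd i (vd j E) z - vd i E z * vd j E z))"

lemma \<kappa>: "vd i (vd j \<beta>) z = \<kappa> * (2 * E z * vd i (vd j E) z - vd i E z * vd j E z)"
  unfolding \<kappa>_def
  using someI_ex[of "\<lambda>k. \<forall>i j. vd i (vd j \<beta>) z = k * (2 * E z * vd i (vd j E) z - vd i E z * vd j E z)"]
    hess_\<beta>_angular[OF zU] by blast

definition p :: real where "p = 4 * E z * (\<iota> z)\<^sup>2 - 8 * (E z)^3 * (\<iota> z)^3 * \<kappa>"

abbreviation perp :: "real^'n \<Rightarrow> bool" where "perp a \<equiv> vd a (vd n E) z = 0"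

lemma perp': "perp a \<Longrightarrow> vd n (vd a E) z = 0"
  using vd_commute[OF open_U smooth_E zU, of n a] by simp

text \<open>With y_n = b_n = 0 two terms of \<open>vd2_E'\<close> survive, and the angular form
  makes \<beta>_{vn} a multiple of g_{vn}.\<close>

lemma metric'_n: "vd v (vd n E') z = p * vd v (vd n E) z"
  unfolding vd2_E'[OF z] \<kappa> p_def
  by (simp add: yn bn algebra_simps power2_eq_square eval_nat_numeral)

lemma metric'_n': "vd n (vd v E') z = p * vd v (vd n E) z"
  using metric'_n[of v] vd_commute[OF star.open_U star.smooth_E z, of n v] by simp

text \<open>Otherwise n would lie in the kernel of the regular starred metric.\<close>

lemma p_nonzero: "p \<noteq> 0"
proof
  assume "p = 0"
  then have "n = 0" by (intro star.nondeg[OF z]) (simp add: metric'_n)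
  then show False using nn by (simp add: vd_linear_simps[OF smooth_E zU])
qed

lemma \<delta>n: "\<delta> n \<beta> z = 0"
  using \<delta>_\<beta>[OF zU, of n] E_nonzero[OF zU] by (simp add: yn)

lemma dd_hess_\<beta>_n:
  "perp a \<Longrightarrow> dd (vd a (vd n \<beta>)) z h =
    \<kappa> * (2 * E z * dd (vd a (vd n E)) z h - vd a E z * dd (vd n E) z h)"
  by (rule dd_hess_\<beta>[OF zU nn yn _ \<kappa>])

text \<open>By \<open>dd_hess_\<beta>\<close> this derivative consists of two terms, which vanish by
  \<open>Cn\<close> and by orthogonality.\<close>

lemma Cn_\<beta>: assumes a: "perp a" and c: "perp c" shows "vd n (vd a (vd c \<beta>)) z = 0"
proof -
  have "vd n (vd a (vd c \<beta>)) z = vd a (vd c (vd n \<beta>)) z"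
    by (rule vd_cycle[OF open_U smooth_\<beta> zU])
  also have "\<dots> = \<kappa> * (2 * E z * vd a (vd c (vd n E)) z - vd c E z * vd a (vd n E) z)"
    using dd_hess_\<beta>_n[OF c, of "(0, a)"] by (simp add: vd_def[of a])
  also have "vd a (vd c (vd n E)) z = vd n (vd a (vd c E)) z"
    using vd_cycle[OF open_U smooth_E zU] by metis
  finally show ?thesis using Cn[OF a c] a by simp
qed

text \<open>In direction n every term of \<open>dd_vd2E'\<close> has a vanishing factor. This is the
  starred form of M_{\<alpha>\<beta>} = 0.\<close>

lemma C'n: assumes a: "perp a" and c: "perp c" shows "vd n (vd a (vd c E')) z = 0"
proof -
  have d: "dd E z (0, n) = 0" "dd \<beta> z (0, n) = 0" "dd (vd a E) z (0, n) = 0" "dd (vd c E) z (0, n) = 0"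
    "dd (vd a \<beta>) z (0, n) = 0" "dd (vd c \<beta>) z (0, n) = 0"
    "dd (vd a (vd c E)) z (0, n) = 0" "dd (vd a (vd c \<beta>)) z (0, n) = 0"
    using yn bn perp'[OF a] perp'[OF c] Cn[OF a c] Cn_\<beta>[OF a c] \<kappa>[of n a] \<kappa>[of n c]
    by (simp_all add: vd_def[of n])
  show ?thesis unfolding vd_def[of n] dd_vd2E'[OF z d(1)] d by simp
qed

text \<open>The horizontal derivative of \<beta>_{an} is computed from the angular form and from
  \<open>\<delta>_hess\<close>; the Berwald connection terms agree, so \<open>hess_berwald\<close>
  must vanish.\<close>

lemma berwald_\<beta>_n: assumes a: "perp a" shows "hess_berwald \<beta> r a n z = 0"
proof -
  let ?A = "vd r (vd a G) z" and ?N = "vd r (vd n G) z"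
  have c: "vd ?N (vd a E) z = vd a (vd ?N E) z" for a
    by (rule vd_commute[OF open_U smooth_E zU])
  have "vd ?A (vd n \<beta>) z + vd ?N (vd a \<beta>) z + hess_berwald \<beta> r a n z =
      \<kappa> * (2 * E z * (vd ?A (vd n E) z + vd ?N (vd a E) z) - vd a E z * vd ?N E z)"
    using dd_hess_\<beta>_n[OF a, of "(r, - vd r G z)"] \<delta>_hess[OF smooth_\<beta> zU S_vd2\<beta>, of r a n]
      \<delta>_vd2E[OF zU, of r a n] \<delta>_vdE[OF zU, of r n] vd_commute[OF open_U smooth_G zU, of n r]
    by (simp add: \<delta>_def)
  then show ?thesis unfolding \<kappa> by (simp add: yn algebra_simps)
qed

section \<open>Tangential and normal parts of the spray difference and its vertical
  derivatives\<close>

lemma vd_\<Delta>_low: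
  "vd a (vd (\<Delta> z) (vd r E')) z + vd (vd a \<Delta> z) (vd r E') z =
    vd a (\<lambda>w. 2 * E w * (\<iota> w)^3 * S \<beta> w * (3 * E w * \<iota> w * vd r \<beta> w - 2 * vd r E w)) z"
proof -
  have "vd a (\<lambda>w. vd (\<Delta> w) (vd r E') w) z =
      vd a (\<lambda>w. 2 * E w * (\<iota> w)^3 * S \<beta> w * (3 * E w * \<iota> w * vd r \<beta> w - 2 * vd r E w)) z"
    by (rule vd_cong[OF star.open_U z \<Delta>_low])
  then show ?thesis by (simp add: star.vd_vd_field[OF star.smooth_vdE smooth_\<Delta> z])
qed

text \<open>For r = n the right side of \<open>\<Delta>_low\<close> vanishes because y_n = b_n =
  0.\<close>

lemma perp_\<Delta>: "perp (\<Delta> z)"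
  using \<Delta>_low[OF z, of n] p_nonzero by (simp add: metric'_n yn bn)

lemma vd_\<Delta>_rhs:
  "vd a (\<lambda>w. 2 * E w * (\<iota> w)^3 * S \<beta> w * (3 * E w * \<iota> w * vd r \<beta> w - 2 * vd r E w)) z =
    2 * E z * (\<iota> z)^3 * S \<beta> z * (3 * E z * \<iota> z * vd a (vd r \<beta>) z
      + 3 * (vd a E z * \<iota> z - E z * (\<iota> z)\<^sup>2 * vd a \<beta> z) * vd r \<beta> z - 2 * vd a (vd r E) z)
    + (2 * vd a E z * (\<iota> z)^3 * S \<beta> z - 6 * E z * (\<iota> z)^4 * vd a \<beta> z * S \<beta> z
      + 4 * E z * (\<iota> z)^3 * \<delta> a \<beta> z) * (3 * E z * \<iota> z * vd r \<beta> z - 2 * vd r E z)"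
proof -
  note S = smooth_on_has_derivative[OF smooth_S[OF smooth_\<beta>] zU]
  have "\<exists>T'. ((\<lambda>w. 2 * E w * (\<iota> w)^3 * S \<beta> w * (3 * E w * \<iota> w * vd r \<beta> w - 2 * vd r E w))
      has_derivative T') (at z) \<and> T' (0, a) =
    2 * E z * (\<iota> z)^3 * S \<beta> z * (3 * E z * \<iota> z * vd a (vd r \<beta>) z
      + 3 * (vd a E z * \<iota> z - E z * (\<iota> z)\<^sup>2 * vd a \<beta> z) * vd r \<beta> z - 2 * vd a (vd r E) z)
    + (2 * vd a E z * (\<iota> z)^3 * S \<beta> z - 6 * E z * (\<iota> z)^4 * vd a \<beta> z * S \<beta> z
      + 2 * E z * (\<iota> z)^3 * vd a (S \<beta>) z) * (3 * E z * \<iota> z * vd r \<beta> z - 2 * vd r E z)"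
    unfolding vd_def[of a]
    by (rule exI, rule conjI, (rule derivative_intros has_derivative_E_beta[OF z] S)+)
      (simp add: algebra_simps power2_eq_square eval_nat_numeral)
  \<comment> \<open>\<open>vd_S\<beta>\<close> turns the derivative of S \<beta> into twice the
    horizontal derivative of \<beta>, whence the coefficient 4.\<close>
  then show ?thesis unfolding vd_def[of a, symmetric]
    using dd_eqI vd_S\<beta>[OF zU, of a] unfolding vd_def[of a] by fastforce
qed

text \<open>In \<open>vd_\<Delta>_low\<close> with r = n the third derivative vanishes by
  \<open>C'n\<close>, and the right side because y_n = b_n = g_{an} = 0.\<close>

lemma perp_vd_\<Delta>: assumes a: "perp a" shows "perp (vd a \<Delta> z)"
proof -
  have "vd a (vd (\<Delta> z) (vd n E')) z = vd n (vd a (vd (\<Delta> z) E')) z"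
    using vd_cycle[OF star.open_U star.smooth_E z] by metis
  then have "vd (vd a \<Delta> z) (vd n E') z = 0"
    using vd_\<Delta>_low[of a n] C'n[OF a perp_\<Delta>] \<kappa>[of a n] a by (simp add: vd_\<Delta>_rhs yn bn)
  then show ?thesis using p_nonzero by (simp add: metric'_n)
qed

text \<open>The counterpart of \<open>perp_vd_\<Delta>\<close>: differentiation along n is tested
  against tangential vectors, and \<open>\<delta>n\<close> removes the derivative of S
  \<beta>.\<close>

lemma vd_n_\<Delta>: "vd n \<Delta> z = vd (vd n \<Delta> z) (vd n E) z *\<^sub>R n"
proof -
  \<comment> \<open>The tangential part, to be shown orthogonal to every vector for the starred
    metric.\<close>
  define v where "v = vd n \<Delta> z - vd (vd n \<Delta> z) (vd n E) z *\<^sub>R n"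
  have "vd r (vd v E') z = 0" for r
  proof -
    define a where "a = r - vd r (vd n E) z *\<^sub>R n"
    have a: "perp a" by (simp add: a_def vd_linear_simps[OF smooth_vdE zU] nn)
    have "vd n (vd (\<Delta> z) (vd a E')) z = 0" by (rule C'n[OF perp_\<Delta> a])
    then have "vd (vd n \<Delta> z) (vd a E') z = 0"
      using vd_\<Delta>_low[of n a] \<kappa>[of n a] perp'[OF a] by (simp add: vd_\<Delta>_rhs yn bn \<delta>n)
    moreover have "vd n (vd a E') z = 0" using metric'_n'[of a] a by simp
    ultimately have 1: "vd v (vd a E') z = 0"
      by (simp add: v_def star.vd_linear_simps[OF star.smooth_vdE z])
    have 2: "vd v (vd n E') z = 0"
      by (simp add: v_def metric'_n vd_linear_simps[OF smooth_vdE zU] nn)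
    have "r = a + vd r (vd n E) z *\<^sub>R n" by (simp add: a_def)
    then have "vd v (vd r E') z = vd v (vd (a + vd r (vd n E) z *\<^sub>R n) E') z" by simp
    also have "\<dots> = 0" using 1 2 by (simp add: star.vd_linear_simps[OF star.smooth_E z])
    finally show ?thesis using vd_commute[OF star.open_U star.smooth_E z] by simp
  qed
  from star.nondeg[OF z this] show ?thesis by (simp add: v_def)
qed

section \<open>The starred Cartan connection on tangential vectors\<close>

lemma star_\<delta>:
  fixes f :: "'n tvec \<Rightarrow> real"
  assumes f: "smooth_on U' f"
  shows "star.\<delta> k f z = \<delta> k f z - vd (vd k \<Delta> z) f z"
  unfolding star.\<delta>_def \<delta>_def vd_G'[OF z]
  using dd_pair[OF f z, of k "- vd k G z"] dd_pair[OF f z, of k "- (vd k G z + vd k \<Delta> z)"]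
  by (simp add: star.vd_linear_simps[OF f z])

text \<open>The corrections by \<Delta> are starred third derivatives with one normal and two
  tangential arguments and vanish by \<open>C'n\<close>. The Christoffel formula with the original
  \<open>\<delta>\<close> remains, to which \<open>dd_vd2E'\<close> applies.\<close>

lemma star_conn_low:
  assumes j: "perp j" and k: "perp k"
  shows "star.conn_low n j k z = p * vd n (vd (vd j (vd k G) z) E) z"
proof -
  have s: "smooth_on U' (vd u (vd v E'))" for u v
    by (intro smooth_on_vd star.smooth_E)
  have c: "vd u (vd n (vd v E')) z = vd n (vd u (vd v E')) z" for u v
    by (rule vd_commute[OF star.open_U star.smooth_vdE z])
  have "vd (vd n \<Delta> z) (vd j (vd k E')) z = 0"
    by (subst vd_n_\<Delta>) (simp add: star.vd_linear_simps[OF smooth_on_vd[OF star.smooth_vdE] z] C'n[OF j k])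
  then have 1: "2 * star.conn_low n j k z =
      \<delta> k (vd n (vd j E')) z + \<delta> j (vd n (vd k E')) z - \<delta> n (vd j (vd k E')) z"
    unfolding star.conn_low_def star_\<delta>[OF s]
    using C'n[OF perp_vd_\<Delta>[OF j] k] C'n[OF perp_vd_\<Delta>[OF k] j] by (simp add: c)
  let ?A = "vd j (vd k G) z" and ?J = "vd n (vd j G) z" and ?K = "vd n (vd k G) z"
  have comm: "vd u (vd v G) z = vd v (vd u G) z" "vd u (vd v E) z = vd v (vd u E) z"
    "vd u (vd v \<beta>) z = vd v (vd u \<beta>) z" for u v
    by (rule vd_commute[OF open_U smooth_G zU] vd_commute[OF open_U smooth_E zU]
        vd_commute[OF open_U smooth_\<beta> zU])+
  have dE: "dd E z (u, - vd u G z) = 0" "dd (vd v E) z (u, - vd u G z) = vd (vd u (vd v G) z) E z" for u v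
    using \<delta>_E[OF zU, of u] \<delta>_vdE[OF zU, of u v] comm(1) by (simp_all add: \<delta>_def)
  have dE2: "dd (vd v (vd w E)) z (u, - vd u G z) =
      vd (vd u (vd v G) z) (vd w E) z + vd (vd u (vd w G) z) (vd v E) z" for u v w
    using \<delta>_vd2E[OF zU, of u v w] by (simp add: \<delta>_def)
  have d\<beta>2: "dd (vd v (vd w \<beta>)) z (u, - vd u G z) =
      vd (vd u (vd v G) z) (vd w \<beta>) z + vd (vd u (vd w G) z) (vd v \<beta>) z + hess_berwald \<beta> u v w z" for u v w
    using \<delta>_hess[OF smooth_\<beta> zU S_vd2\<beta>, of u v w] by (simp add: \<delta>_def)
  \<comment> \<open>By total symmetry it suffices that one index is n and another
    tangential.\<close>
  have Q: "hess_berwald \<beta> k n j z = 0" "hess_berwald \<beta> j n k z = 0" "hess_berwald \<beta> n j k z = 0"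
    using berwald_\<beta>_n[OF j] berwald_\<beta>_n[OF k] hess_berwald_sym[OF smooth_\<beta> zU] by metis+
  \<comment> \<open>This symmetry cancels the horizontal derivatives of b between the terms of the
    Christoffel formula.\<close>
  have grad: "dd (vd v \<beta>) z (u, - vd u G z) = dd (vd u \<beta>) z (v, - vd v G z)" for u v
    using gradient[OF zU, of u v] by (simp add: \<delta>_def)
  have \<delta>n': "dd \<beta> z (n, - vd n G z) = 0" using \<delta>n by (simp add: \<delta>_def)
  have n0: "vd n (vd j E) z = 0" "vd n (vd k E) z = 0" "vd n (vd j \<beta>) z = 0" "vd n (vd k \<beta>) z = 0"
    using perp'[OF j] perp'[OF k] \<kappa>[of n j] \<kappa>[of n k] by (simp_all add: yn)
  have "2 * star.conn_low n j k z = 2 * (4 * E z * (\<iota> z)\<^sup>2 * vd n (vd ?A E) z - 4 * (E z)\<^sup>2 * (\<iota> z)^3 * vd n (vd ?A \<beta>) z)"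
    unfolding 1 \<delta>_def dd_vd2E'[OF z dE(1)] dE(2) dE2 d\<beta>2 Q \<delta>n' n0 yn bn
      comm(1)[of k j] comm(1)[of k n] comm(1)[of j n] comm(2)[of ?A n] comm(3)[of ?A n]
      grad[of n k] grad[of n j]
    by (simp add: algebra_simps)
  also have "\<dots> = 2 * (p * vd n (vd ?A E) z)"
    unfolding \<kappa> p_def by (simp add: yn algebra_simps power2_eq_square eval_nat_numeral)
  finally show ?thesis by simp
qed

end

section \<open>The fundamental tensors of a hypersurface\<close>

definition proj_vec :: "(real^'m::finite \<Rightarrow> real^'n::finite) \<Rightarrow> 'm \<Rightarrow> 'm tvec \<Rightarrow> real^'n"
  where "proj_vec x \<alpha> w = (\<chi> i. proj x i \<alpha> (fst w))"

definition proj2_vec :: "(real^'m::finite \<Rightarrow> real^'n::finite) \<Rightarrow> 'm \<Rightarrow> 'm \<Rightarrow> 'm tvec \<Rightarrow> real^'n"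
  where "proj2_vec x \<alpha> \<gamma> w = (\<chi> i. proj2 x i \<alpha> \<gamma> (fst w))"

lemma snd_lift: "snd (lift x w) = (\<Sum>\<alpha>\<in>UNIV. snd w $ \<alpha> *\<^sub>R proj_vec x \<alpha> w)"
  by (simp add: lift_def proj_vec_def vec_eq_iff mult.commute)

context finsler_chart
begin

section \<open>Fundamental tensors as derivatives of the energy\<close>

lemma normal_low_sum:
  assumes z: "lift x w \<in> U"
  shows "(\<Sum>i\<in>UNIV. normal_low L x N i w * v $ i) = vd (N w) (vd v E) (lift x w)"
proof -
  have "(\<Sum>i\<in>UNIV. normal_low L x N i w * v $ i) = vd v (vd (N w) E) (lift x w)"
    using vd_expand[OF smooth_vdE z, of v "N w"] unfolding normal_low_def metric_sum1[OF z]
    by (simp add: mult.commute)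
  then show ?thesis using vd_commute[OF open_U smooth_E z, of "N w" v] by simp
qed

lemma second_v_tensor_eq:
  assumes z: "lift x w \<in> U"
  shows "second_v_tensor L x N \<alpha> \<gamma> w =
    vd (N w) (vd (proj_vec x \<alpha> w) (vd (proj_vec x \<gamma> w) E)) (lift x w) / 2"
  using cartan_low_sum[OF z, of "proj_vec x \<alpha> w" "proj_vec x \<gamma> w" "N w"]
  by (simp add: second_v_tensor_def proj_vec_def)

lemma M_vec_eq:
  assumes z: "lift x w \<in> U"
  shows "M_vec L x N \<alpha> w = vd (N w) (vd (proj_vec x \<alpha> w) (vd (N w) E)) (lift x w) / 2"
  using cartan_low_sum[OF z, of "proj_vec x \<alpha> w" "N w" "N w"]
  by (simp add: M_vec_def proj_vec_def)

lemma normal_curvature_eq: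
  assumes z: "lift x w \<in> U"
  shows "normal_curvature L x N \<alpha> w = vd (N w) (vd ((\<Sum>\<gamma>\<in>UNIV. snd w $ \<gamma> *\<^sub>R proj2_vec x \<gamma> \<alpha> w)
    + vd (proj_vec x \<alpha> w) G (lift x w)) E) (lift x w)"
proof -
  have "vd (proj_vec x \<alpha> w) G (lift x w) $ i = (\<Sum>j\<in>UNIV. nonlin L i j (lift x w) * proj x j \<alpha> (fst w))" for i
    using vd_expand[OF smooth_G z, of "proj_vec x \<alpha> w"]
    by (simp add: nonlin_eq[OF z] proj_vec_def mult.commute)
  then show ?thesis
    unfolding normal_low_sum[OF z, symmetric] normal_curvature_def
    by (simp add: proj2_vec_def mult.commute)
qed

lemma second_h_tensor_eq:
  assumes z: "lift x w \<in> U"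
  shows "second_h_tensor L x N \<alpha> \<gamma> w = vd (N w) (vd (proj2_vec x \<alpha> \<gamma> w) E) (lift x w)
    + conn_low (N w) (proj_vec x \<alpha> w) (proj_vec x \<gamma> w) (lift x w)
    + M_vec L x N \<alpha> w * normal_curvature L x N \<gamma> w"
  unfolding second_h_tensor_def normal_low_sum[OF z, symmetric] cartan_conn_sum[OF z, symmetric]
  by (simp add: normal_low_def proj_vec_def proj2_vec_def distrib_left sum.distrib)

text \<open>This rests on \<open>M\<^sub>\<alpha> v\<^sup>\<alpha> = 0\<close> and \<open>F\<^sup>i\<^bsub>jk\<^esub> y\<^sup>j = G\<^sup>i\<^sub>k\<close>.\<close>

lemma normal_curvature_transvection:
  assumes z: "lift x w \<in> U"
  shows "(\<Sum>\<alpha>\<in>UNIV. snd w $ \<alpha> * second_h_tensor L x N \<alpha> \<gamma> w) = normal_curvature L x N \<gamma> w"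
proof -
  let ?z = "lift x w"
  note lin = linear_sum[OF linear_vd2[OF open_U smooth_E z]] linear_sum[OF linear_vd2[OF open_U smooth_vdE z]]
    linear_cmul[OF linear_vd2[OF open_U smooth_E z]] linear_cmul[OF linear_vd2[OF open_U smooth_vdE z]]
    linear_sum[OF linear_conn_low(2)[OF z]] linear_cmul[OF linear_conn_low(2)[OF z]]
  have "(\<Sum>\<alpha>\<in>UNIV. snd w $ \<alpha> * M_vec L x N \<alpha> w) = vd (N w) (vd (snd ?z) (vd (N w) E)) ?z / 2"
    unfolding M_vec_eq[OF z] snd_lift lin by (simp add: sum_divide_distrib)
  also have "\<dots> = 0"
    using vd_commute[OF open_U smooth_vdE z, of "N w" "snd ?z" "N w"] Euler_vd2E[OF z] by simp
  finally have "(\<Sum>\<alpha>\<in>UNIV. snd w $ \<alpha> * (M_vec L x N \<alpha> w * normal_curvature L x N \<gamma> w)) = 0"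
    unfolding mult.assoc[symmetric] sum_distrib_right[symmetric] by simp
  moreover have "(\<Sum>\<alpha>\<in>UNIV. snd w $ \<alpha> * conn_low (N w) (proj_vec x \<alpha> w) (proj_vec x \<gamma> w) ?z) =
      vd (N w) (vd (vd (proj_vec x \<gamma> w) G ?z) E) ?z"
    unfolding conn_low_snd[OF z, symmetric] snd_lift lin by simp
  ultimately show ?thesis
    unfolding second_h_tensor_eq[OF z] normal_curvature_eq[OF z]
    by (simp add: distrib_left sum.distrib vd_linear_simps[OF smooth_E z] lin)
qed

text \<open>A dimension count: the vectors B span a space of dimension \<open>CARD('m)\<close>
  inside the orthogonal complement of n, which is proper because it does not contain n.\<close>

lemma perp_in_span:
  fixes B :: "'m::finite \<Rightarrow> real^'n"
  assumes z: "z \<in> U" and nn: "vd n (vd n E) z = 1"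
    and B: "\<And>\<alpha>. vd (B \<alpha>) (vd n E) z = 0"
    and rank: "rank ((\<chi> i \<alpha>. B \<alpha> $ i) :: real^'m^'n) = CARD('m)" and card: "CARD('n) = CARD('m) + 1"
    and a: "vd a (vd n E) z = 0"
  obtains u where "a = (\<Sum>\<alpha>\<in>UNIV. u $ \<alpha> *\<^sub>R B \<alpha>)"
proof -
  define M where "M = ((\<chi> i \<alpha>. B \<alpha> $ i) :: real^'m^'n)"
  have M: "M *v u = (\<Sum>\<alpha>\<in>UNIV. u $ \<alpha> *\<^sub>R B \<alpha>)" for u
    by (simp add: M_def vec_eq_iff matrix_vector_mult_def mult.commute)
  define P where "P = {a. vd a (vd n E) z = 0}"
  note l = linear_vd[OF smooth_vdE z, of n]
  have P: "subspace P"
    unfolding P_def subspace_def by (simp add: linear_0[OF l] linear_add[OF l] linear_cmul[OF l])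
  have R: "subspace (range ((*v) M))"
    using linear_subspace_image[OF matrix_vector_mul_linear[of M] subspace_UNIV] .
  have sub: "range ((*v) M) \<subseteq> P"
    by (auto simp: P_def M linear_sum[OF l] linear_cmul[OF l] B)
  have "n \<notin> P" by (simp add: P_def nn)
  then have "dim P \<noteq> DIM(real^'n)"
    using dim_eq_full[of P] span_eq_iff[THEN iffD2, OF P] by auto
  then have "dim P < CARD('n)" using dim_subset_UNIV[of P] by simp
  then have "dim P \<le> dim (range ((*v) M))"
    using rank card rank_dim_range[of M] by (simp add: M_def)
  then have "range ((*v) M) = P" by (rule subspace_dim_equal[OF R P sub])
  then have "a \<in> range ((*v) M)" using a by (simp add: P_def)
  then show ?thesis using that M by auto
qed

end

text \<open>Both claims at one supporting element, since each assumes H_{\<alpha>\<beta>} = 0 and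
  M_{\<alpha>\<beta>} = 0.\<close>

lemma (in kropina_chart) star_tensors_vanish:
  fixes x :: "real^'m::finite \<Rightarrow> real^'n" and N N' :: "'m tvec \<Rightarrow> real^'n"
  assumes z: "lift x w \<in> U'" and card: "CARD('n) = CARD('m) + 1"
    and rank: "rank ((\<chi> i \<alpha>. proj x i \<alpha> (fst w)) :: real^'m^'n) = CARD('m)"
    and N: "\<And>\<alpha>. vd (proj_vec x \<alpha> w) (vd (N w) E) (lift x w) = 0"
      "vd (N w) (vd (N w) E) (lift x w) = 1"
    and N': "\<And>\<alpha>. vd (proj_vec x \<alpha> w) (vd (N' w) E') (lift x w) = 0"
    and tangential: "vd (N w) \<beta> (lift x w) = 0"
    and h0: "\<And>\<alpha> \<gamma>. second_h_tensor L x N \<alpha> \<gamma> w = 0"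
    and v0: "\<And>\<alpha> \<gamma>. second_v_tensor L x N \<alpha> \<gamma> w = 0"
  shows "second_h_tensor (\<lambda>z. (L z)\<^sup>2 / \<beta> z) x N' \<alpha> \<gamma> w = 0"
    "second_v_tensor (\<lambda>z. (L z)\<^sup>2 / \<beta> z) x N' \<alpha> \<gamma> w = 0"
proof -
  define n where "n = N w"
  let ?z = "lift x w" and ?B = "\<lambda>\<alpha>. proj_vec x \<alpha> w"
  have zU: "?z \<in> U" using z by simp
  have rank': "rank ((\<chi> i \<alpha>. ?B \<alpha> $ i) :: real^'m^'n) = CARD('m)"
    using rank by (simp add: proj_vec_def)
  \<comment> \<open>The vector y is tangent to the hypersurface, and g_{ij} y^i N^j is the vertical
    derivative of E along N.\<close>
  have yn: "vd n E ?z = 0"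
  proof -
    have "vd n E ?z = vd (snd ?z) (vd n E) ?z" by (simp add: Euler_vdE[OF zU])
    also have "\<dots> = 0"
      unfolding snd_lift using N(1)
      by (simp add: n_def linear_sum[OF linear_vd[OF smooth_vdE zU]] vd_linear_simps[OF smooth_vdE zU])
    finally show ?thesis .
  qed
  have C: "vd n (vd a (vd c E)) ?z = 0" if a: "vd a (vd n E) ?z = 0" and c: "vd c (vd n E) ?z = 0" for a c
  proof -
    obtain u where u: "a = (\<Sum>\<alpha>\<in>UNIV. u $ \<alpha> *\<^sub>R ?B \<alpha>)"
      using perp_in_span[OF zU N(2) N(1) rank' card] a unfolding n_def by blast
    obtain v where v: "c = (\<Sum>\<alpha>\<in>UNIV. v $ \<alpha> *\<^sub>R ?B \<alpha>)"
      using perp_in_span[OF zU N(2) N(1) rank' card] c unfolding n_def by blast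
    have "vd n (vd (?B \<alpha>) (vd (?B \<gamma>) E)) ?z = 0" for \<alpha> \<gamma>
      using v0[of \<alpha> \<gamma>] by (simp add: second_v_tensor_eq[OF zU] n_def)
    then have "vd n (vd (?B \<alpha>) (vd c E)) ?z = 0" for \<alpha>
      unfolding v
      by (simp add: linear_sum[OF linear_vd3[OF open_U smooth_E zU]] linear_cmul[OF linear_vd3[OF open_U smooth_E zU]])
    then show ?thesis
      unfolding u
      by (simp add: linear_sum[OF linear_vd2[OF open_U smooth_vdE zU]] linear_cmul[OF linear_vd2[OF open_U smooth_vdE zU]])
  qed
  interpret hypersurface_point U L \<beta> ?z n
    by unfold_locales (use z N(2) yn tangential C in \<open>simp_all add: n_def\<close>)
  \<comment> \<open>The normal component of N'. The tangential rest a is orthogonal to every vector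
    for the starred metric, so it vanishes.\<close>
  define \<mu> where "\<mu> = vd (N' w) (vd n E) ?z"
  define a where "a = N' w - \<mu> *\<^sub>R n"
  have a: "perp a" by (simp add: a_def \<mu>_def vd_linear_simps[OF smooth_vdE zU] nn)
  have "vd r (vd a E') ?z = 0" for r
  proof -
    define s where "s = r - vd r (vd n E) ?z *\<^sub>R n"
    have s: "perp s" by (simp add: s_def vd_linear_simps[OF smooth_vdE zU] nn)
    obtain u where u: "s = (\<Sum>\<alpha>\<in>UNIV. u $ \<alpha> *\<^sub>R ?B \<alpha>)"
      using perp_in_span[OF zU N(2) N(1) rank' card] s unfolding n_def by blast
    have "vd s (vd (N' w) E') ?z = 0"
      unfolding u using N'
      by (simp add: linear_sum[OF linear_vd[OF star.smooth_vdE z]] star.vd_linear_simps[OF star.smooth_vdE z])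
    moreover have "vd s (vd n E') ?z = 0" using s by (simp add: metric'_n)
    ultimately have 1: "vd s (vd a E') ?z = 0"
      by (simp add: a_def star.vd_linear_simps[OF star.smooth_E z])
    have 2: "vd n (vd a E') ?z = 0" using a by (simp add: metric'_n')
    have "r = s + vd r (vd n E) ?z *\<^sub>R n" by (simp add: s_def)
    then have "vd r (vd a E') ?z = vd (s + vd r (vd n E) ?z *\<^sub>R n) (vd a E') ?z" by simp
    also have "\<dots> = 0" using 1 2 by (simp add: star.vd_linear_simps[OF star.smooth_vdE z])
    finally show ?thesis .
  qed
  then have "a = 0" by (rule star.nondeg[OF z])
  then have N'_eq: "N' w = \<mu> *\<^sub>R n" by (simp add: a_def)
  \<comment> \<open>Contraction of \<open>h0\<close> with v gives the normal curvature vector, so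
    the product term in H_{\<alpha>\<beta>} drops out.\<close>
  have H: "normal_curvature L x N \<gamma> w = 0" for \<gamma>
    using normal_curvature_transvection[OF zU, of N \<gamma>] by (simp add: h0)
  have B: "perp (?B \<alpha>)" for \<alpha> using N(1) by (simp add: n_def)
  have H': "normal_curvature (\<lambda>z. (L z)\<^sup>2 / \<beta> z) x N' \<gamma> w = 0" for \<gamma>
  proof -
    \<comment> \<open>X is tangential because H_\<gamma> = 0, and the derivative of \<Delta> along B
      keeps it so.\<close>
    define X where "X = (\<Sum>\<alpha>\<in>UNIV. snd w $ \<alpha> *\<^sub>R proj2_vec x \<alpha> \<gamma> w) + vd (?B \<gamma>) G ?z"
    have "vd n (vd X E) ?z = 0" using H[of \<gamma>] by (simp add: normal_curvature_eq[OF zU] X_def n_def)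
    then have "perp X" using vd_commute[OF open_U smooth_E zU, of X n] by simp
    then have "vd n (vd (X + vd (?B \<gamma>) \<Delta> ?z) E') ?z = 0"
      using perp_vd_\<Delta>[OF B] by (simp add: metric'_n' vd_linear_simps[OF smooth_vdE zU])
    then show ?thesis
      unfolding star.normal_curvature_eq[OF z] N'_eq vd_G'[OF z]
      by (simp add: X_def add.assoc star.vd_linear_simps[OF star.smooth_vdE z])
  qed
  \<comment> \<open>The Cartan connection is now the Berwald connection; passing to the starred
    tensors multiplies both terms by \<open>p\<close>.\<close>
  have "vd n (vd (proj2_vec x \<alpha> \<gamma> w) E) ?z + vd n (vd (vd (?B \<alpha>) (vd (?B \<gamma>) G) ?z) E) ?z = 0"
    using h0[of \<alpha> \<gamma>] by (simp add: second_h_tensor_eq[OF zU] H conn_low_eq[OF zU] n_def)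
  then have "vd n (vd (proj2_vec x \<alpha> \<gamma> w) E') ?z + star.conn_low n (?B \<alpha>) (?B \<gamma>) ?z = 0"
    using vd_commute[OF open_U smooth_E zU, of n "proj2_vec x \<alpha> \<gamma> w"]
    by (simp add: metric'_n' star_conn_low[OF B B] distrib_left[symmetric])
  then show "second_h_tensor (\<lambda>z. (L z)\<^sup>2 / \<beta> z) x N' \<alpha> \<gamma> w = 0"
    unfolding star.second_h_tensor_eq[OF z] H' N'_eq
    by (simp add: star.vd_linear_simps[OF star.smooth_vdE z] linear_cmul[OF star.linear_conn_low(1)[OF z]]
        distrib_left[symmetric])
  show "second_v_tensor (\<lambda>z. (L z)\<^sup>2 / \<beta> z) x N' \<alpha> \<gamma> w = 0"
    unfolding star.second_v_tensor_eq[OF z] N'_eq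
    by (simp add: star.vd_linear_simps[OF smooth_on_vd[OF star.smooth_vdE] z] C'n[OF B B])
qed

section \<open>Passage to charts\<close>

text \<open>Euler's relation is homogeneity differentiated in the scaling factor t at t = 1.\<close>

lemma finsler_space_chart:
  assumes F: "finsler_space X A D L" and c: "c \<in> A"
  shows "finsler_chart (D c) (L c)"
proof
  have *: "open (D c)" "smooth_on (D c) (L c)" "\<And>z. z \<in> D c \<Longrightarrow> invertible (metric_mat (L c) z)"
    "\<And>x y t. (x, y) \<in> D c \<Longrightarrow> t > 0 \<Longrightarrow> L c (x, t *\<^sub>R y) = t * L c (x, y)"
    using F c unfolding finsler_space_def by fastforce+
  show "open (D c)" "smooth_on (D c) (L c)" by (rule *)+
  show "invertible (metric_mat (L c) z)" if "z \<in> D c" for z by (rule *(3)[OF that])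
  show "vd (snd z) (L c) z = L c z" if z: "z \<in> D c" for z
  proof -
    obtain x y where xy: "z = (x, y)" by (cases z)
    have d: "((\<lambda>t. (x, 0) + t *\<^sub>R (0, y)) has_derivative (\<lambda>t. t *\<^sub>R (0, y))) (at 1)"
      by (auto intro!: derivative_eq_intros)
    have "(L c has_derivative dd (L c) z) (at ((x, 0) + 1 *\<^sub>R (0, y)))"
      using smooth_on_has_derivative[OF *(2) z] by (simp add: xy)
    from diff_chain_at[OF d this]
    have "((\<lambda>t. L c (x, t *\<^sub>R y)) has_derivative (\<lambda>t. dd (L c) z (t *\<^sub>R (0, y)))) (at 1)"
      by (simp add: o_def)
    moreover have "((\<lambda>t. L c (x, t *\<^sub>R y)) has_derivative (\<lambda>t. t * L c z)) (at 1)"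
    proof (rule has_derivative_transform_within_open[OF _ open_greaterThan[of 0]])
      show "((\<lambda>t. t * L c z) has_derivative (\<lambda>t. t * L c z)) (at 1)"
        by (auto intro!: derivative_eq_intros)
    qed (use *(4) z xy in auto)
    ultimately have "(\<lambda>t. dd (L c) z (t *\<^sub>R (0, y))) = (\<lambda>t. t * L c z)"
      by (rule has_derivative_unique)
    from fun_cong[OF this, of 1] show ?thesis by (simp add: vd_def xy)
  qed
qed

context finsler_chart
begin

lemma vd2_energy:
  assumes z: "z \<in> U" shows "vd i (vd j E) z = vd i L z * vd j L z + L z * vd i (vd j L) z"
proof -
  have "vd i (vd j E) z = vd i (\<lambda>w. L w * vd j L w) z"
    by (rule vd_cong[OF open_U z vd_energy])
  then show ?thesis by (simp add: vd_mult[OF smooth_L smooth_on_vd[OF smooth_L] z])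
qed

lemma angular_eq: "angular L i j z = L z * vd (axis i 1) (vd (axis j 1) L) z"
  by (simp add: angular_def pdy_eq_vd)

text \<open>If \<open>L\<close> vanished somewhere, the metric tensor would have rank at most one there.\<close>

lemma L_nonzero_if_dim_ge_2:
  assumes z: "z \<in> U" and card: "CARD('n) \<ge> 2"
  shows "L z \<noteq> 0"
proof
  assume L0: "L z = 0"
  have "\<not> (\<forall>i j::'n. i = j)"
  proof
    assume "\<forall>i j::'n. i = j"
    then have "CARD('n) \<le> 1" using card_le_Suc0_iff_eq[of "UNIV :: 'n set"] by simp
    with card show False by simp
  qed
  then obtain i j :: 'n where ij: "i \<noteq> j" by blast
  \<comment> \<open>At a zero of L the metric is l_i l_j, so vectors annihilated by l_i lie in its
    kernel.\<close>
  have zero: "u = 0" if "vd u L z = 0" for u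
    by (rule nondeg[OF z]) (simp add: vd2_energy[OF z] L0 that)
  \<comment> \<open>Built so that l_i u^i = 0.\<close>
  define u where "u = vd (axis j 1) L z *\<^sub>R axis i 1 - vd (axis i 1) L z *\<^sub>R (axis j 1 :: real^'n)"
  have "u = 0" by (rule zero) (simp add: u_def vd_linear_simps[OF smooth_L z])
  then have "u $ i = 0" by simp
  then have "vd (axis j 1) L z = 0" using ij by (simp add: u_def axis_def)
  from zero[OF this] show False by (simp add: axis_eq_0_iff)
qed

text \<open>By (i) and (ii) the vertical derivative of b_i is a multiple of the angular metric,
  which annihilates y; differentiating \<beta> = b_i y^i therefore returns b_j.\<close>

lemma h_vector_chart:
  assumes card: "CARD('n) \<ge> 2" and landsberg: "\<And>z r i j. z \<in> U \<Longrightarrow> vhv_torsion L r i j z = 0"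
    and b: "smooth_on U b" and v: "\<And>z i k. z \<in> U \<Longrightarrow> vcov L b i k z = 0"
    and \<rho>: "\<And>z. z \<in> U \<Longrightarrow> \<rho> z \<noteq> 0"
      "\<And>z i j. z \<in> U \<Longrightarrow> L z * (\<Sum>h\<in>UNIV. cartan L h i j z * b z $ h) = \<rho> z * angular L i j z"
    and grad: "\<And>z i j. z \<in> U \<Longrightarrow> hcov L b i j z = hcov L b j i z"
  shows "h_chart U L (beta b)" "\<And>z u. z \<in> U \<Longrightarrow> vd u (beta b) z = (\<Sum>i\<in>UNIV. b z $ i * u $ i)"
proof -
  note L0 = L_nonzero_if_dim_ge_2[OF _ card]
  let ?H = "\<lambda>z u v. 2 * E z * vd u (vd v E) z - vd u E z * vd v E z"
  let ?e = "\<lambda>i. axis i (1::real) :: real^'n"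
  have sb: "smooth_on U (\<lambda>w. b w $ i)" for i by (rule smooth_on_component[OF open_U b])
  \<comment> \<open>Condition (ii) in terms of the energy: h_{ij} is the angular expression
    \<open>?H\<close> divided by L^2.\<close>
  have c: "(\<Sum>r\<in>UNIV. cartan L r i j z * b z $ r) = \<rho> z / (L z)^3 * ?H z (?e i) (?e j)" if z: "z \<in> U" for z i j
  proof -
    have "L z * (\<Sum>h\<in>UNIV. cartan L h i j z * b z $ h) = \<rho> z * (L z * vd (?e i) (vd (?e j) L) z)"
      using \<rho>(2)[OF z] by (simp add: angular_eq)
    then show ?thesis
      using L0[OF z] unfolding vd_energy[OF z] vd2_energy[OF z] energy_def
      by (simp add: field_simps power2_eq_square power3_eq_cube)
  qed
  have db: "vd (?e j) (\<lambda>w. b w $ i) z = (\<Sum>r\<in>UNIV. cartan L r i j z * b z $ r)" if "z \<in> U" for z i j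
    using v[OF that, of i j] by (simp add: vcov_def pdy_eq_vd)
  have s\<beta>: "smooth_on U (beta b)"
    unfolding beta_def
    by (intro smooth_on_sum[OF open_U] smooth_on_mult[OF open_U] sb smooth_on_component[OF open_U]
        smooth_on_snd[OF open_U])
  have ax: "vd (?e j) (beta b) z = b z $ j" if z: "z \<in> U" for z j
  proof -
    have y: "vd (?e j) (\<lambda>w. snd w $ i) z = ?e j $ i" for i
      using dd_eqI[OF bounded_linear_imp_has_derivative[OF
            bounded_linear_compose[OF bounded_linear_vec_nth bounded_linear_snd]], of i z "(0, ?e j)"]
      by (simp add: vd_def)
    have lin: "linear (\<lambda>u. ?H z u (?e j))"
      using linear_vd[OF smooth_vdE z] linear_vd[OF smooth_E z]
      by (auto intro!: linearI simp: linear_add linear_cmul vd_linear_simps[OF smooth_E z]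
          vd_linear_simps[OF smooth_vdE z] algebra_simps)
    have "vd (?e j) (beta b) z = (\<Sum>i\<in>UNIV. vd (?e j) (\<lambda>w. b w $ i * snd w $ i) z)"
      unfolding beta_def vd_def
      by (rule dd_eqI) (intro has_derivative_sum smooth_on_has_derivative[OF _ z] smooth_on_mult[OF open_U]
          sb smooth_on_component[OF open_U] smooth_on_snd[OF open_U])
    also have "\<dots> = (\<Sum>i\<in>UNIV. b z $ i * ?e j $ i + \<rho> z / (L z)^3 * ?H z (?e i) (?e j) * snd z $ i)"
      by (simp only: vd_mult[OF sb smooth_on_component[OF open_U smooth_on_snd[OF open_U]] z] y db[OF z] c[OF z])
    also have "\<dots> = b z $ j + \<rho> z / (L z)^3 * (\<Sum>i\<in>UNIV. snd z $ i * ?H z (?e i) (?e j))"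
    proof -
      have "(\<Sum>i\<in>UNIV. b z $ i * ?e j $ i) = b z $ j"
        by (simp add: axis_def if_distrib cong: if_cong)
      then show ?thesis by (simp add: sum.distrib sum_distrib_left mult_ac)
    qed
    also have "(\<Sum>i\<in>UNIV. snd z $ i * ?H z (?e i) (?e j)) = ?H z (snd z) (?e j)"
      using linear_expand[OF lin, of "snd z"] by simp
    also have "\<dots> = 0" by (simp add: Euler_vdE[OF z] Euler_E[OF z])
    finally show ?thesis by simp
  qed
  have vb: "vd u (vd (?e j) (beta b)) z = vd u (\<lambda>w. b w $ j) z" if "z \<in> U" for z u j
    by (rule vd_cong[OF open_U that ax])
  have hess_ax: "vd (?e i) (vd (?e j) (beta b)) z = (\<Sum>r\<in>UNIV. cartan L r i j z * b z $ r)" if z: "z \<in> U" for z i j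
    using vd_commute[OF open_U s\<beta> z, of "?e i" "?e j"] vb[OF z] db[OF z] by simp
  show vd\<beta>: "vd u (beta b) z = (\<Sum>i\<in>UNIV. b z $ i * u $ i)" if z: "z \<in> U" for z u
    using vd_expand[OF s\<beta> z, of u] by (simp add: ax[OF z] mult.commute)
  show "h_chart U L (beta b)"
  proof unfold_locales
    fix z :: "'n tvec" assume z: "z \<in> U"
    show "vhv_torsion L r i j z = 0" for r i j by (rule landsberg[OF z])
    show "vd (snd z) (beta b) z = beta b z" by (simp add: vd\<beta>[OF z] beta_def)
    show "vd (?e i) (vd (?e j) (beta b)) z = vd (cartan_vec i j z) (beta b) z" for i j
      by (simp add: vd\<beta>[OF z] hess_ax[OF z] cartan_vec_def mult.commute)
    show "\<exists>\<kappa>. \<kappa> \<noteq> 0 \<and> (\<forall>i j. vd i (vd j (beta b)) z = \<kappa> * ?H z i j)"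
    proof (intro exI[of _ "\<rho> z / (L z)^3"] conjI allI)
      show "\<rho> z / (L z)^3 \<noteq> 0" using \<rho>(1)[OF z] L0[OF z] by simp
      have l1: "linear (\<lambda>u. k * ?H z u v)" and l2: "linear (\<lambda>u. k * ?H z v u)" for k v
        by (auto intro!: linearI simp: vd_linear_simps[OF smooth_E z] vd_linear_simps[OF smooth_vdE z]
            algebra_simps)
      have "vd (?e i) (vd v (beta b)) z = \<rho> z / (L z)^3 * ?H z (?e i) v" for i v
        by (rule axis_test[OF linear_vd2[OF open_U s\<beta> z] l2]) (simp only: hess_ax[OF z] c[OF z])
      then show "vd u (vd v (beta b)) z = \<rho> z / (L z)^3 * ?H z u v" for u v
        by (rule axis_test[OF linear_vd[OF smooth_on_vd[OF s\<beta>] z] l1])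
    qed
    \<comment> \<open>The connection terms of b_{i|j} and b_{j|i} agree by symmetry of
      F^r_{ij}.\<close>
    have d: "\<delta> (?e j) (vd (?e i) (beta b)) z = \<delta> (?e i) (vd (?e j) (beta b)) z" for i j
    proof -
      have e: "\<delta> (?e j) (vd (?e i) (beta b)) z = delta L j (\<lambda>w. b w $ i) z" for i j
        unfolding delta_eq[OF sb z] \<delta>_def by (rule dd_cong[OF open_U z ax])
      have "hcov L b i j z = delta L j (\<lambda>w. b w $ i) z - (\<Sum>r\<in>UNIV. cartan_conn L r i j z * b z $ r)" for i j
        by (simp add: hcov_def delta_def mult.commute)
      then show ?thesis using grad[OF z, of i j] cartan_conn_sym[OF z, of _ i j] by (simp add: e)
    qed
    have "\<delta> (?e i) (vd v (beta b)) z = \<delta> v (vd (?e i) (beta b)) z" for i v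
      by (rule axis_test[OF linear_\<delta>_vd(1)[OF s\<beta> z] linear_\<delta>[OF smooth_on_vd[OF s\<beta>] z]]) (rule d)
    then show "\<delta> i (vd j (beta b)) z = \<delta> j (vd i (beta b)) z" for i j
      by (rule axis_test[OF linear_\<delta>[OF smooth_on_vd[OF s\<beta>] z] linear_\<delta>_vd(1)[OF s\<beta> z]])
  qed (rule s\<beta>)
qed

end

theorem theorem4p4:
  fixes X :: "'p topology" and A :: "('p, 'n::finite) chart set"
    and D :: "('p, 'n) chart \<Rightarrow> 'n tvec set"
    and L :: "('p, 'n) chart \<Rightarrow> 'n tvec \<Rightarrow> real"
    and b :: "('p, 'n) chart \<Rightarrow> 'n tvec \<Rightarrow> real^'n"
    and Y :: "'q topology" and E :: "('q, 'm::finite) chart set"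
    and f :: "'q \<Rightarrow> 'p"
    and N N' :: "('p, 'n) chart \<Rightarrow> ('q, 'm) chart \<Rightarrow> 'm tvec \<Rightarrow> real^'n"
  assumes "landsberg_space X A D L"
    and "h_vector A D L b"
    and "finsler_space X A (kropina_dom D b) (kropina L b)"
    and "hypersurface X A Y E f"
    and "unit_normal A D L E f N"
    and "unit_normal A (kropina_dom D b) (kropina L b) E f N'"
    and "gradient_field A D L b"
    and "tangential A D b E f N"
  shows "(hyperplane_second_kind A D L E f N \<and> v_tensor_vanishes A D L E f N \<longrightarrow>
            hyperplane_second_kind A (kropina_dom D b) (kropina L b) E f N') \<and>
         (hyperplane_third_kind A D L E f N \<longrightarrow>
            hyperplane_third_kind A (kropina_dom D b) (kropina L b) E f N')"
proof -
  have card: "CARD('n) = CARD('m) + 1" using assms(4) by (simp add: hypersurface_def)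
  \<comment> \<open>The hypersurface has dimension at least 1; the bound is used to show that L has
    no zeros.\<close>
  then have card2: "CARD('n) \<ge> 2" using zero_less_card_finite[where 'a = 'm] by linarith
  \<comment> \<open>The hypotheses of either claim amount to H_{\<alpha>\<beta>} = 0 and
    M_{\<alpha>\<beta>} = 0, so one pointwise statement yields both.\<close>
  have main: "second_h_tensor (kropina L b c) (loc_map f c d) (N' c d) \<alpha> \<gamma> w = 0 \<and>
      second_v_tensor (kropina L b c) (loc_map f c d) (N' c d) \<alpha> \<gamma> w = 0"
    if h: "h_tensor_vanishes A D L E f N" and v: "v_tensor_vanishes A D L E f N"
      and c: "c \<in> A" and d: "d \<in> E" and w: "w \<in> sub_dom (kropina_dom D b) f c d"
    for c d w \<alpha> \<gamma>
  proof -
    let ?x = "loc_map f c d"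
    let ?z = "lift ?x w"
    have K: "kropina L b c = (\<lambda>z. (L c z)\<^sup>2 / beta (b c) z)"
      and KD: "kropina_dom D b c = {z \<in> D c. beta (b c) z \<noteq> 0}"
      by (simp_all add: fun_eq_iff kropina_def kropina_dom_def)
    \<comment> \<open>The starred domain lies in the original one, so all unstarred hypotheses apply
      at w.\<close>
    have w': "w \<in> sub_dom D f c d" and z': "?z \<in> kropina_dom D b c" and u: "fst w \<in> loc_dom f c d"
      using w by (auto simp: sub_dom_def kropina_dom_def)
    then have z: "?z \<in> D c" by (simp add: kropina_dom_def)
    have F: "finsler_space X A D L" using assms(1) by (simp add: landsberg_space_def)
    interpret F: finsler_chart "D c" "L c" by (rule finsler_space_chart[OF F c])
    interpret F': finsler_chart "kropina_dom D b c" "kropina L b c"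
      by (rule finsler_space_chart[OF assms(3) c])
    obtain \<rho> where \<rho>: "\<And>z. z \<in> D c \<Longrightarrow> \<rho> z \<noteq> 0"
      "\<And>z i j. z \<in> D c \<Longrightarrow> L c z * (\<Sum>h\<in>UNIV. cartan (L c) h i j z * b c z $ h) = \<rho> z * angular (L c) i j z"
      using assms(2) c unfolding h_vector_def by blast
    have lb: "vhv_torsion (L c) r i j z = 0" if "z \<in> D c" for z r i j
      using assms(1) c that by (simp add: landsberg_space_def)
    have sb: "smooth_on (D c) (b c)" and vc: "\<And>z i k. z \<in> D c \<Longrightarrow> vcov (L c) (b c) i k z = 0"
      using assms(2) c by (simp_all add: h_vector_def covector_field_def)
    have gr: "hcov (L c) (b c) i j z = hcov (L c) (b c) j i z" if "z \<in> D c" for z i j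
      using assms(7) c that by (simp add: gradient_field_def)
    have hv: "h_chart (D c) (L c) (beta (b c))"
      "\<And>z u. z \<in> D c \<Longrightarrow> vd u (beta (b c)) z = (\<Sum>i\<in>UNIV. b c z $ i * u $ i)"
      by (rule F.h_vector_chart[OF card2, of "b c" \<rho>]; use lb sb vc \<rho> gr in blast)+
    interpret H: h_chart "D c" "L c" "beta (b c)" by (rule hv(1))
    interpret kropina_chart "D c" "L c" "beta (b c)"
    proof (rule kropina_chart.intro[OF H.h_chart_axioms])
      show "finsler_chart {z \<in> D c. beta (b c) z \<noteq> 0} (\<lambda>z. (L c z)\<^sup>2 / beta (b c) z)"
        using F'.finsler_chart_axioms by (simp only: K KD)
      show "kropina_chart_axioms (D c) (L c)"
        using F.L_nonzero_if_dim_ge_2[OF _ card2] by unfold_locales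
    qed
    have rank: "rank ((\<chi> i \<alpha>. proj ?x i \<alpha> (fst w)) :: real^'m^'n) = CARD('m)"
      using assms(4) c d u by (simp add: hypersurface_def)
    have n1: "vd (proj_vec ?x \<alpha> w) (vd (N c d w) (energy (L c))) ?z = 0" for \<alpha>
    proof -
      have "(\<Sum>i\<in>UNIV. \<Sum>j\<in>UNIV. metric (L c) i j ?z * proj ?x i \<alpha> (fst w) * N c d w $ j) = 0"
        using assms(5) c d w' unfolding unit_normal_def by blast
      then show ?thesis
        using F.metric_sum[OF z, of "proj_vec ?x \<alpha> w" "N c d w"] by (simp add: proj_vec_def)
    qed
    have n2: "vd (N c d w) (vd (N c d w) (energy (L c))) ?z = 1"
      using assms(5) c d w' unfolding unit_normal_def F.metric_sum[OF z, symmetric] by blast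
    have n3: "vd (proj_vec ?x \<alpha> w) (vd (N' c d w) (energy (kropina L b c))) ?z = 0" for \<alpha>
    proof -
      have "(\<Sum>i\<in>UNIV. \<Sum>j\<in>UNIV. metric (kropina L b c) i j ?z * proj ?x i \<alpha> (fst w) * N' c d w $ j) = 0"
        using assms(6) c d w unfolding unit_normal_def by blast
      then show ?thesis
        using F'.metric_sum[OF z', of "proj_vec ?x \<alpha> w" "N' c d w"] by (simp add: proj_vec_def)
    qed
    have tg: "vd (N c d w) (beta (b c)) ?z = 0"
      using assms(8) c d w' unfolding hv(2)[OF z] tangential_def by blast
    have "second_h_tensor (L c) ?x (N c d) \<alpha> \<gamma> w = 0"
      and "second_v_tensor (L c) ?x (N c d) \<alpha> \<gamma> w = 0" for \<alpha> \<gamma>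
      using h v c d w' by (simp_all add: h_tensor_vanishes_def v_tensor_vanishes_def)
    note vanish = star_tensors_vanish[where N = "N c d" and N' = "N' c d",
        OF z'[unfolded KD] card rank n1 n2 n3[unfolded K] tg this]
    show ?thesis unfolding K by (intro conjI vanish)
  qed
  show ?thesis
    unfolding hyperplane_second_kind_def hyperplane_third_kind_def
    using main by (simp add: h_tensor_vanishes_def[of A "kropina_dom D b"] v_tensor_vanishes_def[of A "kropina_dom D b"])
qed

end
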